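(* There exists a lattice $L\subset\mathbb R^8$ with covering density $\Theta(L)<3.2013$ whose Delone subdivision has a common refinement with the Delone subdivision of the root lattice $\mathsf E_8$.
   Context: The root lattice is $\mathsf E_8=\{\boldsymbol x\in\mathbb R^8:\ \boldsymbol x\in\mathbb Z^8\cup(\tfrac12+\mathbb Z)^8,\ \sum_{i=1}^8x_i\in2\mathbb Z\}$. A lattice in $\mathbb R^d$ is $L=A\mathbb Z^d$ with $A\in\mathsf{GL}_d(\mathbb R)$; for each such basis $A$ of $L$ the positive definite quadratic form (PQF) $Q=A^tA$, $Q[\boldsymbol x]=\boldsymbol x^tQ\boldsymbol x$, is said to be associated to $L$. The covering density is $\Theta(L)=\mu(L)^d\kappa_d/\det(L)$, where $\det(L)=|\det A|$, $\mu(L)$ is the smallest $\mu$ such that the balls of radius $\mu$ centered at the points of $L$ cover $\mathbb R^d$, and $\kappa_d=\pi^{d/2}/\Gamma(d/2+1)$. A polytope $P=\operatorname{conv}\{\boldsymbol v_1,\dots,\boldsymbol v_n\}$ with $\boldsymbol v_1,\dots,\boldsymbol v_n\in\mathbb Z^d$ is a Delone polytope of a PQF $Q$ if there are $\boldsymbol c\in\mathbb R^d$ and $r\in\mathbb R$ with $Q[\boldsymbol v_i-\boldsymbol c]=r^2$ for $i=1,\dots,n$ and $Q[\boldsymbol v-\boldsymbol c]>r^2$ for all $\boldsymbol v\in\mathbb Z^d\setminus\{\boldsymbol v_1,\dots,\boldsymbol v_n\}$. The set of all Delone polytopes of $Q$ is its Delone subdivision $\operatorname{Del}(Q)$. $\operatorname{Del}(Q')$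 is a refinement of $\operatorname{Del}(Q)$ if every Delone polytope of $Q'$ is contained in a Delone polytope of $Q$. The Delone subdivisions of two lattices $L_1,L_2$ have a common refinement if there are PQFs $Q_1,Q_2$ associated to $L_1,L_2$ respectively, and a PQF $Q''$, such that $\operatorname{Del}(Q'')$ is a refinement of both $\operatorname{Del}(Q_1)$ and $\operatorname{Del}(Q_2)$. *)

theory Defs
  imports "HOL-Analysis.Analysis"
begin

text \<open>
  The ambient space of dimension \<open>d\<close> is \<^typ>\<open>real ^ 'n\<close> with \<open>d = CARD('n)\<close>;
  vectors are columns.
\<close>

definition integer_vectors :: "(real ^ 'n::finite) set" where
  "integer_vectors = {x. \<forall>i. x $ i \<in> \<int>}"

definition lattice_basis :: "real ^ 'n ^ 'n \<Rightarrow> (real ^ 'n::finite) set \<Rightarrow> bool" where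
  "lattice_basis A L \<longleftrightarrow> invertible A \<and> L = (\<lambda>x. A *v x) ` integer_vectors"

definition is_lattice :: "(real ^ 'n::finite) set \<Rightarrow> bool" where
  "is_lattice L \<longleftrightarrow> (\<exists>A. lattice_basis A L)"

text \<open>\<open>\<bar>det A\<bar>\<close> is the same for all bases \<open>A\<close> of a lattice, so the description is proper.\<close>

definition lattice_det :: "(real ^ 'n::finite) set \<Rightarrow> real" where
  "lattice_det L = (THE D. \<exists>A. lattice_basis A L \<and> D = \<bar>det A\<bar>)"

text \<open>Balls are closed; for a lattice the least such radius exists.\<close>

definition covering_radius :: "(real ^ 'n::finite) set \<Rightarrow> real" where
  "covering_radius L = (LEAST \<mu>. (\<Union>v\<in>L. cball v \<mu>) = UNIV)"

text \<open>\<^term>\<open>unit_ball_vol d\<close> is \<open>pi powr (d / 2) / Gamma (d / 2 + 1)\<close> by definition.\<close>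

definition covering_density :: "(real ^ 'n::finite) set \<Rightarrow> real" where
  "covering_density L =
     covering_radius L ^ CARD('n) * unit_ball_vol (real CARD('n)) / lattice_det L"

definition quad_form :: "real ^ 'n ^ 'n \<Rightarrow> real ^ 'n::finite \<Rightarrow> real" where
  "quad_form Q x = x \<bullet> (Q *v x)"

definition PQF :: "real ^ 'n ^ 'n::finite \<Rightarrow> bool" where
  "PQF Q \<longleftrightarrow> transpose Q = Q \<and> (\<forall>x. x \<noteq> 0 \<longrightarrow> quad_form Q x > 0)"

definition associated_form :: "real ^ 'n ^ 'n \<Rightarrow> (real ^ 'n::finite) set \<Rightarrow> bool" where
  "associated_form Q L \<longleftrightarrow> (\<exists>A. lattice_basis A L \<and> Q = transpose A ** A)"

text \<open>Delone polytopes of every dimension, from single lattice points up to \<open>d\<close>, are included.\<close>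

definition delone_polytope :: "real ^ 'n ^ 'n \<Rightarrow> (real ^ 'n::finite) set \<Rightarrow> bool" where
  "delone_polytope Q P \<longleftrightarrow>
     (\<exists>V c r. finite V \<and> V \<noteq> {} \<and> V \<subseteq> integer_vectors \<and> P = convex hull V \<and>
        (\<forall>v\<in>V. quad_form Q (v - c) = r\<^sup>2) \<and>
        (\<forall>v\<in>integer_vectors - V. quad_form Q (v - c) > r\<^sup>2))"

definition Del :: "real ^ 'n ^ 'n \<Rightarrow> (real ^ 'n::finite) set set" where
  "Del Q = {P. delone_polytope Q P}"

definition is_refinement :: "'a set set \<Rightarrow> 'a set set \<Rightarrow> bool" where
  "is_refinement D' D \<longleftrightarrow> (\<forall>P'\<in>D'. \<exists>P\<in>D. P' \<subseteq> P)"

definition have_common_refinement ::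
    "(real ^ 'n::finite) set \<Rightarrow> (real ^ 'n) set \<Rightarrow> bool" where
  "have_common_refinement L\<^sub>1 L\<^sub>2 \<longleftrightarrow>
     (\<exists>Q\<^sub>1 Q\<^sub>2 Q. associated_form Q\<^sub>1 L\<^sub>1 \<and> associated_form Q\<^sub>2 L\<^sub>2 \<and> PQF Q \<and>
        is_refinement (Del Q) (Del Q\<^sub>1) \<and> is_refinement (Del Q) (Del Q\<^sub>2))"

definition E8 :: "(real ^ 8) set" where
  "E8 = {x. ((\<forall>i. x $ i \<in> \<int>) \<or> (\<forall>i. x $ i \<in> {1/2 + z | z. z \<in> \<int>})) \<and>
            (\<Sum>i\<in>UNIV. x $ i) \<in> {2 * z | z. z \<in> \<int>}}"

end

theory Submission
  imports Defs "HOL-Library.Multiset"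
begin

text \<open>
  The lattice is the image of the root lattice under a linear map that shrinks a plane. Let \<open>r\<close> be a root
  and \<open>s\<close> a lattice vector of squared norm 4 with \<open>r \<bullet> s = 1\<close>; the vectors \<open>r\<close> and \<open>u = 2 s - r\<close> are
  orthogonal. Measure lengths by \<open>\<bar>x\<bar>\<^sup>2 - \<beta> (r \<bullet> x)\<^sup>2 - \<gamma> (u \<bullet> x)\<^sup>2\<close>, with \<open>\<beta>\<close> and \<open>\<gamma>\<close> such that the
  squared lengths along \<open>r\<close> and \<open>u\<close> shrink to about 3/4. The determinant of the new lattice is then about 3/4,
  while its covering radius falls from 1 to about 0.936.

  The Delone cells of the root lattice are cross polytopes around the deep holes and regular simplices. A
  simplex has squared circumradius 8/9 before the deformation, only slightly more than allowed, and the
  deformation along \<open>r\<close> alone reduces it enough (\<open>variance_bound\<close>). A cross polytope is no longer inscribed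
  in a sphere after the deformation; it is cut into simplices along its shortest axis \<open>j\<close>. If \<open>q\<^sub>i\<close> is the
  value of the form on axis \<open>i\<close>, then the function \<open>q\<^sub>j + \<Sum>\<^sub>i (q\<^sub>i - q\<^sub>j) \<bar>y\<^sub>i\<bar>\<close> interpolates the form at the
  vertices of these simplices, for all sign patterns at once. Two inequalities about it carry the proof: its excess
  over the form bounds the squared distance to a nearest vertex, and all lattice points outside the cross
  polytope lie strictly above it (\<open>short_axis\<close>). The second inequality shows that a Delone polytope of the
  deformed lattice whose relative interior meets a cross polytope is contained in it, and since every facet
  of a simplex is also a facet of a cross polytope, every Delone polytope lies in a cell of the root lattice
  (\<open>E8_refinement\<close>). So the Delone subdivision of the deformed lattice is itself the common refinement.

  The 135 translation classes of deep holes are treated uniformly. In coordinates adapted to a hole the lattice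
  always looks the same, and only the deforming plane changes its position; up to symmetry there are five positions
  (\<open>profile_cases\<close>), each of which reduces to rational arithmetic. That the cells cover space
  follows from choosing a nearest deep hole and comparing it with its images under reflections
  (\<open>cross_polytope_or_simplex\<close>).
\<close>

section \<open>Covering radius and determinant of a lattice\<close>

lemma integer_vectors_diff:
  assumes "x \<in> integer_vectors" "y \<in> integer_vectors"
  shows "x - y \<in> (integer_vectors :: (real ^ 'n::finite) set)"
  using assms unfolding integer_vectors_def by auto

lemma norm_ge_1_integer_vector:
  assumes "x \<in> integer_vectors" "x \<noteq> (0 :: real ^ 'n::finite)"
  shows "1 \<le> norm x"
proof -
  obtain i where i: "x $ i \<noteq> 0" using assms(2) by (metis vec_eq_iff zero_index)
  have "x $ i \<in> \<int>" using assms(1) unfolding integer_vectors_def by auto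
  then have "1 \<le> \<bar>x $ i\<bar>" using i by (rule Ints_nonzero_abs_ge1)
  also have "\<dots> \<le> norm x" by (rule component_le_norm_cart)
  finally show ?thesis .
qed

text \<open>
  An injective linear map is bounded below, so the distance at least one between distinct integer
  vectors survives up to a factor.
\<close>

lemma lattice_uniformly_discrete:
  assumes "is_lattice (L :: (real ^ 'n::finite) set)"
  obtains e where "e > 0" "\<And>x y. x \<in> L \<Longrightarrow> y \<in> L \<Longrightarrow> dist x y < e \<Longrightarrow> x = y"
proof -
  obtain A :: "real ^ 'n ^ 'n" where A: "invertible A" "L = (\<lambda>x. A *v x) ` integer_vectors"
    using assms unfolding is_lattice_def lattice_basis_def by blast
  have inj: "inj ((*v) A)" using A(1) inj_matrix_vector_mult by blast
  obtain B where B: "B > 0" "\<And>x. B * norm x \<le> norm (A *v x)"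
    using linear_inj_bounded_below_pos[OF matrix_vector_mul_linear inj] by blast
  show thesis
  proof (rule that[OF B(1)])
    fix x y assume "x \<in> L" "y \<in> L" and d: "dist x y < B"
    then obtain a b where ab: "a \<in> integer_vectors" "b \<in> integer_vectors" "x = A *v a" "y = A *v b"
      using A(2) by auto
    show "x = y"
    proof (rule ccontr)
      assume "x \<noteq> y"
      then have "1 \<le> norm (a - b)"
        using norm_ge_1_integer_vector[OF integer_vectors_diff[OF ab(1,2)]] ab by auto
      then have "B \<le> B * norm (a - b)" using B(1) by simp
      also have "\<dots> \<le> norm (A *v (a - b))" by (rule B(2))
      finally show False using d ab by (simp add: dist_norm matrix_vector_mult_diff_distrib)
    qed
  qed
qed

lemma closed_lattice:
  assumes "is_lattice (L :: (real ^ 'n::finite) set)"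
  shows "closed L"
proof -
  obtain e where "e > 0" "\<And>x y. x \<in> L \<Longrightarrow> y \<in> L \<Longrightarrow> dist x y < e \<Longrightarrow> x = y"
    using lattice_uniformly_discrete[OF assms] by blast
  then show ?thesis by (intro discrete_imp_closed[of e L]) (metis dist_commute)+
qed

text \<open>
  The infimum of all covering radii is itself one, because in a closed set the distance to a given
  point is attained. So the \<open>LEAST\<close> in the definition exists and lies below every covering
  radius.
\<close>

lemma covering_radius_le:
  assumes L: "is_lattice (L :: (real ^ 'n::finite) set)"
    and cov: "\<And>x. \<exists>v\<in>L. dist v x \<le> \<mu>"
  shows "0 \<le> covering_radius L" "covering_radius L \<le> \<mu>"
proof -
  let ?C = "{m. (\<Union>v\<in>L. cball v m) = UNIV}"
  have mem: "m \<in> ?C \<longleftrightarrow> (\<forall>x. \<exists>v\<in>L. dist v x \<le> m)" for m :: real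
    by (auto simp: set_eq_iff)
  have mu: "\<mu> \<in> ?C" unfolding mem using cov by blast
  have pos: "0 \<le> m" if "m \<in> ?C" for m
    using that unfolding mem by (metis dist_self zero_le_dist order_trans)
  have bdd: "bdd_below ?C" using pos by (meson bdd_below.I)
  have ne: "L \<noteq> {}" using cov by blast
  have inf: "Inf ?C \<in> ?C"
    unfolding mem
  proof
    fix x
    obtain v where v: "v \<in> L" "\<And>y. y \<in> L \<Longrightarrow> dist x v \<le> dist x y"
      using distance_attains_inf[OF closed_lattice[OF L] ne] by metis
    have "dist v x \<le> m" if "m \<in> ?C" for m
      using that v unfolding mem by (metis dist_commute order_trans)
    then have "dist v x \<le> Inf ?C" using mu by (intro cInf_greatest) auto
    then show "\<exists>v\<in>L. dist v x \<le> Inf ?C" using v(1) by blast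
  qed
  have "covering_radius L = Inf ?C"
    unfolding covering_radius_def
  proof (rule Least_equality)
    show "(\<Union>v\<in>L. cball v (Inf ?C)) = UNIV" using inf by simp
    show "Inf ?C \<le> m" if "(\<Union>v\<in>L. cball v m) = UNIV" for m
      using that bdd by (intro cInf_lower) auto
  qed
  then show "0 \<le> covering_radius L" "covering_radius L \<le> \<mu>"
    using inf pos cInf_lower[OF mu bdd] by auto
qed

lemma det_Ints:
  fixes M :: "real ^ 'n ^ 'n::finite"
  assumes "\<And>i j. M $ i $ j \<in> \<int>"
  shows "det M \<in> \<int>"
  unfolding det_def by (intro Ints_sum Ints_mult Ints_prod assms) (auto simp: sign_def)

lemma axis_integer_vectors: "axis k 1 \<in> integer_vectors"
  unfolding integer_vectors_def by (auto simp: axis_def)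

text \<open>
  Each basis is an integer matrix times the other, so each determinant is an integer multiple of
  the other.
\<close>

lemma lattice_basis_det_eq:
  assumes "lattice_basis A L" "lattice_basis B (L :: (real ^ 'n::finite) set)"
  shows "\<bar>det A\<bar> = \<bar>det B\<bar>"
proof -
  have *: "\<exists>c\<in>\<int>. det B = det A * c" if "lattice_basis A L" "lattice_basis B L" for A B :: "real ^ 'n ^ 'n"
  proof -
    have A: "invertible A" "L = (\<lambda>x. A *v x) ` integer_vectors"
      and B: "L = (\<lambda>x. B *v x) ` integer_vectors"
      using that unfolding lattice_basis_def by auto
    obtain A' where A': "A ** A' = mat 1" "A' ** A = mat 1" using A(1) unfolding invertible_def by blast
    define U where "U = A' ** B"
    have AU: "B = A ** U" unfolding U_def by (simp add: matrix_mul_assoc A')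
    have "U $ i $ j \<in> \<int>" for i j
    proof -
      have "B *v axis j 1 \<in> L" unfolding B using axis_integer_vectors by blast
      then obtain z where z: "z \<in> integer_vectors" "B *v axis j 1 = A *v z" unfolding A(2) by auto
      have "U *v axis j 1 = z"
        unfolding U_def using z(2) A'(2)
        by (metis matrix_vector_mul_assoc matrix_vector_mul_lid)
      then have "U *v axis j 1 \<in> integer_vectors" using z by simp
      then have "column j U \<in> integer_vectors" by (simp add: matrix_vector_mult_basis)
      then show ?thesis unfolding integer_vectors_def column_def by simp
    qed
    then have "det U \<in> \<int>" by (rule det_Ints)
    then show ?thesis by (auto simp: AU det_mul)
  qed
  have nz: "det A \<noteq> 0" "det B \<noteq> 0"
    using assms unfolding lattice_basis_def by (auto simp: invertible_det_nz)
  obtain c where c: "c \<in> \<int>" "det B = det A * c" using *[OF assms] by blast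
  obtain d where d: "d \<in> \<int>" "det A = det B * d" using *[OF assms(2,1)] by blast
  have "c * d = 1" using c d nz by (metis mult.assoc mult_cancel_left2)
  then have cd: "\<bar>c\<bar> * \<bar>d\<bar> = 1" by (metis abs_mult abs_one)
  have "1 \<le> \<bar>c\<bar>" "1 \<le> \<bar>d\<bar>"
    using c(1) d(1) cd Ints_nonzero_abs_ge1 by fastforce+
  have "\<bar>c\<bar> * 1 \<le> \<bar>c\<bar> * \<bar>d\<bar>" using \<open>1 \<le> \<bar>d\<bar>\<close> by (intro mult_left_mono) auto
  then have "\<bar>c\<bar> = 1" using cd \<open>1 \<le> \<bar>c\<bar>\<close> by simp
  then show ?thesis by (simp add: c(2) abs_mult)
qed

lemma lattice_det_eq:
  assumes "lattice_basis A (L :: (real ^ 'n::finite) set)"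
  shows "lattice_det L = \<bar>det A\<bar>"
  unfolding lattice_det_def
  using assms lattice_basis_det_eq by (intro the_equality) blast+

section \<open>The root lattice seen from a deep hole\<close>

lemma E8_iff:
  "x \<in> E8 \<longleftrightarrow> ((\<forall>i. x $ i \<in> \<int>) \<or> (\<forall>i. x $ i - 1/2 \<in> \<int>)) \<and> (\<Sum>i\<in>UNIV. x $ i) / 2 \<in> \<int>"
proof -
  have half: "t \<in> {1/2 + z | z. z \<in> \<int>} \<longleftrightarrow> t - 1/2 \<in> \<int>" for t :: real
  proof
    show "t \<in> {1/2 + z | z. z \<in> \<int>}" if "t - 1/2 \<in> \<int>"
      using that by (intro CollectI exI[of _ "t - 1/2"]) simp
  qed auto
  have even: "t \<in> {2 * z | z. z \<in> \<int>} \<longleftrightarrow> t / 2 \<in> \<int>" for t :: real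
  proof
    show "t \<in> {2 * z | z. z \<in> \<int>}" if "t / 2 \<in> \<int>"
      using that by (intro CollectI exI[of _ "t / 2"]) simp
  qed auto
  show ?thesis unfolding E8_def half even by simp
qed

text \<open>
  This is the root lattice translated by minus the first unit vector, which is one of its deep
  holes: the sixteen vectors \<open>\<plusminus> e\<^sub>i\<close> are the lattice points nearest to the hole.
\<close>

definition odd_coset :: "(real ^ 8) set" where
  "odd_coset = {w. ((\<forall>i. w $ i \<in> \<int>) \<or> (\<forall>i. w $ i - 1/2 \<in> \<int>)) \<and> ((\<Sum>i\<in>UNIV. w $ i) - 1) / 2 \<in> \<int>}"

lemma E8_add:
  assumes "x \<in> E8" "y \<in> E8"
  shows "x + y \<in> E8"
proof -
  have s: "(\<Sum>i\<in>UNIV. (x + y) $ i) / 2 = (\<Sum>i\<in>UNIV. x $ i) / 2 + (\<Sum>i\<in>UNIV. y $ i) / 2"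
    by (simp add: sum.distrib add_divide_distrib)
  consider "\<forall>i. x $ i \<in> \<int>" "\<forall>i. y $ i \<in> \<int>" | "\<forall>i. x $ i \<in> \<int>" "\<forall>i. y $ i - 1/2 \<in> \<int>"
    | "\<forall>i. x $ i - 1/2 \<in> \<int>" "\<forall>i. y $ i \<in> \<int>" | "\<forall>i. x $ i - 1/2 \<in> \<int>" "\<forall>i. y $ i - 1/2 \<in> \<int>"
    using assms unfolding E8_iff by blast
  then have "(\<forall>i. (x + y) $ i \<in> \<int>) \<or> (\<forall>i. (x + y) $ i - 1/2 \<in> \<int>)"
  proof cases
    case 2
    have "(x + y) $ i - 1/2 = x $ i + (y $ i - 1/2)" for i by simp
    with 2 show ?thesis by (metis Ints_add)
  next
    case 3
    have "(x + y) $ i - 1/2 = (x $ i - 1/2) + y $ i" for i by simp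
    with 3 show ?thesis by (metis Ints_add)
  next
    case 4
    have "(x + y) $ i = (x $ i - 1/2) + (y $ i - 1/2) + 1" for i by simp
    with 4 show ?thesis by (metis Ints_add Ints_1)
  qed auto
  moreover have "(\<Sum>i\<in>UNIV. (x + y) $ i) / 2 \<in> \<int>"
    unfolding s using assms by (intro Ints_add) (auto simp: E8_iff)
  ultimately show ?thesis unfolding E8_iff by blast
qed

lemma E8_minus:
  assumes "x \<in> E8"
  shows "- x \<in> E8"
proof -
  have "(- x) $ i - 1/2 = - (x $ i - 1/2) - 1" for i by simp
  then have "(\<forall>i. (- x) $ i \<in> \<int>) \<or> (\<forall>i. (- x) $ i - 1/2 \<in> \<int>)"
    using assms unfolding E8_iff by (metis Ints_1 Ints_diff Ints_minus vector_uminus_component)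
  then show ?thesis using assms unfolding E8_iff by (auto simp: sum_negf)
qed

lemma E8_diff: "x \<in> E8 \<Longrightarrow> y \<in> E8 \<Longrightarrow> x - y \<in> E8"
  using E8_add[OF _ E8_minus] by fastforce

lemma E8_0: "0 \<in> E8"
  unfolding E8_iff by simp

lemma E8_of_nat_scale: "x \<in> E8 \<Longrightarrow> of_nat n *\<^sub>R x \<in> E8"
  by (induction n) (auto simp: E8_0 scaleR_left_distrib intro: E8_add)

lemma E8_Ints_scale:
  assumes "x \<in> E8" "k \<in> \<int>"
  shows "k *\<^sub>R x \<in> E8"
proof -
  obtain n where n: "k = of_nat n \<or> k = - of_nat n"
    using assms(2) by (metis Ints_cases int_cases2 of_int_minus of_int_of_nat_eq)
  then show ?thesis using E8_of_nat_scale[OF assms(1)] E8_minus by fastforce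
qed

lemma E8_inner_Ints:
  assumes "x \<in> E8" "y \<in> E8"
  shows "x \<bullet> y \<in> \<int>"
proof -
  have mixed: "x \<bullet> y \<in> \<int>"
    if "\<forall>i. x $ i \<in> \<int>" "(\<Sum>i\<in>UNIV. x $ i) / 2 \<in> \<int>" "\<forall>i. y $ i - 1/2 \<in> \<int>" for x y :: "real ^ 8"
  proof -
    have "x \<bullet> y = (\<Sum>i\<in>UNIV. x $ i * (y $ i - 1/2)) + (\<Sum>i\<in>UNIV. x $ i) / 2"
      by (simp add: inner_vec_def sum_divide_distrib flip: sum.distrib) (simp add: algebra_simps)
    then show ?thesis using that by (auto intro!: Ints_add Ints_sum Ints_mult)
  qed
  consider "\<forall>i. x $ i \<in> \<int>" "\<forall>i. y $ i \<in> \<int>" | "\<forall>i. x $ i \<in> \<int>" "\<forall>i. y $ i - 1/2 \<in> \<int>"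
    | "\<forall>i. x $ i - 1/2 \<in> \<int>" "\<forall>i. y $ i \<in> \<int>" | "\<forall>i. x $ i - 1/2 \<in> \<int>" "\<forall>i. y $ i - 1/2 \<in> \<int>"
    using assms unfolding E8_iff by blast
  then show ?thesis
  proof cases
    case 1
    then show ?thesis by (auto simp: inner_vec_def intro!: Ints_sum Ints_mult)
  next
    case 2
    then show ?thesis using mixed assms E8_iff by blast
  next
    case 3
    then show ?thesis using mixed[of y x] assms E8_iff by (metis inner_commute)
  next
    case 4
    have "x \<bullet> y = (\<Sum>i\<in>UNIV. (x $ i - 1/2) * (y $ i - 1/2) + x $ i / 2 + y $ i / 2 - 1/4)"
      by (simp add: inner_vec_def) (simp add: algebra_simps)
    also have "\<dots> = (\<Sum>i\<in>UNIV. (x $ i - 1/2) * (y $ i - 1/2))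
        + (\<Sum>i\<in>UNIV. x $ i) / 2 + (\<Sum>i\<in>UNIV. y $ i) / 2 - 2"
      by (simp add: sum.distrib sum_subtractf sum_divide_distrib)
    also have "\<dots> \<in> \<int>"
      using 4 assms[unfolded E8_iff]
      by (intro Ints_add[OF Ints_add] Ints_diff[of _ 2] Ints_sum Ints_mult Ints_numeral) blast+
    finally show ?thesis .
  qed
qed

lemma odd_coset_iff: "w \<in> odd_coset \<longleftrightarrow> w - axis k 1 \<in> E8"
proof -
  have i: "(w - axis k 1) $ i \<in> \<int> \<longleftrightarrow> w $ i \<in> \<int>" for i
    using Ints_add[of "w $ i - 1" 1] by (cases "i = k") (auto simp: axis_def)
  have h: "(w - axis k 1) $ i - 1/2 \<in> \<int> \<longleftrightarrow> w $ i - 1/2 \<in> \<int>" for i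
  proof (cases "i = k")
    case True
    then have "(w - axis k 1) $ i - 1/2 = (w $ i - 1/2) - 1" by (simp add: axis_def)
    then show ?thesis using Ints_add[of "w $ i - 1/2 - 1" 1] Ints_diff[of "w $ i - 1/2" 1]
      by (metis Ints_1 diff_add_cancel)
  qed (simp add: axis_def)
  have s: "(\<Sum>i\<in>UNIV. (w - axis k 1) $ i) = (\<Sum>i\<in>UNIV. w $ i) - 1"
    by (simp add: sum_subtractf axis_def)
  show ?thesis unfolding odd_coset_def E8_iff mem_Collect_eq i h s ..
qed

lemma odd_coset_add_E8: "w \<in> odd_coset \<Longrightarrow> x \<in> E8 \<Longrightarrow> w + x \<in> odd_coset"
  using E8_add[of "w - axis 1 1" x] unfolding odd_coset_iff[of _ 1] by (simp add: algebra_simps)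

lemma odd_coset_diff: "w \<in> odd_coset \<Longrightarrow> w' \<in> odd_coset \<Longrightarrow> w - w' \<in> E8"
  using E8_diff[of "w - axis 1 1" "w' - axis 1 1"] unfolding odd_coset_iff[of _ 1] by simp

lemma axis_odd_coset: "axis k 1 \<in> odd_coset"
  using E8_0 unfolding odd_coset_iff[of _ k] by simp

lemma two_axis_E8: "axis k 1 + axis k 1 \<in> E8"
proof -
  have "(\<Sum>i\<in>UNIV. (axis k 1 + axis k 1 :: real ^ 8) $ i) = 2"
    unfolding vector_add_component sum.distrib by (simp add: axis_def)
  then show ?thesis unfolding E8_iff by (auto simp: axis_def)
qed

lemma odd_coset_minus:
  assumes "w \<in> odd_coset"
  shows "- w \<in> odd_coset"
proof -
  have "- (w - axis 1 1) - (axis 1 1 + axis 1 1) \<in> E8"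
    by (rule E8_diff[OF E8_minus two_axis_E8]) (use assms odd_coset_iff in blast)
  then show ?thesis unfolding odd_coset_iff[of _ 1] by (simp add: algebra_simps)
qed

definition half_signs :: "real ^ 8 \<Rightarrow> bool" where
  "half_signs \<tau> \<longleftrightarrow> (\<forall>i. \<bar>\<tau> $ i\<bar> = 1/2)"

lemma half_signs_cases:
  assumes "half_signs \<tau>"
  obtains "\<tau> $ i = 1/2" | "\<tau> $ i = - (1/2)"
  using assms unfolding half_signs_def by (metis abs_eq_iff')

lemma half_signs_square:
  assumes "half_signs \<tau>"
  shows "\<tau> $ i * \<tau> $ i = 1/4"
proof -
  have "\<bar>\<tau> $ i\<bar> * \<bar>\<tau> $ i\<bar> = 1/2 * (1/2)" using assms unfolding half_signs_def by metis
  then show ?thesis by simp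
qed

lemma half_signs_Ints:
  assumes "half_signs \<tau>"
  shows "\<tau> $ i - 1/2 \<in> \<int>"
proof (cases rule: half_signs_cases[OF assms, of i])
  case 1
  show ?thesis unfolding 1 by simp
next
  case 2
  have "- (1/2) - 1/2 = (-1 :: real)" by simp
  then show ?thesis unfolding 2 by simp
qed

lemma half_signs_inner:
  assumes "half_signs \<tau>"
  shows "\<tau> \<bullet> \<tau> = 2"
  by (simp add: inner_vec_def half_signs_square[OF assms])

text \<open>
  The coordinate sum is an integer, and its parity decides.
\<close>

lemma half_signs_E8_or_odd_coset:
  assumes "half_signs \<tau>"
  shows "\<tau> \<in> E8 \<or> \<tau> \<in> odd_coset"
proof -
  note half = half_signs_Ints[OF assms]
  have "(\<Sum>i\<in>UNIV. \<tau> $ i) = (\<Sum>i\<in>UNIV. \<tau> $ i - 1/2) + 4" by (simp add: sum_subtractf)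
  also have "\<dots> \<in> \<int>" using half by (intro Ints_add Ints_sum) auto
  finally obtain n :: int where n: "(\<Sum>i\<in>UNIV. \<tau> $ i) = of_int n" by (auto elim: Ints_cases)
  show ?thesis
  proof (cases "even n")
    case True
    then obtain k where "n = 2 * k" by blast
    then have "(\<Sum>i\<in>UNIV. \<tau> $ i) / 2 = of_int k" using n by simp
    then show ?thesis using half unfolding E8_iff by auto
  next
    case False
    then obtain k where "n = 2 * k + 1" by (auto elim: oddE)
    then have "((\<Sum>i\<in>UNIV. \<tau> $ i) - 1) / 2 = of_int k" using n by simp
    then show ?thesis using half unfolding odd_coset_def by auto
  qed
qed

text \<open>
  An isometry \<open>y \<mapsto> m + U y\<close> under which the lattice looks as it does from the standard
  deep hole. Every deep hole \<open>m\<close> carries one, and the reflections below lead from one to the next.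
\<close>

definition hole_frame :: "real ^ 8 \<Rightarrow> (real ^ 8 \<Rightarrow> real ^ 8) \<Rightarrow> bool" where
  "hole_frame m U \<longleftrightarrow> orthogonal_transformation U \<and> (\<lambda>y. m + U y) ` odd_coset = E8"

lemma hole_frame_axis: "hole_frame (axis 1 1) (\<lambda>y. y)"
proof -
  have "(\<lambda>y. axis 1 1 + y) ` odd_coset = E8"
  proof (intro equalityI subsetI)
    fix x assume "x \<in> (\<lambda>y. axis 1 1 + y) ` odd_coset"
    then obtain y where "y \<in> odd_coset" "x = axis 1 1 + y" by blast
    then have "x = (y - axis 1 1) + (axis 1 1 + axis 1 1)" "y - axis 1 1 \<in> E8"
      by (auto simp: odd_coset_iff[of _ 1])
    then show "x \<in> E8" using two_axis_E8 E8_add by metis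
  next
    fix x assume "x \<in> (E8 :: (real ^ 8) set)"
    then have "x - axis 1 1 \<in> odd_coset"
      using E8_diff[OF _ two_axis_E8[of 1]] by (simp add: odd_coset_iff[of _ 1] algebra_simps)
    then show "x \<in> (\<lambda>y. axis 1 1 + y) ` odd_coset" by (intro image_eqI[of _ _ "x - axis 1 1"]) auto
  qed
  then show ?thesis unfolding hole_frame_def by simp
qed

lemma hole_frame_diff:
  assumes "hole_frame m U"
  shows "U (y - z) = U y - U z" "U (y + z) = U y + U z" "U (c *\<^sub>R y) = c *\<^sub>R U y" "U y \<bullet> U z = y \<bullet> z"
  using assms unfolding hole_frame_def orthogonal_transformation_def
  by (auto simp: linear_diff linear_add linear_scale)

lemma half_signs_inner_odd_coset:
  assumes "half_signs \<rho>" "\<rho> \<in> E8" "w \<in> odd_coset"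
  shows "\<rho> \<bullet> w - 1/2 \<in> \<int>"
proof -
  have "\<rho> \<bullet> (w - axis 1 1) \<in> \<int>"
    using assms by (intro E8_inner_Ints) (auto simp: odd_coset_iff[of _ 1])
  moreover have "\<rho> \<bullet> w - 1/2 = \<rho> \<bullet> (w - axis 1 1) + (\<rho> $ 1 - 1/2)"
    by (simp add: inner_diff_right inner_axis)
  ultimately show ?thesis using half_signs_Ints[OF assms(1), of 1] by (metis Ints_add)
qed

text \<open>
  The map is the reflection in the hyperplane \<open>\<rho> \<bullet> y = 1/2\<close>. It preserves the coset because
  it changes a point by an integer multiple of the root \<open>\<rho>\<close>.
\<close>

lemma odd_coset_reflect:
  assumes "half_signs \<rho>" "\<rho> \<in> E8" "w \<in> odd_coset"
  shows "w - (\<rho> \<bullet> w - 1/2) *\<^sub>R \<rho> \<in> odd_coset"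
proof -
  have "- ((\<rho> \<bullet> w - 1/2) *\<^sub>R \<rho>) \<in> E8"
    by (intro E8_minus E8_Ints_scale half_signs_inner_odd_coset assms)
  from odd_coset_add_E8[OF assms(3) this] show ?thesis by simp
qed

text \<open>
  The affine reflection sends the hole at the origin to \<open>\<rho> / 2\<close>, so composing with it yields the
  frame of a neighbouring hole.
\<close>

lemma hole_frame_reflect:
  assumes f: "hole_frame m U" and \<rho>: "half_signs \<rho>" "\<rho> \<in> E8"
  shows "hole_frame (m + U ((1/2) *\<^sub>R \<rho>)) (\<lambda>y. U (y - (\<rho> \<bullet> y) *\<^sub>R \<rho>))"
proof -
  define R where "R y = y - (\<rho> \<bullet> y - 1/2) *\<^sub>R \<rho>" for y
  have rr: "\<rho> \<bullet> \<rho> = 2" by (rule half_signs_inner[OF \<rho>(1)])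
  have RR: "R (R y) = y" for y
    unfolding R_def by (simp add: inner_diff_right rr algebra_simps)
  have R_image: "R ` odd_coset = odd_coset"
  proof (intro equalityI subsetI)
    fix y assume "y \<in> odd_coset"
    then have "R y \<in> odd_coset" unfolding R_def by (rule odd_coset_reflect[OF \<rho>])
    then show "y \<in> R ` odd_coset" by (intro image_eqI[of _ _ "R y"]) (simp add: RR)
  qed (use odd_coset_reflect[OF \<rho>] R_def in auto)
  have eq: "(m + U ((1/2) *\<^sub>R \<rho>)) + U (y - (\<rho> \<bullet> y) *\<^sub>R \<rho>) = m + U (R y)" for y
    unfolding R_def by (simp add: hole_frame_diff[OF f] algebra_simps)
  have "(\<lambda>y. (m + U ((1/2) *\<^sub>R \<rho>)) + U (y - (\<rho> \<bullet> y) *\<^sub>R \<rho>)) ` odd_coset = (\<lambda>y. m + U y) ` R ` odd_coset"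
    by (simp add: image_image eq)
  also have "\<dots> = E8" using f unfolding R_image hole_frame_def by simp
  finally have img: "(\<lambda>y. (m + U ((1/2) *\<^sub>R \<rho>)) + U (y - (\<rho> \<bullet> y) *\<^sub>R \<rho>)) ` odd_coset = E8" .
  have "linear (\<lambda>y. U (y - (\<rho> \<bullet> y) *\<^sub>R \<rho>))"
    by (intro linearI) (simp_all add: hole_frame_diff[OF f] inner_add_right algebra_simps)
  moreover have "U (v - (\<rho> \<bullet> v) *\<^sub>R \<rho>) \<bullet> U (w - (\<rho> \<bullet> w) *\<^sub>R \<rho>) = v \<bullet> w" for v w
    unfolding hole_frame_diff(4)[OF f]
    by (simp add: inner_diff_left inner_diff_right rr inner_commute)
  ultimately show ?thesis using img unfolding hole_frame_def orthogonal_transformation_def by blast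
qed

text \<open>
  A hole is the midpoint of two opposite lattice points. So the holes lie in half the lattice and are
  uniformly discrete, which is what makes a nearest one exist.
\<close>

lemma hole_frame_double:
  assumes "hole_frame m U"
  shows "m + m \<in> E8"
proof -
  have "m + U (axis 1 1) \<in> E8" "m + U (- axis 1 1) \<in> E8"
    using assms axis_odd_coset odd_coset_minus[OF axis_odd_coset] unfolding hole_frame_def by blast+
  then have "(m + U (axis 1 1)) + (m + U (- axis 1 1)) \<in> E8" by (rule E8_add)
  moreover have "U (- axis 1 1) = - U (axis 1 1)"
    using hole_frame_diff(3)[OF assms, of "-1" "axis 1 1"] by simp
  ultimately show ?thesis by (simp add: algebra_simps)
qed

lemma nearest_hole_frame:
  obtains m U where "hole_frame m U" "\<And>m' U'. hole_frame m' U' \<Longrightarrow> dist x m \<le> dist x m'"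
proof -
  let ?H = "{m. \<exists>U. hole_frame m U}"
  have "m = m'" if m: "m \<in> ?H" "m' \<in> ?H" and d: "dist m m' < 1/2" for m m'
  proof (rule ccontr)
    assume "m \<noteq> m'"
    define z where "z = (m + m) - (m' + m')"
    have z2: "z = 2 *\<^sub>R (m - m')" unfolding z_def by (simp add: scaleR_2)
    have "z \<in> E8" unfolding z_def using m hole_frame_double by (blast intro: E8_diff)
    then have "z \<bullet> z \<in> \<int>" by (intro E8_inner_Ints)
    moreover have "z \<bullet> z > 0" using \<open>m \<noteq> m'\<close> z2 by simp
    ultimately have "1 \<le> z \<bullet> z" using Ints_nonzero_abs_ge1[of "z \<bullet> z"] by simp
    then have "1 \<le> norm z" by (simp add: norm_eq_sqrt_inner)
    then show False using d unfolding z2 by (simp add: dist_norm)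
  qed
  then have "closed ?H" by (intro discrete_imp_closed[of "1/2"]) (auto simp: dist_commute)
  moreover have "?H \<noteq> {}" using hole_frame_axis by blast
  ultimately obtain m where "m \<in> ?H" "\<And>m'. m' \<in> ?H \<Longrightarrow> dist x m \<le> dist x m'"
    by (rule distance_attains_inf) blast
  then show thesis using that by blast
qed

text \<open>
  In the frame of a nearest hole, no reflected hole \<open>\<rho> / 2\<close> is nearer to \<open>y\<close> than the origin.
\<close>

lemma cell_coordinates:
  obtains m U y where "hole_frame m U" "x = m + U y"
    "\<forall>\<rho>\<in>E8. half_signs \<rho> \<longrightarrow> \<rho> \<bullet> y \<le> 1/2"
proof -
  obtain m U where f: "hole_frame m U"
    and near: "\<And>m' U'. hole_frame m' U' \<Longrightarrow> dist x m \<le> dist x m'"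
    using nearest_hole_frame[of x] by blast
  obtain y where y: "x - m = U y"
    using f orthogonal_transformation_surj unfolding hole_frame_def by (metis surjD)
  have "\<rho> \<bullet> y \<le> 1/2" if \<rho>: "half_signs \<rho>" "\<rho> \<in> E8" for \<rho>
  proof -
    have "dist x m \<le> dist x (m + U ((1/2) *\<^sub>R \<rho>))"
      by (rule near[OF hole_frame_reflect[OF f \<rho>]])
    then have "norm (U y) \<le> norm (U (y - (1/2) *\<^sub>R \<rho>))"
      using y by (simp add: dist_norm hole_frame_diff[OF f] algebra_simps)
    then have "U y \<bullet> U y \<le> U (y - (1/2) *\<^sub>R \<rho>) \<bullet> U (y - (1/2) *\<^sub>R \<rho>)"
      by (simp add: norm_eq_sqrt_inner)
    then have "y \<bullet> y \<le> (y - (1/2) *\<^sub>R \<rho>) \<bullet> (y - (1/2) *\<^sub>R \<rho>)"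
      unfolding hole_frame_diff(4)[OF f] .
    then show ?thesis
      by (simp add: inner_diff_left inner_diff_right half_signs_inner[OF \<rho>(1)] inner_commute)
  qed
  moreover have "x = m + U y" using y by (simp add: algebra_simps)
  ultimately show thesis using that[OF f] by blast
qed

text \<open>
  This is the Delone subdivision of the root lattice. Let \<open>\<tau>\<close> be half the sign vector of \<open>y\<close>.
  If \<open>\<tau>\<close> is a root, its inequality says that \<open>y\<close> lies in the cross polytope. Otherwise \<open>\<tau>\<close>
  is a lattice point, the apex of a simplex over a facet of the cross polytope; flipping one sign of
  \<open>\<tau>\<close> gives roots, whose inequalities make the barycentric coordinates nonnegative.
\<close>

lemma cross_polytope_or_simplex:
  assumes "\<forall>\<rho>\<in>E8. half_signs \<rho> \<longrightarrow> \<rho> \<bullet> y \<le> 1/2"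
  obtains (cross) "(\<Sum>i\<in>UNIV. \<bar>y $ i\<bar>) \<le> 1"
  | (simplex) \<tau> l l0 where "half_signs \<tau>" "\<tau> \<in> odd_coset" "\<And>i. 0 \<le> l i" "0 \<le> l0"
      "(\<Sum>i\<in>UNIV. l i) + l0 = (1 :: real)" "\<And>i. y $ i = l0 * \<tau> $ i + 2 * \<tau> $ i * l i"
proof -
  define S where "S = (\<Sum>i\<in>UNIV. \<bar>y $ i\<bar>)"
  \<comment> \<open>At a zero coordinate either sign will do.\<close>
  define \<tau> :: "real ^ 8" where "\<tau> = (\<chi> i. if 0 \<le> y $ i then 1/2 else - (1/2))"
  have \<tau>: "half_signs \<tau>" unfolding half_signs_def \<tau>_def by simp
  have ty: "\<tau> $ i * y $ i = \<bar>y $ i\<bar> / 2" "2 * \<tau> $ i * \<bar>y $ i\<bar> = y $ i" for i unfolding \<tau>_def by auto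
  have tS: "\<tau> \<bullet> y = S / 2" unfolding S_def inner_vec_def by (simp add: ty sum_divide_distrib)
  show thesis
  proof (cases "S \<le> 1")
    case True
    then show thesis using cross S_def by simp
  next
    case False
    then have "\<tau> \<notin> E8" using assms \<tau> tS by force
    then have odd: "\<tau> \<in> odd_coset" using half_signs_E8_or_odd_coset[OF \<tau>] by blast
    have ge: "(S - 1) / 2 \<le> \<bar>y $ k\<bar>" for k
    proof -
      define \<rho> where "\<rho> = \<tau> - axis k (2 * \<tau> $ k)"
      have "axis k (2 * \<tau> $ k) = axis k 1 \<or> axis k (2 * \<tau> $ k) = - axis k 1"
        by (rule half_signs_cases[OF \<tau>, of k]) (auto simp: axis_def vec_eq_iff)
      then have "\<rho> \<in> E8"
        using odd_coset_diff[OF odd axis_odd_coset[of k]]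
          odd_coset_diff[OF odd odd_coset_minus[OF axis_odd_coset[of k]]] unfolding \<rho>_def by auto
      moreover have "half_signs \<rho>"
        using \<tau> unfolding half_signs_def \<rho>_def by (auto simp: axis_def)
      ultimately have "\<rho> \<bullet> y \<le> 1/2" using assms by blast
      moreover have "\<rho> \<bullet> y = S / 2 - \<bar>y $ k\<bar>"
        unfolding \<rho>_def using tS ty(1)[of k] by (simp add: inner_diff_left inner_axis')
      ultimately show ?thesis by simp
    qed
    show thesis
    proof (rule simplex[OF \<tau> odd, of "\<lambda>i. \<bar>y $ i\<bar> - (S - 1) / 6" "(S - 1) / 3"])
      show "0 \<le> \<bar>y $ i\<bar> - (S - 1) / 6" for i using ge[of i] False by simp
      show "0 \<le> (S - 1) / 3" using False by simp
      show "(\<Sum>i\<in>UNIV. \<bar>y $ i\<bar> - (S - 1) / 6) + (S - 1) / 3 = 1"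
        by (simp add: sum_subtractf flip: S_def) (simp add: field_simps)
      show "y $ i = (S - 1) / 3 * \<tau> $ i + 2 * \<tau> $ i * (\<bar>y $ i\<bar> - (S - 1) / 6)" for i
        using ty(2)[of i] by (simp add: right_diff_distrib diff_divide_distrib) (simp add: field_simps)
    qed
  qed
qed

text \<open>
  The lattice is the set of differences of the coset.
\<close>

lemma hole_frame_pullback:
  assumes "hole_frame m U" "r \<in> E8"
  obtains r' where "r' \<in> E8" "U r' = r"
proof -
  have "m + U (axis 1 1) \<in> E8" using assms axis_odd_coset unfolding hole_frame_def by blast
  then have "m + U (axis 1 1) + r \<in> E8" using assms(2) by (rule E8_add)
  then have "m + U (axis 1 1) + r \<in> (\<lambda>y. m + U y) ` odd_coset"
    using assms(1) unfolding hole_frame_def by simp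
  then obtain w where w: "w \<in> odd_coset" "m + U w = m + U (axis 1 1) + r" by auto
  show thesis
  proof (rule that)
    show "w - axis 1 1 \<in> E8" using w odd_coset_iff by blast
    show "U (w - axis 1 1) = r" using w(2) by (simp add: hole_frame_diff[OF assms(1)] algebra_simps)
  qed
qed

section \<open>The deformed form\<close>

text \<open>
  These rationals lie close to the optimum of the two-parameter family of forms below, where three
  constraints meet: the circumradii of two kinds of simplices and \<open>2 * \<beta> + 42 * \<gamma> \<le> 1\<close>, which
  keeps the apex of a simplex outside the circumspheres of the pieces of an adjacent cross polytope. They satisfy the last
  constraint strictly, so the deformed lattice itself has a Delone subdivision that refines that of
  the root lattice.
\<close>

definition \<beta> :: real where "\<beta> = 17/135"
definition \<gamma> :: real where "\<gamma> = 7/393"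

text \<open>
  The plane spanned by \<open>r\<close> and \<open>s\<close> has an orthogonal complement that meets the lattice in a copy of
  \<open>A\<^sub>6\<close>; the deformed form shrinks this plane and keeps the complement.
\<close>

definition root_pair :: "real ^ 8 \<Rightarrow> real ^ 8 \<Rightarrow> bool" where
  "root_pair r s \<longleftrightarrow> r \<in> E8 \<and> s \<in> E8 \<and> r \<bullet> r = 2 \<and> s \<bullet> s = 4 \<and> r \<bullet> s = 1"

text \<open>
  For a root pair, the vector of the plane orthogonal to \<open>r\<close>, of squared length 14.
\<close>

definition perp :: "real ^ 8 \<Rightarrow> real ^ 8 \<Rightarrow> real ^ 8" where
  "perp r s = 2 *\<^sub>R s - r"

definition deformed_form :: "real ^ 8 \<Rightarrow> real ^ 8 \<Rightarrow> real ^ 8 \<Rightarrow> real" where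
  "deformed_form r s x = x \<bullet> x - \<beta> * (r \<bullet> x)\<^sup>2 - \<gamma> * (perp r s \<bullet> x)\<^sup>2"

lemma perp_inner:
  assumes "root_pair r s"
  shows "r \<bullet> perp r s = 0" "perp r s \<bullet> r = 0" "perp r s \<bullet> perp r s = 14"
  using assms unfolding root_pair_def perp_def
  by (simp_all add: inner_diff_left inner_diff_right inner_commute)

text \<open>
  Besides \<open>s\<close>, also \<open>s - r\<close> completes \<open>- r\<close> to a pair, with the same orthogonal vector. This
  halves the case distinction in half-integral positions.
\<close>

lemma deformed_form_swap: "deformed_form (- r) (s - r) x = deformed_form r s x"
  unfolding deformed_form_def perp_def by (simp add: algebra_simps scaleR_2)

lemma root_pair_swap:
  assumes "root_pair r s"
  shows "root_pair (- r) (s - r)"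
  using assms unfolding root_pair_def
  by (auto intro: E8_minus E8_diff simp: inner_diff_left inner_diff_right inner_commute)

text \<open>
  Bessel's inequality for \<open>r\<close> and the vector orthogonal to it; \<open>1 - 2 * \<beta>\<close> is the smallest
  eigenvalue of the form.
\<close>

lemma deformed_form_ge:
  assumes "root_pair r s"
  shows "(1 - 2 * \<beta>) * (x \<bullet> x) \<le> deformed_form r s x"
proof -
  let ?u = "perp r s" let ?P = "r \<bullet> x" let ?Q = "perp r s \<bullet> x"
  have rr: "r \<bullet> r = 2" using assms unfolding root_pair_def by simp
  let ?z = "x - (?P / 2) *\<^sub>R r - (?Q / 14) *\<^sub>R ?u"
  have rz: "r \<bullet> ?z = 0" and uz: "?u \<bullet> ?z = 0"
    using rr perp_inner[OF assms] by (simp_all add: inner_diff_right)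
  have "0 \<le> ?z \<bullet> ?z" by simp
  also have "?z \<bullet> ?z = x \<bullet> ?z" using rz uz by (simp add: inner_diff_left)
  also have "\<dots> = x \<bullet> x - ?P\<^sup>2 / 2 - ?Q\<^sup>2 / 14"
    by (simp add: inner_diff_right inner_commute power2_eq_square)
  finally have "?P\<^sup>2 / 2 + ?Q\<^sup>2 / 14 \<le> x \<bullet> x" by simp
  then have "2 * \<beta> * (?P\<^sup>2 / 2 + ?Q\<^sup>2 / 14) \<le> 2 * \<beta> * (x \<bullet> x)"
    by (intro mult_left_mono) (simp_all add: \<beta>_def)
  moreover have "\<gamma> * ?Q\<^sup>2 \<le> 2 * \<beta> * (?Q\<^sup>2 / 14)"
    using zero_le_power2[of ?Q] by (simp add: \<beta>_def \<gamma>_def)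
  ultimately show ?thesis unfolding deformed_form_def by (simp add: algebra_simps)
qed

lemma deformed_form_nonneg:
  assumes "root_pair r s"
  shows "0 \<le> deformed_form r s x"
  using order_trans[OF _ deformed_form_ge[OF assms]] by (simp add: \<beta>_def)

text \<open>
  The right-hand side is the maximum over \<open>y\<close>, attained at the vector \<open>z\<close> of the proof; the
  difference of the two sides is the form at \<open>y - z\<close>.
\<close>

lemma deformed_form_dual:
  assumes "root_pair r s"
  shows "2 * (b \<bullet> y) - deformed_form r s y
    \<le> b \<bullet> b + \<beta> / (1 - 2 * \<beta>) * (r \<bullet> b)\<^sup>2 + \<gamma> / (1 - 14 * \<gamma>) * (perp r s \<bullet> b)\<^sup>2"
proof -
  define u where "u = perp r s"
  define P where "P = r \<bullet> b"
  define Q where "Q = u \<bullet> b"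
  define \<beta>' where "\<beta>' = \<beta> / (1 - 2 * \<beta>)"
  define \<gamma>' where "\<gamma>' = \<gamma> / (1 - 14 * \<gamma>)"
  define z where "z = b + (\<beta>' * P) *\<^sub>R r + (\<gamma>' * Q) *\<^sub>R u"
  have rr: "r \<bullet> r = 2" using assms unfolding root_pair_def by simp
  note uu = perp_inner[OF assms, folded u_def]
  have eqs: "\<beta> * (1 + 2 * \<beta>') = \<beta>'" "\<gamma> * (1 + 14 * \<gamma>') = \<gamma>'"
    unfolding \<beta>'_def \<gamma>'_def \<beta>_def \<gamma>_def by simp_all
  have rz: "r \<bullet> z = (1 + 2 * \<beta>') * P" and uz: "u \<bullet> z = (1 + 14 * \<gamma>') * Q"
    unfolding z_def using rr uu by (simp_all add: inner_add_right P_def Q_def algebra_simps)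
  have brz: "\<beta> * (r \<bullet> z) = \<beta>' * P" and guz: "\<gamma> * (u \<bullet> z) = \<gamma>' * Q"
    unfolding rz uz by (simp_all add: eqs flip: mult.assoc)
  have xz: "x \<bullet> z = x \<bullet> b + \<beta>' * P * (r \<bullet> x) + \<gamma>' * Q * (u \<bullet> x)" for x
    unfolding z_def by (simp add: inner_add_right inner_commute)
  have "deformed_form r s (y - z) = deformed_form r s y - 2 * (y \<bullet> z - \<beta> * (r \<bullet> z) * (r \<bullet> y) - \<gamma> * (u \<bullet> z) * (u \<bullet> y))
      + (z \<bullet> z - \<beta> * (r \<bullet> z) * (r \<bullet> z) - \<gamma> * (u \<bullet> z) * (u \<bullet> z))"
    unfolding deformed_form_def u_def[symmetric]
    by (simp add: inner_diff_left inner_diff_right inner_commute power2_eq_square algebra_simps)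
  also have "\<dots> = deformed_form r s y - 2 * (y \<bullet> b) + z \<bullet> b"
    unfolding brz guz xz[of y] xz[of z] by simp
  also have "z \<bullet> b = b \<bullet> b + \<beta>' * P\<^sup>2 + \<gamma>' * Q\<^sup>2"
    unfolding z_def by (simp add: inner_add_left P_def Q_def power2_eq_square)
  finally have "deformed_form r s y - 2 * (y \<bullet> b) + (b \<bullet> b + \<beta>' * P\<^sup>2 + \<gamma>' * Q\<^sup>2) \<ge> 0"
    using deformed_form_nonneg[OF assms, of "y - z"] by simp
  then show ?thesis
    unfolding \<beta>'_def \<gamma>'_def P_def Q_def u_def by (simp add: inner_commute)
qed

lemma deformed_form_dual_crude:
  assumes "root_pair r s"
  shows "2 * (b \<bullet> y) - deformed_form r s y \<le> (b \<bullet> b) / (1 - 2 * \<beta>)"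
proof -
  let ?c = "1 - 2 * \<beta>"
  have c: "?c > 0" by (simp add: \<beta>_def)
  have "0 \<le> (b - ?c *\<^sub>R y) \<bullet> (b - ?c *\<^sub>R y)" by simp
  also have "\<dots> = b \<bullet> b - ?c * (2 * (b \<bullet> y)) + ?c * (?c * (y \<bullet> y))"
    by (simp add: inner_diff_left inner_diff_right inner_commute algebra_simps)
  finally have "?c * (2 * (b \<bullet> y) - ?c * (y \<bullet> y)) \<le> b \<bullet> b" by (simp add: algebra_simps)
  then have "2 * (b \<bullet> y) - ?c * (y \<bullet> y) \<le> (b \<bullet> b) / ?c"
    using c by (simp add: pos_le_divide_eq mult.commute)
  then show ?thesis using deformed_form_ge[OF assms, of y] by linarith
qed

section \<open>The five positions of the deforming plane\<close>

lemma E8_double_coordinates: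
  assumes "x \<in> E8"
  obtains a :: "8 \<Rightarrow> int" where "\<And>i. x $ i = of_int (a i) / 2" "(\<forall>i. even (a i)) \<or> (\<forall>i. odd (a i))"
proof (cases "\<forall>i. x $ i \<in> \<int>")
  case True
  then have "\<forall>i. \<exists>n. x $ i = of_int n" by (metis Ints_cases)
  then obtain n where "\<And>i. x $ i = of_int (n i)" by metis
  then show thesis using that[of "\<lambda>i. 2 * n i"] by simp
next
  case False
  then have "\<forall>i. x $ i - 1/2 \<in> \<int>" using assms E8_iff by blast
  then have "\<forall>i. \<exists>n. x $ i - 1/2 = of_int n" by (metis Ints_cases)
  then obtain n where "\<And>i. x $ i - 1/2 = of_int (n i)" by metis
  then have "x $ i = of_int (2 * n i + 1) / 2" for i
    by (simp add: field_simps)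
  then show thesis using that[of "\<lambda>i. 2 * n i + 1"] by simp
qed

text \<open>
  The diagonal entry of the form in direction \<open>i\<close> depends only on the squares; the product records
  the relative sign, so that a profile determines the pair of coordinates up to a common sign.
\<close>

definition coordinate_profile :: "real ^ 8 \<Rightarrow> real ^ 8 \<Rightarrow> 8 \<Rightarrow> real \<times> real \<times> real" where
  "coordinate_profile r s i = ((r $ i)\<^sup>2, r $ i * perp r s $ i, (perp r s $ i)\<^sup>2)"

lemma mset_eq_sum_list_replicate:
  assumes "set_mset M \<subseteq> set ps" "distinct ps"
  shows "M = sum_list (map (\<lambda>p. replicate_mset (count M p) p) ps)"
proof (rule multiset_eqI)
  fix x
  have "count (sum_list (map (\<lambda>p. replicate_mset (count M p) p) qs)) x
      = (if x \<in> set qs then count M x else 0)" if "distinct qs" for qs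
    using that by (induction qs) auto
  then show "count M x = count (sum_list (map (\<lambda>p. replicate_mset (count M p) p) ps)) x"
    using assms by (auto simp: not_in_iff)
qed

lemma abs_le_of_sum_squares:
  fixes a :: "8 \<Rightarrow> int"
  assumes "(\<Sum>i\<in>UNIV. (a i)\<^sup>2) = n" "n < (k + 1)\<^sup>2" "0 \<le> k"
  shows "\<bar>a i\<bar> \<le> k"
proof -
  have "(a i)\<^sup>2 \<le> n"
    using member_le_sum[of i UNIV "\<lambda>i. (a i)\<^sup>2"] assms(1) by simp
  then have "\<bar>a i\<bar>\<^sup>2 < (k + 1)\<^sup>2" using assms by simp
  then show ?thesis using assms(3) power_less_imp_less_base[of "\<bar>a i\<bar>" 2 "k + 1"] by simp
qed

text \<open>
  Here \<open>a\<close> and \<open>t\<close> are twice the coordinates of \<open>r\<close> and \<open>s\<close>. For each choice of parities only a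
  few triples can occur, and their multiplicities solve a linear system over the naturals.
\<close>

lemma integer_profile:
  fixes a t :: "8 \<Rightarrow> int"
  assumes a: "(\<Sum>i\<in>UNIV. (a i)\<^sup>2) = 8" and t: "(\<Sum>i\<in>UNIV. (t i)\<^sup>2) = 16"
    and at: "(\<Sum>i\<in>UNIV. a i * t i) = 4"
    and pa: "(\<forall>i. even (a i)) \<or> (\<forall>i. odd (a i))" and pt: "(\<forall>i. even (t i)) \<or> (\<forall>i. odd (t i))"
    and not_odd: "\<not> ((\<forall>i. odd (a i)) \<and> (\<forall>i. odd (t i)))"
  shows "image_mset (\<lambda>i. ((a i)\<^sup>2, a i * t i, (t i)\<^sup>2)) (mset_set UNIV) \<in>
    {{#(4,4,4), (4,0,0)#} + replicate_mset 3 (0,0,4) + replicate_mset 3 (0,0,0),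
     replicate_mset 2 (4,2,1) + {#(0,0,9)#} + replicate_mset 5 (0,0,1),
     {#(4,6,9), (4,-2,1)#} + replicate_mset 6 (0,0,1),
     {#(1,4,16)#} + replicate_mset 7 (1,0,0),
     replicate_mset 3 (1,2,4) + {#(1,-2,4)#} + replicate_mset 4 (1,0,0)}" (is "?M \<in> _")
proof -
  have ai: "\<bar>a i\<bar> \<le> 2" for i using abs_le_of_sum_squares[OF a, of 2] by simp
  have ti: "\<bar>t i\<bar> \<le> 4" for i using abs_le_of_sum_squares[OF t, of 4] by simp
  have a_cases: "a i \<in> {-2,-1,0,1,2}" for i using ai[of i] by auto
  have t_cases: "t i \<in> {-4,-3,-2,-1,0,1,2,3,4}" for i using ti[of i] by auto
  have sums: "size ?M = 8" "(\<Sum>p\<in>#?M. fst p) = 8" "(\<Sum>p\<in>#?M. fst (snd p)) = 4"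
    "(\<Sum>p\<in>#?M. snd (snd p)) = 16"
    using a t at by (simp_all add: image_mset.compositionality comp_def sum_unfold_sum_mset)
  have sub: "set_mset ?M \<subseteq> X" if "\<And>i. ((a i)\<^sup>2, a i * t i, (t i)\<^sup>2) \<in> X" for X
    using that by (auto simp only: set_image_mset image_subset_iff)
  let ?k = "\<lambda>p. count ?M p"
  have decomposition: "?M = sum_list (map (\<lambda>p. replicate_mset (?k p) p) ps)"
    "8 = sum_list (map ?k ps)" "8 = sum_list (map (\<lambda>p. int (?k p) * fst p) ps)"
    "4 = sum_list (map (\<lambda>p. int (?k p) * fst (snd p)) ps)"
    "16 = sum_list (map (\<lambda>p. int (?k p) * snd (snd p)) ps)"
    if "set_mset ?M \<subseteq> set ps" "distinct ps" for ps
  proof -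
    define k where "k = ?k"
    have M: "?M = sum_list (map (\<lambda>p. replicate_mset (k p) p) ps)"
      unfolding k_def by (rule mset_eq_sum_list_replicate[OF that])
    have img: "(\<Sum>p\<in>#sum_list (map (\<lambda>p. replicate_mset (k p) p) qs). f p)
        = sum_list (map (\<lambda>p. int (k p) * f p) qs)" for f :: "_ \<Rightarrow> int" and qs
      by (induction qs) auto
    have siz: "size (sum_list (map (\<lambda>p. replicate_mset (k p) p) qs)) = sum_list (map k qs)" for qs
      by (induction qs) auto
    show "?M = sum_list (map (\<lambda>p. replicate_mset (?k p) p) ps)" using M unfolding k_def .
    show "8 = sum_list (map ?k ps)" "8 = sum_list (map (\<lambda>p. int (?k p) * fst p) ps)"
      "4 = sum_list (map (\<lambda>p. int (?k p) * fst (snd p)) ps)"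
      "16 = sum_list (map (\<lambda>p. int (?k p) * snd (snd p)) ps)"
      using sums siz[of ps] img[of fst ps] img[of "\<lambda>p. fst (snd p)" ps] img[of "\<lambda>p. snd (snd p)" ps]
      unfolding M[symmetric] unfolding k_def by simp_all
  qed
  consider (ee) "\<forall>i. even (a i)" "\<forall>i. even (t i)" | (eo) "\<forall>i. even (a i)" "\<forall>i. odd (t i)"
    | (oe) "\<forall>i. odd (a i)" "\<forall>i. even (t i)" using pa pt not_odd by blast
  then show ?thesis
  proof cases
    case ee
    let ?ps = "[(0,0,0),(0,0,4),(0,0,16),(4,0,0),(4,4,4),(4,-4,4),(4,8,16),(4,-8,16)] :: (int \<times> int \<times> int) list"
    have "((a i)\<^sup>2, a i * t i, (t i)\<^sup>2) \<in> set ?ps" for i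
    proof -
      have "even (a i)" "even (t i)" using ee by blast+
      have "a i \<in> {-2,0,2}" using a_cases[of i] \<open>even (a i)\<close> by auto
      moreover have "t i \<in> {-4,-2,0,2,4}" using t_cases[of i] \<open>even (t i)\<close> by auto
      ultimately show ?thesis by (elim insertE emptyE) simp_all
    qed
    note D = decomposition[OF sub[OF this]]
    obtain k1 k2 k3 k4 k5 k6 k7 k8 where k: "k1 = ?k (0,0,0)" "k2 = ?k (0,0,4)" "k3 = ?k (0,0,16)"
      "k4 = ?k (4,0,0)" "k5 = ?k (4,4,4)" "k6 = ?k (4,-4,4)" "k7 = ?k (4,8,16)" "k8 = ?k (4,-8,16)" by blast
    have eqs: "k1 + k2 + k3 + k4 + k5 + k6 + k7 + k8 = 8" "k4 + k5 + k6 + k7 + k8 = 2"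
      "k5 + 2 * k7 = k6 + 2 * k8 + 1" "k2 + 4 * k3 + k5 + k6 + 4 * k7 + 4 * k8 = 4"
      using D(2-5) unfolding k by simp_all
    have "k8 = 0" using eqs by linarith
    moreover have "k7 = 0" using eqs by linarith
    moreover have "k6 = 0" using eqs calculation by linarith
    moreover have "k5 = 1" "k4 = 1" using eqs calculation by linarith+
    moreover have "k3 = 0" using eqs calculation by linarith
    moreover have "k2 = 3" "k1 = 3" using eqs calculation by linarith+
    ultimately have "?M = {#(4,4,4), (4,0,0)#} + replicate_mset 3 (0,0,4) + replicate_mset 3 (0,0,0)"
      using D(1) unfolding k by simp
    then show ?thesis by blast
  next
    case eo
    let ?ps = "[(0,0,1),(0,0,9),(4,2,1),(4,-2,1),(4,6,9),(4,-6,9)] :: (int \<times> int \<times> int) list"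
    have "((a i)\<^sup>2, a i * t i, (t i)\<^sup>2) \<in> set ?ps" for i
    proof -
      have "even (a i)" "odd (t i)" using eo by blast+
      have "a i \<in> {-2,0,2}" using a_cases[of i] \<open>even (a i)\<close> by auto
      moreover have "t i \<in> {-3,-1,1,3}" using t_cases[of i] \<open>odd (t i)\<close> by auto
      ultimately show ?thesis by (elim insertE emptyE) simp_all
    qed
    note D = decomposition[OF sub[OF this]]
    obtain k1 k2 k3 k4 k5 k6 where k: "k1 = ?k (0,0,1)" "k2 = ?k (0,0,9)" "k3 = ?k (4,2,1)"
      "k4 = ?k (4,-2,1)" "k5 = ?k (4,6,9)" "k6 = ?k (4,-6,9)" by blast
    have eqs: "k1 + k2 + k3 + k4 + k5 + k6 = 8" "k3 + k4 + k5 + k6 = 2"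
      "k3 + 3 * k5 = k4 + 3 * k6 + 2" "k1 + 9 * k2 + k3 + k4 + 9 * k5 + 9 * k6 = 16"
      using D(2-5) unfolding k by simp_all
    have "k6 = 0" using eqs by linarith
    moreover have "k5 \<le> 1" using eqs by linarith
    then consider "k5 = 0" | "k5 = 1" by linarith
    then have "k1 = 5 \<and> k2 = 1 \<and> k3 = 2 \<and> k4 = 0 \<and> k5 = 0 \<or>
      k1 = 6 \<and> k2 = 0 \<and> k3 = 0 \<and> k4 = 1 \<and> k5 = 1"
    proof cases
      case 1
      then have "k4 = 0" "k3 = 2" using eqs \<open>k6 = 0\<close> by linarith+
      then have "k2 = 1" "k1 = 5" using eqs 1 \<open>k6 = 0\<close> by linarith+
      then show ?thesis using 1 \<open>k4 = 0\<close> \<open>k3 = 2\<close> by simp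
    next
      case 2
      then have "k4 = 1" "k3 = 0" using eqs \<open>k6 = 0\<close> by linarith+
      then have "k2 = 0" "k1 = 6" using eqs 2 \<open>k6 = 0\<close> by linarith+
      then show ?thesis using 2 \<open>k4 = 1\<close> \<open>k3 = 0\<close> by simp
    qed
    ultimately have "?M = replicate_mset 2 (4,2,1) + {#(0,0,9)#} + replicate_mset 5 (0,0,1) \<or>
      ?M = {#(4,6,9), (4,-2,1)#} + replicate_mset 6 (0,0,1)"
      using D(1) unfolding k by auto
    then show ?thesis by blast
  next
    case oe
    let ?ps = "[(1,0,0),(1,2,4),(1,-2,4),(1,4,16),(1,-4,16)] :: (int \<times> int \<times> int) list"
    have "((a i)\<^sup>2, a i * t i, (t i)\<^sup>2) \<in> set ?ps" for i
    proof -
      have "odd (a i)" "even (t i)" using oe by blast+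
      have "a i \<in> {-1,1}" using a_cases[of i] \<open>odd (a i)\<close> by auto
      moreover have "t i \<in> {-4,-2,0,2,4}" using t_cases[of i] \<open>even (t i)\<close> by auto
      ultimately show ?thesis by (elim insertE emptyE) simp_all
    qed
    note D = decomposition[OF sub[OF this]]
    obtain k1 k2 k3 k4 k5 where k: "k1 = ?k (1,0,0)" "k2 = ?k (1,2,4)" "k3 = ?k (1,-2,4)"
      "k4 = ?k (1,4,16)" "k5 = ?k (1,-4,16)" by blast
    have eqs: "k1 + k2 + k3 + k4 + k5 = 8" "k2 + 2 * k4 = k3 + 2 * k5 + 2"
      "k2 + k3 + 4 * k4 + 4 * k5 = 4"
      using D(2-5) unfolding k by simp_all
    have "k5 = 0" using eqs by linarith
    moreover have "k4 \<le> 1" using eqs by linarith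
    then consider "k4 = 1" | "k4 = 0" by linarith
    then have "k1 = 7 \<and> k2 = 0 \<and> k3 = 0 \<and> k4 = 1 \<or> k1 = 4 \<and> k2 = 3 \<and> k3 = 1 \<and> k4 = 0"
    proof cases
      case 1
      then have "k2 = 0" "k3 = 0" "k1 = 7" using eqs \<open>k5 = 0\<close> by linarith+
      then show ?thesis using 1 by simp
    next
      case 2
      then have "k3 = 1" "k2 = 3" "k1 = 4" using eqs \<open>k5 = 0\<close> by linarith+
      then show ?thesis using 2 by simp
    qed
    ultimately have "?M = {#(1,4,16)#} + replicate_mset 7 (1,0,0) \<or>
      ?M = replicate_mset 3 (1,2,4) + {#(1,-2,4)#} + replicate_mset 4 (1,0,0)"
      using D(1) unfolding k by auto
    then show ?thesis by blast
  qed
qed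

text \<open>
  How the plane may lie relative to the axes of a cross polytope. In this order the five profiles
  are called alpha to epsilon in lemma names.
\<close>

definition plane_profiles :: "(real \<times> real \<times> real) multiset set" where
  "plane_profiles =
    {{#(1,1,1), (1,-1,1)#} + replicate_mset 3 (0,0,4) + replicate_mset 3 (0,0,0),
     replicate_mset 2 (1,0,0) + {#(0,0,9)#} + replicate_mset 5 (0,0,1),
     {#(1,2,4), (1,-2,4)#} + replicate_mset 6 (0,0,1),
     {#(1/4,7/4,49/4)#} + replicate_mset 7 (1/4,-1/4,1/4),
     replicate_mset 3 (1/4,3/4,9/4) + {#(1/4,-5/4,25/4)#} + replicate_mset 4 (1/4,-1/4,1/4)}"

text \<open>
  If \<open>r\<close> and \<open>s\<close> are both half-integral, the swapped pair has an integral second vector and defines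
  the same form.
\<close>

lemma profile_cases:
  assumes "root_pair r s"
  obtains r' s' where "root_pair r' s'" "deformed_form r' s' = deformed_form r s"
    "image_mset (coordinate_profile r' s') (mset_set UNIV) \<in> plane_profiles"
proof -
  have main: "image_mset (coordinate_profile r s) (mset_set UNIV) \<in> plane_profiles"
    if rs: "root_pair r s" and a: "\<And>i. r $ i = of_int (a i) / 2" "(\<forall>i. even (a i)) \<or> (\<forall>i. odd (a i))"
      and t: "\<And>i. s $ i = of_int (t i) / 2" "(\<forall>i. even (t i)) \<or> (\<forall>i. odd (t i))"
      and nodd: "\<not> ((\<forall>i. odd (a i)) \<and> (\<forall>i. odd (t i)))" for r s a t
  proof -
    define f :: "int \<times> int \<times> int \<Rightarrow> real \<times> real \<times> real"
      where "f = (\<lambda>(x, y, z). (of_int x / 4, of_int (2 * y - x) / 4, of_int (4 * z - 4 * y + x) / 4))"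
    have "real_of_int (\<Sum>i\<in>UNIV. (a i)\<^sup>2) = 4 * (r \<bullet> r)" "real_of_int (\<Sum>i\<in>UNIV. (t i)\<^sup>2) = 4 * (s \<bullet> s)"
      "real_of_int (\<Sum>i\<in>UNIV. a i * t i) = 4 * (r \<bullet> s)"
      by (simp_all add: inner_vec_def a(1) t(1) sum_distrib_left power2_eq_square)
    then have "real_of_int (\<Sum>i\<in>UNIV. (a i)\<^sup>2) = real_of_int 8" "real_of_int (\<Sum>i\<in>UNIV. (t i)\<^sup>2) = real_of_int 16"
      "real_of_int (\<Sum>i\<in>UNIV. a i * t i) = real_of_int 4"
      using rs unfolding root_pair_def by simp_all
    then have "(\<Sum>i\<in>UNIV. (a i)\<^sup>2) = 8" "(\<Sum>i\<in>UNIV. (t i)\<^sup>2) = 16" "(\<Sum>i\<in>UNIV. a i * t i) = 4"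
      unfolding of_int_eq_iff by blast+
    note int = integer_profile[OF this a(2) t(2) nodd]
    have "coordinate_profile r s = f \<circ> (\<lambda>i. ((a i)\<^sup>2, a i * t i, (t i)\<^sup>2))"
      unfolding coordinate_profile_def perp_def f_def
      by (auto simp: fun_eq_iff a(1) t(1) power2_eq_square field_simps)
    then have "image_mset (coordinate_profile r s) (mset_set UNIV)
        = image_mset f (image_mset (\<lambda>i. ((a i)\<^sup>2, a i * t i, (t i)\<^sup>2)) (mset_set UNIV))"
      by (simp add: image_mset.compositionality)
    with int show ?thesis unfolding plane_profiles_def by (elim insertE emptyE) (simp_all add: f_def)
  qed
  obtain a where a: "\<And>i. r $ i = of_int (a i) / 2" "(\<forall>i. even (a i)) \<or> (\<forall>i. odd (a i))"
    using E8_double_coordinates assms unfolding root_pair_def by metis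
  obtain t where t: "\<And>i. s $ i = of_int (t i) / 2" "(\<forall>i. even (t i)) \<or> (\<forall>i. odd (t i))"
    using E8_double_coordinates assms unfolding root_pair_def by metis
  show thesis
  proof (cases "(\<forall>i. odd (a i)) \<and> (\<forall>i. odd (t i))")
    case False
    then show thesis using that[OF assms refl] main[OF assms a t] by blast
  next
    case True
    have "image_mset (coordinate_profile (- r) (s - r)) (mset_set UNIV) \<in> plane_profiles"
      using True by (intro main[of "- r" "s - r" "\<lambda>i. - a i" "\<lambda>i. t i - a i"])
        (auto simp: a(1) t(1) root_pair_swap[OF assms] diff_divide_distrib)
    then show thesis using that[OF root_pair_swap[OF assms]] deformed_form_swap by blast
  qed
qed

section \<open>Cross polytopes under the deformed form\<close>

text \<open>
  An upper bound for the squared covering radius of the deformed lattice, just above the larger of the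
  two squared circumradii that nearly coincide (profiles alpha and epsilon).
\<close>

definition radius_sq :: real where "radius_sq = 876822 / 1000000"

lemma profile_sum:
  assumes "image_mset (coordinate_profile r s) (mset_set UNIV) = M"
  shows "(\<Sum>i\<in>UNIV. g (coordinate_profile r s i)) = (\<Sum>p\<in>#M. g p)"
  by (simp add: sum_unfold_sum_mset image_mset.compositionality comp_def flip: assms)

lemma profile_mem:
  assumes "image_mset (coordinate_profile r s) (mset_set UNIV) = M"
  shows "coordinate_profile r s i \<in># M"
  by (simp flip: assms)

lemma profile_ex:
  assumes "image_mset (coordinate_profile r s) (mset_set UNIV) = M" "p \<in># M"
  obtains i where "coordinate_profile r s i = p"
  using assms by auto

lemma profile_card:
  assumes "image_mset (coordinate_profile r s) (mset_set UNIV) = M"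
  shows "card {i. coordinate_profile r s i = p} = count M p"
  by (simp add: count_image_mset vimage_def flip: assms)

lemma deformed_form_axis:
  "deformed_form r s (axis i 1) = 1 - \<beta> * (r $ i)\<^sup>2 - \<gamma> * (perp r s $ i)\<^sup>2"
  unfolding deformed_form_def by (simp add: inner_axis)

lemma deformed_form_minus: "deformed_form r s (- x) = deformed_form r s x"
  unfolding deformed_form_def by simp

text \<open>
  The trace of the form.
\<close>

lemma sum_deformed_form_axis:
  assumes "root_pair r s"
  shows "(\<Sum>i\<in>UNIV. deformed_form r s (axis i 1)) = 8 - 2 * \<beta> - 14 * \<gamma>"
proof -
  have "(\<Sum>i\<in>UNIV. (r $ i)\<^sup>2) = 2" "(\<Sum>i\<in>UNIV. (perp r s $ i)\<^sup>2) = 14"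
    using assms perp_inner[OF assms] unfolding root_pair_def by (simp_all add: inner_vec_def power2_eq_square)
  then show ?thesis unfolding deformed_form_axis by (simp add: sum_subtractf flip: sum_distrib_left)
qed

text \<open>
  Around a deep hole the squared distances 1 and 2 belong to the vertices of the cross polytope and to
  the apices of the adjacent simplices. An integral point has odd squared norm; a half-integral point
  with an entry other than \<open>\<plusminus> 1/2\<close> has squared norm at least 4.
\<close>

lemma odd_coset_norm_cases:
  assumes w: "w \<in> odd_coset"
  obtains (axis) k where "w = axis k 1 \<or> w = - axis k 1" | (half) "half_signs w" | (far) "3 \<le> w \<bullet> w"
proof (cases "\<forall>i. w $ i \<in> \<int>")
  case True
  then have "\<forall>i. \<exists>n. w $ i = of_int n" by (metis Ints_cases)
  then obtain n :: "8 \<Rightarrow> int" where n: "\<And>i. w $ i = of_int (n i)" by metis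
  define S where "S = (\<Sum>i\<in>UNIV. n i * n i)"
  have wS: "w \<bullet> w = of_int S" unfolding S_def by (simp add: inner_vec_def n)
  obtain k where "((\<Sum>i\<in>UNIV. w $ i) - 1) / 2 = of_int k"
    using w unfolding odd_coset_def by (auto elim: Ints_cases)
  then have "real_of_int (\<Sum>i\<in>UNIV. n i) = of_int (2 * k + 1)" by (simp add: n)
  then have "(\<Sum>i\<in>UNIV. n i) = 2 * k + 1" unfolding of_int_eq_iff .
  moreover have "S - (\<Sum>i\<in>UNIV. n i) = (\<Sum>i\<in>UNIV. n i * (n i - 1))"
    unfolding S_def by (simp add: sum_subtractf algebra_simps)
  moreover have "even (\<Sum>i\<in>UNIV. n i * (n i - 1))" by (intro dvd_sum) simp
  ultimately have "odd S" by presburger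
  moreover have "0 \<le> S" unfolding S_def by (intro sum_nonneg) simp
  ultimately have "S = 1 \<or> 3 \<le> S" by presburger
  then show thesis
  proof
    assume 1: "S = 1"
    then have "\<exists>k. n k \<noteq> 0" unfolding S_def by (rule_tac ccontr) simp
    then obtain k where k: "n k \<noteq> 0" by blast
    have split: "S = n k * n k + (\<Sum>i\<in>UNIV - {k}. n i * n i)"
      unfolding S_def by (subst sum.remove[of _ k]) auto
    have "0 < (n k)\<^sup>2" using k by simp
    then have nk: "1 \<le> n k * n k" by (simp add: power2_eq_square)
    have rest: "0 \<le> (\<Sum>i\<in>UNIV - {k}. n i * n i)" by (intro sum_nonneg) simp
    have "(\<Sum>i\<in>UNIV - {k}. n i * n i) = 0" using 1 split nk rest by linarith
    then have z: "n i = 0" if "i \<noteq> k" for i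
      using that by (subst (asm) sum_nonneg_eq_0_iff) auto
    have "n k * n k = 1" using 1 split nk rest by linarith
    then have "n k = 1 \<or> n k = -1" by (metis square_eq_1_iff)
    then have "w = axis k 1 \<or> w = - axis k 1" using n z by (auto simp: vec_eq_iff axis_def)
    then show thesis by (rule axis)
  next
    assume "3 \<le> S"
    then show thesis using far wS by simp
  qed
next
  case False
  then have h: "w $ i - 1/2 \<in> \<int>" for i using w unfolding odd_coset_def by blast
  have sq: "1/4 \<le> w $ i * w $ i" "\<bar>w $ i\<bar> \<noteq> 1/2 \<Longrightarrow> 9/4 \<le> w $ i * w $ i" for i
  proof -
    obtain n where "w $ i - 1/2 = of_int n" using h[of i] by (auto elim: Ints_cases)
    then have w2: "w $ i = of_int (2 * n + 1) / 2" by (simp add: field_simps)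
    have ww: "w $ i * w $ i = of_int ((2 * n + 1) * (2 * n + 1)) / 4" unfolding w2 by simp
    have "0 \<le> n * (n + 1)" by (simp add: zero_le_mult_iff) linarith
    then have "1 \<le> (2 * n + 1) * (2 * n + 1)" by (simp add: algebra_simps)
    then show "1/4 \<le> w $ i * w $ i" unfolding ww by (simp only: divide_right_mono of_int_1_le_iff zero_le_numeral)
    show "9/4 \<le> w $ i * w $ i" if "\<bar>w $ i\<bar> \<noteq> 1/2"
    proof -
      have "n \<noteq> 0" "n \<noteq> -1" using that unfolding w2 by auto
      then have "2 \<le> n * (n + 1)"
        using mult_mono[of 1 n 2 "n + 1"] mult_mono[of 1 "- (n + 1)" 2 "- n"] by (cases "n \<ge> 1") (auto simp: algebra_simps)
      then have "9 \<le> (2 * n + 1) * (2 * n + 1)" by (simp add: algebra_simps)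
      then have "real_of_int 9 \<le> of_int ((2 * n + 1) * (2 * n + 1))" by (simp only: of_int_le_iff)
      then show ?thesis unfolding ww by simp
    qed
  qed
  show thesis
  proof (cases "half_signs w")
    case False
    then obtain k where k: "\<bar>w $ k\<bar> \<noteq> 1/2" unfolding half_signs_def by blast
    have "w \<bullet> w = w $ k * w $ k + (\<Sum>i\<in>UNIV - {k}. w $ i * w $ i)"
      unfolding inner_vec_def inner_real_def by (subst sum.remove[of _ k]) auto
    moreover have "(\<Sum>i\<in>UNIV - {k}. 1/4) \<le> (\<Sum>i\<in>UNIV - {k}. w $ i * w $ i)"
      by (intro sum_mono sq)
    moreover have "(\<Sum>i\<in>UNIV - {k}. 1/4 :: real) = 7/4" by (simp add: card_Diff_singleton)
    ultimately show thesis using sq(2)[OF k] far by simp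
  qed (rule half)
qed

text \<open>
  The deformed form has smaller values on some axes than on others, and \<open>j\<close> is a shortest one.
  Splitting the cross polytope along axis \<open>j\<close> gives simplices, and the left-hand side is the piecewise
  linear interpolation of the form at their vertices. The claim says that lattice points outside the
  cross polytope lie strictly above it, that is, outside all circumspheres. For points of squared norm
  at least 3 a crude estimate suffices; for those of squared norm 2 the interpolation only depends on
  the trace and on \<open>q j\<close>, which leaves the assumption \<open>half\<close>.
\<close>

lemma strictly_outside:
  assumes rs: "root_pair r s"
    and min: "\<And>i. q j \<le> q i" and q: "q = (\<lambda>i. deformed_form r s (axis i 1))"
    and qj: "q j \<le> 88/100" and dev: "(\<Sum>i\<in>UNIV. (q i - q j)\<^sup>2) \<le> 33/100"
    and half: "\<And>w. half_signs w \<Longrightarrow> w \<in> odd_coset \<Longrightarrow> 4 - \<beta> - 7 * \<gamma> < deformed_form r s w + 3 * q j"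
    and w: "w \<in> odd_coset" "\<And>k. w \<noteq> axis k 1" "\<And>k. w \<noteq> - axis k 1"
  shows "q j + (\<Sum>i\<in>UNIV. (q i - q j) * \<bar>w $ i\<bar>) < deformed_form r s w"
  using w(1)
proof (cases rule: odd_coset_norm_cases)
  case half
  have "(\<Sum>i\<in>UNIV. (q i - q j) * \<bar>w $ i\<bar>) = (\<Sum>i\<in>UNIV. (q i - q j) * (1/2))"
    using half unfolding half_signs_def by (intro sum.cong) metis+
  also have "\<dots> = (8 - 2 * \<beta> - 14 * \<gamma>) / 2 - 4 * q j"
    using sum_deformed_form_axis[OF rs] unfolding q by (simp add: sum_subtractf flip: sum_divide_distrib)
  also have "\<dots> = 4 - \<beta> - 7 * \<gamma> - 4 * q j" by (simp add: field_simps)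
  finally show ?thesis using assms(6)[OF half w(1)] by linarith
next
  case far
  \<comment> \<open>The factor 3/20 leaves most of the smallest eigenvalue, about 0.748, to absorb the constant terms.\<close>
  have "(q i - q j) * \<bar>w $ i\<bar> \<le> 5/3 * (q i - q j)\<^sup>2 + 3/20 * (w $ i * w $ i)" for i
  proof -
    have "0 \<le> (10 * (q i - q j) - 3 * \<bar>w $ i\<bar>)\<^sup>2" by simp
    then show ?thesis by (simp add: power2_eq_square algebra_simps)
  qed
  then have "(\<Sum>i\<in>UNIV. (q i - q j) * \<bar>w $ i\<bar>)
      \<le> (\<Sum>i\<in>UNIV. 5/3 * (q i - q j)\<^sup>2 + 3/20 * (w $ i * w $ i))" by (intro sum_mono)
  also have "\<dots> = 5/3 * (\<Sum>i\<in>UNIV. (q i - q j)\<^sup>2) + 3/20 * (w \<bullet> w)"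
    unfolding inner_vec_def inner_real_def by (simp add: sum.distrib sum_distrib_left)
  finally have "(\<Sum>i\<in>UNIV. (q i - q j) * \<bar>w $ i\<bar>) \<le> 55/100 + 3/20 * (w \<bullet> w)" using dev by simp
  moreover have "(1 - 2 * \<beta>) * (w \<bullet> w) \<le> deformed_form r s w" by (rule deformed_form_ge[OF rs])
  ultimately show ?thesis using far qj unfolding \<beta>_def by simp
qed (use w in auto)

text \<open>
  An axis along which the cross polytope may be split into simplices: it is shortest, the squared
  circumradii are bounded by \<^const>\<open>radius_sq\<close>, and all other lattice points lie outside the
  circumspheres. The circumradius bound is expressed through the difference of interpolation and
  form: with the signs of \<open>y\<close> fixed, the maximum of this difference over all of space is the squared
  circumradius.
\<close>

definition short_axis :: "real ^ 8 \<Rightarrow> real ^ 8 \<Rightarrow> 8 \<Rightarrow> bool" where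
  "short_axis r s j \<longleftrightarrow>
    (\<forall>i. deformed_form r s (axis j 1) \<le> deformed_form r s (axis i 1)) \<and>
    (\<forall>y. deformed_form r s (axis j 1)
        + (\<Sum>i\<in>UNIV. (deformed_form r s (axis i 1) - deformed_form r s (axis j 1)) * \<bar>y $ i\<bar>) - deformed_form r s y \<le> radius_sq) \<and>
    (\<forall>w\<in>odd_coset. (\<forall>k. w \<noteq> axis k 1 \<and> w \<noteq> - axis k 1) \<longrightarrow>
      deformed_form r s (axis j 1)
        + (\<Sum>i\<in>UNIV. (deformed_form r s (axis i 1) - deformed_form r s (axis j 1)) * \<bar>w $ i\<bar>) < deformed_form r s w)"

lemma signed_vector:
  fixes d :: "8 \<Rightarrow> real" and y :: "real ^ 8"
  defines "b \<equiv> \<chi> i. d i * sgn (y $ i) / 2"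
  shows "2 * (b \<bullet> y) = (\<Sum>i\<in>UNIV. d i * \<bar>y $ i\<bar>)" "b \<bullet> b \<le> (\<Sum>i\<in>UNIV. (d i)\<^sup>2) / 4"
proof -
  show "2 * (b \<bullet> y) = (\<Sum>i\<in>UNIV. d i * \<bar>y $ i\<bar>)"
    unfolding b_def inner_vec_def
    by (simp add: sum_distrib_left abs_sgn mult_ac)
  have "b $ i * b $ i \<le> (d i)\<^sup>2 / 4" for i
    unfolding b_def by (auto simp: sgn_if power2_eq_square)
  then show "b \<bullet> b \<le> (\<Sum>i\<in>UNIV. (d i)\<^sup>2) / 4"
    unfolding inner_vec_def inner_real_def sum_divide_distrib by (intro sum_mono)
qed

lemma short_axisI:
  assumes rs: "root_pair r s" and q: "q = (\<lambda>i. deformed_form r s (axis i 1))"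
    and min: "\<And>i. q j \<le> q i" and qj: "q j \<le> 88/100"
    and dev: "(\<Sum>i\<in>UNIV. (q i - q j)\<^sup>2) \<le> 33/100"
    and half: "\<And>w. half_signs w \<Longrightarrow> w \<in> odd_coset \<Longrightarrow> 4 - \<beta> - 7 * \<gamma> < deformed_form r s w + 3 * q j"
    and cover: "\<And>y b. b = (\<chi> i. (q i - q j) * sgn (y $ i) / 2) \<Longrightarrow>
      q j + (2 * (b \<bullet> y) - deformed_form r s y) \<le> radius_sq"
  shows "short_axis r s j"
  unfolding short_axis_def
proof (intro conjI allI ballI impI)
  show "deformed_form r s (axis j 1) \<le> deformed_form r s (axis i 1)" for i using min unfolding q .
next
  fix y
  show "deformed_form r s (axis j 1)
    + (\<Sum>i\<in>UNIV. (deformed_form r s (axis i 1) - deformed_form r s (axis j 1)) * \<bar>y $ i\<bar>) - deformed_form r s y \<le> radius_sq"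
    using cover[OF refl, of y] unfolding signed_vector(1) unfolding q by simp
next
  fix w assume "w \<in> odd_coset" "\<forall>k. w \<noteq> axis k 1 \<and> w \<noteq> - axis k 1"
  then show "deformed_form r s (axis j 1)
    + (\<Sum>i\<in>UNIV. (deformed_form r s (axis i 1) - deformed_form r s (axis j 1)) * \<bar>w $ i\<bar>) < deformed_form r s w"
    using strictly_outside[OF rs min q qj dev half] unfolding q by blast
qed

text \<open>
  Four of the five profiles have a shortest axis so long that the smallest eigenvalue decides.
\<close>

lemma half_signs_outside_if_long:
  assumes "root_pair r s" "8/10 \<le> (q :: real)" "half_signs w"
  shows "4 - \<beta> - 7 * \<gamma> < deformed_form r s w + 3 * q"
  using deformed_form_ge[OF assms(1), of w] half_signs_inner[OF assms(3)] assms(2)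
  unfolding \<beta>_def \<gamma>_def by simp

lemma cover_crude:
  assumes rs: "root_pair r s" and num: "c + D / (4 * (1 - 2 * \<beta>)) \<le> radius_sq"
    and D: "(\<Sum>i\<in>UNIV. (d i)\<^sup>2) \<le> D" and b: "b = (\<chi> i. d i * sgn (y $ i) / 2)"
  shows "c + (2 * (b \<bullet> y) - deformed_form r s y) \<le> radius_sq"
proof -
  have "b \<bullet> b \<le> D / 4" unfolding b using signed_vector(2)[of d y] D by linarith
  then have "(b \<bullet> b) / (1 - 2 * \<beta>) \<le> D / 4 / (1 - 2 * \<beta>)"
    by (intro divide_right_mono) (simp_all add: \<beta>_def)
  then show ?thesis using deformed_form_dual_crude[OF rs, of b y] num by simp
qed

lemma profile_weight:
  "deformed_form r s (axis i 1) = (\<lambda>(x, y, z). 1 - \<beta> * x - \<gamma> * z) (coordinate_profile r s i)"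
  unfolding deformed_form_axis coordinate_profile_def by simp

lemma cofactor_of_quarter_square:
  assumes "(x :: real)\<^sup>2 = 1/4" "x * u = c / 4"
  shows "u = c * x"
proof -
  have "u = 4 * (x\<^sup>2 * u)" unfolding assms(1) by simp
  also have "\<dots> = 4 * (x * (x * u))" by (simp add: power2_eq_square)
  finally show ?thesis unfolding assms(2) by simp
qed

lemma short_axis_beta_type:
  assumes rs: "root_pair r s" and M: "image_mset (coordinate_profile r s) (mset_set UNIV)
    = replicate_mset 2 (1,0,0) + {#(0,0,9)#} + replicate_mset 5 (0,0,1)" (is "_ = ?M")
  shows "\<exists>j. short_axis r s j"
proof -
  define q where "q = (\<lambda>i. deformed_form r s (axis i 1))"
  obtain j where j: "coordinate_profile r s j = (0,0,9)" using profile_ex[OF M, of "(0,0,9)"] by auto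
  have qj: "q j = 1 - 9 * \<gamma>" unfolding q_def profile_weight j by simp
  have dev: "(\<Sum>i\<in>UNIV. (q i - q j)\<^sup>2) = 2 * (9 * \<gamma> - \<beta>)\<^sup>2 + 5 * (8 * \<gamma>)\<^sup>2"
    unfolding qj unfolding q_def profile_weight
      profile_sum[OF M, of "\<lambda>p. ((case p of (x, y, z) \<Rightarrow> 1 - \<beta> * x - \<gamma> * z) - (1 - 9 * \<gamma>))\<^sup>2"]
    by (simp add: power2_eq_square algebra_simps)
  have "short_axis r s j"
  proof (rule short_axisI[OF rs q_def])
    show "q j \<le> q i" for i
      using profile_mem[OF M, of i] unfolding qj unfolding q_def profile_weight
      by (auto simp: in_replicate_mset \<beta>_def \<gamma>_def)
    show "q j \<le> 88/100" unfolding qj \<gamma>_def by simp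
    show "(\<Sum>i\<in>UNIV. (q i - q j)\<^sup>2) \<le> 33/100" unfolding dev \<beta>_def \<gamma>_def by (simp add: power2_eq_square)
    show "4 - \<beta> - 7 * \<gamma> < deformed_form r s w + 3 * q j" if "half_signs w" for w
      by (rule half_signs_outside_if_long[OF rs _ that]) (simp add: qj \<gamma>_def)
    show "q j + (2 * (b \<bullet> y) - deformed_form r s y) \<le> radius_sq" if "b = (\<chi> i. (q i - q j) * sgn (y $ i) / 2)" for y b
      by (rule cover_crude[OF rs _ eq_refl[OF dev] that])
        (simp add: qj \<beta>_def \<gamma>_def radius_sq_def power2_eq_square)
  qed
  then show ?thesis by blast
qed

lemma short_axis_gamma_type:
  assumes rs: "root_pair r s" and M: "image_mset (coordinate_profile r s) (mset_set UNIV)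
    = {#(1,2,4), (1,-2,4)#} + replicate_mset 6 (0,0,1)" (is "_ = ?M")
  shows "\<exists>j. short_axis r s j"
proof -
  define q where "q = (\<lambda>i. deformed_form r s (axis i 1))"
  obtain j where j: "coordinate_profile r s j = (1,2,4)" using profile_ex[OF M, of "(1,2,4)"] by auto
  have qj: "q j = 1 - \<beta> - 4 * \<gamma>" unfolding q_def profile_weight j by simp
  have dev: "(\<Sum>i\<in>UNIV. (q i - q j)\<^sup>2) = 6 * (\<beta> + 3 * \<gamma>)\<^sup>2"
    unfolding qj unfolding q_def profile_weight
      profile_sum[OF M, of "\<lambda>p. ((case p of (x, y, z) \<Rightarrow> 1 - \<beta> * x - \<gamma> * z) - (1 - \<beta> - 4 * \<gamma>))\<^sup>2"]
    by (simp add: power2_eq_square algebra_simps)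
  have "short_axis r s j"
  proof (rule short_axisI[OF rs q_def])
    show "q j \<le> q i" for i
      using profile_mem[OF M, of i] unfolding qj unfolding q_def profile_weight
      by (auto simp: in_replicate_mset \<beta>_def \<gamma>_def)
    show "q j \<le> 88/100" unfolding qj \<beta>_def \<gamma>_def by simp
    show "(\<Sum>i\<in>UNIV. (q i - q j)\<^sup>2) \<le> 33/100" unfolding dev \<beta>_def \<gamma>_def by (simp add: power2_eq_square)
    show "4 - \<beta> - 7 * \<gamma> < deformed_form r s w + 3 * q j" if "half_signs w" for w
      by (rule half_signs_outside_if_long[OF rs _ that]) (simp add: qj \<beta>_def \<gamma>_def)
    show "q j + (2 * (b \<bullet> y) - deformed_form r s y) \<le> radius_sq" if "b = (\<chi> i. (q i - q j) * sgn (y $ i) / 2)" for y b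
      by (rule cover_crude[OF rs _ eq_refl[OF dev] that])
        (simp add: qj \<beta>_def \<gamma>_def radius_sq_def power2_eq_square)
  qed
  then show ?thesis by blast
qed

text \<open>
  The one profile for which a neighbouring apex \<open>w\<close> comes close to the circumsphere. Both
  \<open>r \<bullet> w\<close> and its companion are confined to a few values; the extreme pair \<open>3/2\<close>, \<open>7/2\<close> leaves the
  slack \<open>1 - 2 * \<beta> - 42 * \<gamma>\<close>.
\<close>

lemma short_axis_delta_type:
  assumes rs: "root_pair r s" and M: "image_mset (coordinate_profile r s) (mset_set UNIV)
    = {#(1/4,7/4,49/4)#} + replicate_mset 7 (1/4,-1/4,1/4)" (is "_ = ?M")
  shows "\<exists>j. short_axis r s j"
proof -
  define q where "q = (\<lambda>i. deformed_form r s (axis i 1))"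
  let ?u = "perp r s"
  obtain j where j: "coordinate_profile r s j = (1/4,7/4,49/4)"
    using profile_ex[OF M, of "(1/4,7/4,49/4)"] by auto
  have qj: "q j = 1 - \<beta> / 4 - 49 / 4 * \<gamma>" unfolding q_def profile_weight j by simp
  have dev: "(\<Sum>i\<in>UNIV. (q i - q j)\<^sup>2) = 7 * (12 * \<gamma>)\<^sup>2"
    unfolding qj unfolding q_def profile_weight
      profile_sum[OF M, of "\<lambda>p. ((case p of (x, y, z) \<Rightarrow> 1 - \<beta> * x - \<gamma> * z) - (1 - \<beta> / 4 - 49 / 4 * \<gamma>))\<^sup>2"]
    by (simp add: power2_eq_square field_simps)
  have "card {i. coordinate_profile r s i = (1/4,7/4,49/4)} = 1" using profile_card[OF M] by simp
  then obtain j' where "{i. coordinate_profile r s i = (1/4,7/4,49/4)} = {j'}" by (rule card_1_singletonE)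
  then have "coordinate_profile r s i \<noteq> (1/4,7/4,49/4)" if "i \<noteq> j" for i
    using that j by (metis (mono_tags, lifting) mem_Collect_eq singletonD)
  then have others: "coordinate_profile r s i = (1/4,-1/4,1/4)" if "i \<noteq> j" for i
    using that profile_mem[OF M, of i] by (force simp: in_replicate_mset)
  have u: "?u = axis j (8 * r $ j) - r"
  proof (rule vec_eq_iff[THEN iffD2], rule allI)
    fix i
    show "?u $ i = (axis j (8 * r $ j) - r) $ i"
    proof (cases "i = j")
      case True
      have "(r $ j)\<^sup>2 = 1/4" "r $ j * ?u $ j = 7/4" using j unfolding coordinate_profile_def by simp_all
      then have "?u $ j = 7 * r $ j" using cofactor_of_quarter_square[of "r $ j" "?u $ j" 7] by simp
      then show ?thesis using True by simp
    next
      case False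
      have "(r $ i)\<^sup>2 = 1/4" "r $ i * ?u $ i = - (1/4)"
        using others[OF False] unfolding coordinate_profile_def by simp_all
      then have "?u $ i = - (r $ i)" using cofactor_of_quarter_square[of "r $ i" "?u $ i" "-1"] by simp
      then show ?thesis using False by (simp add: axis_def)
    qed
  qed
  have "short_axis r s j"
  proof (rule short_axisI[OF rs q_def])
    show "q j \<le> q i" for i
      using profile_mem[OF M, of i] unfolding qj unfolding q_def profile_weight
      by (auto simp: in_replicate_mset \<beta>_def \<gamma>_def)
    show "q j \<le> 88/100" unfolding qj \<beta>_def \<gamma>_def by simp
    show "(\<Sum>i\<in>UNIV. (q i - q j)\<^sup>2) \<le> 33/100" unfolding dev \<beta>_def \<gamma>_def by (simp add: power2_eq_square)
    show "4 - \<beta> - 7 * \<gamma> < deformed_form r s w + 3 * q j" if w: "half_signs w" "w \<in> odd_coset" for w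
    proof -
      define x where "x = r \<bullet> w"
      define t where "t = 8 * r $ j * w $ j"
      have rj: "\<bar>r $ j\<bar> = 1/2"
      proof -
        have "\<bar>r $ j\<bar>\<^sup>2 = (1/2)\<^sup>2" using j unfolding coordinate_profile_def by (simp add: power2_eq_square)
        then show ?thesis by (rule power2_eq_imp_eq) simp_all
      qed
      have wj: "\<bar>w $ j\<bar> = 1/2" using w unfolding half_signs_def by blast
      have t: "\<bar>t\<bar> = 2" unfolding t_def abs_mult rj wj by simp
      have ut: "?u \<bullet> w = t - x" unfolding u x_def t_def by (simp add: inner_diff_left inner_axis')
      have "r \<bullet> (w - axis j 1) \<in> \<int>"
        using rs w(2) odd_coset_iff unfolding root_pair_def by (intro E8_inner_Ints) auto
      then obtain n where "x - r $ j = of_int n"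
        unfolding x_def by (auto simp: inner_diff_right inner_axis elim: Ints_cases)
      then have n: "x = r $ j + of_int n" by simp
      have "x\<^sup>2 \<le> 4"
        using Cauchy_Schwarz_ineq[of r w] rs half_signs_inner[OF w(1)]
        unfolding x_def root_pair_def by (simp add: power2_eq_square)
      then have "\<bar>x\<bar> \<le> 2" using power2_le_imp_le[of "\<bar>x\<bar>" 2] by simp
      then have "\<bar>x\<bar> \<le> 3/2"
      proof -
        have "r $ j = 1/2 \<or> r $ j = - (1/2)" using rj by linarith
        then show ?thesis
        proof
          assume e: "r $ j = 1/2"
          have "n < 2" "-3 < n" using \<open>\<bar>x\<bar> \<le> 2\<close> unfolding n e by linarith+
          then have "n \<le> 1" "-2 \<le> n" by linarith+
          then have "real_of_int n \<le> 1" "-2 \<le> real_of_int n" by linarith+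
          then show ?thesis unfolding n e by linarith
        next
          assume e: "r $ j = - (1/2)"
          have "n < 3" "-2 < n" using \<open>\<bar>x\<bar> \<le> 2\<close> unfolding n e by linarith+
          then have "n \<le> 2" "-1 \<le> n" by linarith+
          then have "real_of_int n \<le> 2" "-1 \<le> real_of_int n" by linarith+
          then show ?thesis unfolding n e by linarith
        qed
      qed
      have "\<bar>t - x\<bar> \<le> 7/2" using t \<open>\<bar>x\<bar> \<le> 3/2\<close> by linarith
      have "x\<^sup>2 \<le> (3/2)\<^sup>2" "(t - x)\<^sup>2 \<le> (7/2)\<^sup>2"
        using power_mono[OF \<open>\<bar>x\<bar> \<le> 3/2\<close>, of 2] power_mono[OF \<open>\<bar>t - x\<bar> \<le> 7/2\<close>, of 2] by simp_all
      then have "\<beta> * x\<^sup>2 \<le> \<beta> * (9/4)" "\<gamma> * (t - x)\<^sup>2 \<le> \<gamma> * (49/4)"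
        by (simp_all add: \<beta>_def \<gamma>_def power2_eq_square)
      then have "2 - \<beta> * (9/4) - \<gamma> * (49/4) \<le> deformed_form r s w"
        unfolding deformed_form_def ut half_signs_inner[OF w(1)] x_def[symmetric] by linarith
      then show ?thesis unfolding qj \<beta>_def \<gamma>_def by simp
    qed
    show "q j + (2 * (b \<bullet> y) - deformed_form r s y) \<le> radius_sq" if "b = (\<chi> i. (q i - q j) * sgn (y $ i) / 2)" for y b
      by (rule cover_crude[OF rs _ eq_refl[OF dev] that])
        (simp add: qj \<beta>_def \<gamma>_def radius_sq_def power2_eq_square)
  qed
  then show ?thesis by blast
qed

text \<open>
  Here the circumradius is nearly the covering radius, so the exact dual bound is needed. Where \<open>r\<close> has
  a nonzero coordinate the axis is itself shortest, hence \<open>b\<close> is orthogonal to \<open>r\<close>.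
\<close>

lemma short_axis_alpha_type:
  assumes rs: "root_pair r s" and M: "image_mset (coordinate_profile r s) (mset_set UNIV)
    = {#(1,1,1), (1,-1,1)#} + replicate_mset 3 (0,0,4) + replicate_mset 3 (0,0,0)" (is "_ = ?M")
  shows "\<exists>j. short_axis r s j"
proof -
  define q where "q = (\<lambda>i. deformed_form r s (axis i 1))"
  let ?u = "perp r s"
  obtain j where j: "coordinate_profile r s j = (1,1,1)" using profile_ex[OF M, of "(1,1,1)"] by auto
  have qj: "q j = 1 - \<beta> - \<gamma>" unfolding q_def profile_weight j by simp
  have dev: "(\<Sum>i\<in>UNIV. (q i - q j)\<^sup>2) = 3 * (\<beta> - 3 * \<gamma>)\<^sup>2 + 3 * (\<beta> + \<gamma>)\<^sup>2"
    unfolding qj unfolding q_def profile_weight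
      profile_sum[OF M, of "\<lambda>p. ((case p of (x, y, z) \<Rightarrow> 1 - \<beta> * x - \<gamma> * z) - (1 - \<beta> - \<gamma>))\<^sup>2"]
    by (simp add: power2_eq_square algebra_simps)
  have "short_axis r s j"
  proof (rule short_axisI[OF rs q_def])
    show "q j \<le> q i" for i
      using profile_mem[OF M, of i] unfolding qj unfolding q_def profile_weight
      by (auto simp: in_replicate_mset \<beta>_def \<gamma>_def)
    show "q j \<le> 88/100" unfolding qj \<beta>_def \<gamma>_def by simp
    show "(\<Sum>i\<in>UNIV. (q i - q j)\<^sup>2) \<le> 33/100" unfolding dev \<beta>_def \<gamma>_def by (simp add: power2_eq_square)
    show "4 - \<beta> - 7 * \<gamma> < deformed_form r s w + 3 * q j" if "half_signs w" for w
      by (rule half_signs_outside_if_long[OF rs _ that]) (simp add: qj \<beta>_def \<gamma>_def)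
    show "q j + (2 * (b \<bullet> y) - deformed_form r s y) \<le> radius_sq" if b: "b = (\<chi> i. (q i - q j) * sgn (y $ i) / 2)" for y b
    proof -
      let ?g = "\<lambda>p :: real \<times> real \<times> real. if p = (0,0,4) then \<beta> - 3 * \<gamma> else 0"
      have coord: "r $ i * b $ i = 0 \<and> \<bar>?u $ i * b $ i\<bar> \<le> ?g (coordinate_profile r s i)" for i
      proof -
        have qi: "q i = (\<lambda>(x, y, z). 1 - \<beta> * x - \<gamma> * z) (coordinate_profile r s i)"
          unfolding q_def profile_weight ..
        have bi: "\<bar>b $ i\<bar> \<le> \<bar>q i - q j\<bar> / 2" unfolding b by (simp add: abs_mult sgn_if)
        consider "coordinate_profile r s i = (1,1,1) \<or> coordinate_profile r s i = (1,-1,1)"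
          | "coordinate_profile r s i = (0,0,4)" | "coordinate_profile r s i = (0,0,0)"
          using profile_mem[OF M, of i] by (auto simp: in_replicate_mset)
        then show ?thesis
        proof cases
          case 1
          then have "q i = q j" unfolding qi qj by auto
          then have "b $ i = 0" using bi by simp
          then show ?thesis using 1 by auto
        next
          case 2
          then have "q i - q j = \<beta> - 3 * \<gamma>" unfolding qi qj by simp
          then have bi': "\<bar>b $ i\<bar> \<le> (\<beta> - 3 * \<gamma>) / 2" using bi by (simp add: \<beta>_def \<gamma>_def)
          have "r $ i = 0" "(?u $ i)\<^sup>2 = 4" using 2 unfolding coordinate_profile_def by auto
          moreover have "\<bar>?u $ i\<bar> = 2"
          proof -
            have "\<bar>?u $ i\<bar>\<^sup>2 = 2\<^sup>2" using \<open>(?u $ i)\<^sup>2 = 4\<close> by simp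
            then show ?thesis by (rule power2_eq_imp_eq) simp_all
          qed
          ultimately show ?thesis using bi' 2 by (simp add: abs_mult)
        next
          case 3
          then have "r $ i = 0" "?u $ i = 0" unfolding coordinate_profile_def by auto
          then show ?thesis using 3 by simp
        qed
      qed
      have rb: "r \<bullet> b = 0"
        unfolding inner_vec_def inner_real_def using coord by (intro sum.neutral) blast
      have "\<bar>?u \<bullet> b\<bar> \<le> (\<Sum>i\<in>UNIV. ?g (coordinate_profile r s i))"
        unfolding inner_vec_def inner_real_def using coord by (intro order_trans[OF sum_abs] sum_mono) blast
      also have "\<dots> = 3 * (\<beta> - 3 * \<gamma>)" unfolding profile_sum[OF M, of ?g] by simp
      finally have "\<bar>?u \<bullet> b\<bar> \<le> \<bar>3 * (\<beta> - 3 * \<gamma>)\<bar>" by simp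
      then have "(?u \<bullet> b)\<^sup>2 \<le> (3 * (\<beta> - 3 * \<gamma>))\<^sup>2" unfolding abs_le_square_iff .
      then have "\<gamma> / (1 - 14 * \<gamma>) * (?u \<bullet> b)\<^sup>2 \<le> \<gamma> / (1 - 14 * \<gamma>) * (3 * (\<beta> - 3 * \<gamma>))\<^sup>2"
        by (intro mult_left_mono) (simp_all add: \<gamma>_def)
      moreover have "b \<bullet> b \<le> (3 * (\<beta> - 3 * \<gamma>)\<^sup>2 + 3 * (\<beta> + \<gamma>)\<^sup>2) / 4"
        unfolding b using signed_vector(2)[of "\<lambda>i. q i - q j" y] dev by simp
      moreover have "q j + ((3 * (\<beta> - 3 * \<gamma>)\<^sup>2 + 3 * (\<beta> + \<gamma>)\<^sup>2) / 4
          + \<gamma> / (1 - 14 * \<gamma>) * (3 * (\<beta> - 3 * \<gamma>))\<^sup>2) \<le> radius_sq"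
        unfolding qj \<beta>_def \<gamma>_def radius_sq_def by (simp add: power2_eq_square)
      moreover have "2 * (b \<bullet> y) - deformed_form r s y \<le> b \<bullet> b + \<gamma> / (1 - 14 * \<gamma>) * (?u \<bullet> b)\<^sup>2"
        using deformed_form_dual[OF rs, of b y] unfolding rb by simp
      ultimately show ?thesis by linarith
    qed
  qed
  then show ?thesis by blast
qed

text \<open>
  The second nearly extremal circumradius. The inner products of \<open>b\<close> with \<open>r\<close> and its companion cannot be
  large at the same time; in terms of the two partial sums \<open>X\<close> and \<open>Y\<close> of signs the bound is a quadratic
  form with nonnegative coefficients.
\<close>

lemma short_axis_epsilon_type:
  assumes rs: "root_pair r s" and M: "image_mset (coordinate_profile r s) (mset_set UNIV)
    = replicate_mset 3 (1/4,3/4,9/4) + {#(1/4,-5/4,25/4)#} + replicate_mset 4 (1/4,-1/4,1/4)" (is "_ = ?M")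
  shows "\<exists>j. short_axis r s j"
proof -
  define q where "q = (\<lambda>i. deformed_form r s (axis i 1))"
  let ?u = "perp r s"
  obtain j where j: "coordinate_profile r s j = (1/4,-5/4,25/4)"
    using profile_ex[OF M, of "(1/4,-5/4,25/4)"] by auto
  have qj: "q j = 1 - \<beta> / 4 - 25 / 4 * \<gamma>" unfolding q_def profile_weight j by simp
  have dev: "(\<Sum>i\<in>UNIV. (q i - q j)\<^sup>2) = 3 * (4 * \<gamma>)\<^sup>2 + 4 * (6 * \<gamma>)\<^sup>2"
    unfolding qj unfolding q_def profile_weight
      profile_sum[OF M, of "\<lambda>p. ((case p of (x, y, z) \<Rightarrow> 1 - \<beta> * x - \<gamma> * z) - (1 - \<beta> / 4 - 25 / 4 * \<gamma>))\<^sup>2"]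
    by (simp add: power2_eq_square field_simps)
  have "short_axis r s j"
  proof (rule short_axisI[OF rs q_def])
    show "q j \<le> q i" for i
      using profile_mem[OF M, of i] unfolding qj unfolding q_def profile_weight
      by (auto simp: in_replicate_mset \<beta>_def \<gamma>_def)
    show "q j \<le> 88/100" unfolding qj \<beta>_def \<gamma>_def by simp
    show "(\<Sum>i\<in>UNIV. (q i - q j)\<^sup>2) \<le> 33/100" unfolding dev \<beta>_def \<gamma>_def by (simp add: power2_eq_square)
    show "4 - \<beta> - 7 * \<gamma> < deformed_form r s w + 3 * q j" if "half_signs w" for w
      by (rule half_signs_outside_if_long[OF rs _ that]) (simp add: qj \<beta>_def \<gamma>_def)
    show "q j + (2 * (b \<bullet> y) - deformed_form r s y) \<le> radius_sq" if b: "b = (\<chi> i. (q i - q j) * sgn (y $ i) / 2)" for y b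
    proof -
      define I where "I = {i. coordinate_profile r s i = (1/4,3/4,9/4)}"
      define J where "J = {i. coordinate_profile r s i = (1/4,-1/4,1/4)}"
      have card: "card I = 3" "card J = 4" unfolding I_def J_def profile_card[OF M] by simp_all
      define e where "e i = 2 * r $ i * sgn (y $ i)" for i
      have prof: "i \<in> I \<or> i \<in> J \<or> coordinate_profile r s i = (1/4,-5/4,25/4)" for i
        using profile_mem[OF M, of i] by (auto simp: I_def J_def in_replicate_mset)
      have disj: "I \<inter> J = {}" unfolding I_def J_def by auto
      have r2: "(r $ i)\<^sup>2 = 1/4" for i
        using profile_mem[OF M, of i] unfolding coordinate_profile_def by (auto simp: in_replicate_mset)
      have e_le: "\<bar>e i\<bar> \<le> 1" for i
      proof -
        have "\<bar>r $ i\<bar>\<^sup>2 = (1/2)\<^sup>2" using r2[of i] by (simp add: power2_eq_square)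
        then have "\<bar>r $ i\<bar> = 1/2" by (rule power2_eq_imp_eq) simp_all
        then show ?thesis unfolding e_def by (simp add: abs_mult sgn_if)
      qed
      have b_i: "b $ i = (q i - q j) * sgn (y $ i) / 2" for i unfolding b by simp
      have rb_i: "r $ i * b $ i = (if i \<in> I then \<gamma> * e i else 0) + (if i \<in> J then 3/2 * \<gamma> * e i else 0)"
        and ub_i: "?u $ i * b $ i = (if i \<in> I then 3 * \<gamma> * e i else 0) + (if i \<in> J then - (3/2) * \<gamma> * e i else 0)" for i
      proof -
        have qi: "q i = (\<lambda>(x, y, z). 1 - \<beta> * x - \<gamma> * z) (coordinate_profile r s i)"
          unfolding q_def profile_weight ..
        consider "i \<in> I" "i \<notin> J" | "i \<in> J" "i \<notin> I" | "i \<notin> I" "i \<notin> J" "coordinate_profile r s i = (1/4,-5/4,25/4)"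
          using prof[of i] disj by (auto simp: I_def J_def)
        then have "r $ i * b $ i = (if i \<in> I then \<gamma> * e i else 0) + (if i \<in> J then 3/2 * \<gamma> * e i else 0) \<and>
          ?u $ i * b $ i = (if i \<in> I then 3 * \<gamma> * e i else 0) + (if i \<in> J then - (3/2) * \<gamma> * e i else 0)"
        proof cases
          case 1
          then have p: "coordinate_profile r s i = (1/4,3/4,9/4)" unfolding I_def by simp
          then have "q i - q j = 4 * \<gamma>" unfolding qi qj by simp
          moreover have "r $ i * ?u $ i = 3/4" using p unfolding coordinate_profile_def by simp
          then have "?u $ i = 3 * r $ i" using cofactor_of_quarter_square[OF r2[of i], of "?u $ i" 3] by simp
          ultimately show ?thesis using 1 unfolding b_i e_def by simp
        next
          case 2
          then have p: "coordinate_profile r s i = (1/4,-1/4,1/4)" unfolding J_def by simp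
          then have "q i - q j = 6 * \<gamma>" unfolding qi qj by simp
          moreover have "r $ i * ?u $ i = - (1/4)" using p unfolding coordinate_profile_def by simp
          then have "?u $ i = - (r $ i)" using cofactor_of_quarter_square[OF r2[of i], of "?u $ i" "-1"] by simp
          ultimately show ?thesis using 2 unfolding b_i e_def by simp
        next
          case 3
          then have "q i - q j = 0" unfolding qi qj by simp
          then show ?thesis using 3 unfolding b_i by simp
        qed
        then show "r $ i * b $ i = (if i \<in> I then \<gamma> * e i else 0) + (if i \<in> J then 3/2 * \<gamma> * e i else 0)"
          "?u $ i * b $ i = (if i \<in> I then 3 * \<gamma> * e i else 0) + (if i \<in> J then - (3/2) * \<gamma> * e i else 0)" by blast+
      qed
      define X where "X = (\<Sum>i\<in>I. e i)"
      define Y where "Y = (\<Sum>i\<in>J. e i)"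
      have restrict: "(\<Sum>i\<in>UNIV. if i \<in> K then c * e i else 0) = c * (\<Sum>i\<in>K. e i)" for K c
        by (simp add: sum_distrib_left flip: sum.inter_filter)
      have rb: "r \<bullet> b = \<gamma> * (X + 3/2 * Y)"
        unfolding inner_vec_def inner_real_def rb_i sum.distrib restrict X_def Y_def by (simp add: algebra_simps)
      have ub: "?u \<bullet> b = \<gamma> * (3 * X - 3/2 * Y)"
        unfolding inner_vec_def inner_real_def ub_i sum.distrib restrict X_def Y_def by (simp add: algebra_simps)
      have XY: "\<bar>X\<bar> \<le> 3" "\<bar>Y\<bar> \<le> 4"
      proof -
        have "\<bar>\<Sum>i\<in>K. e i\<bar> \<le> real (card K)" for K
          using order_trans[OF sum_abs[of e K] sum_bounded_above[of K "\<lambda>i. \<bar>e i\<bar>" 1]] e_le by simp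
        from this[of I] this[of J] show "\<bar>X\<bar> \<le> 3" "\<bar>Y\<bar> \<le> 4" unfolding X_def Y_def card by simp_all
      qed
      have X2: "X\<^sup>2 \<le> 9" and Y2: "Y\<^sup>2 \<le> 16"
        using power_mono[OF XY(1), of 2] power_mono[OF XY(2), of 2] by simp_all
      have XY12: "X * Y \<le> 12"
      proof -
        have "X * Y \<le> \<bar>X\<bar> * \<bar>Y\<bar>" by (simp flip: abs_mult)
        also have "\<dots> \<le> 3 * 4" using XY by (intro mult_mono) auto
        finally show ?thesis by simp
      qed
      define \<beta>' where "\<beta>' = \<beta> / (1 - 2 * \<beta>)"
      define \<gamma>' where "\<gamma>' = \<gamma> / (1 - 14 * \<gamma>)"
      have pos: "0 \<le> \<beta>' + 9 * \<gamma>'" "0 \<le> 3 * \<beta>' - 9 * \<gamma>'" "0 \<le> 9/4 * (\<beta>' + \<gamma>')"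
        unfolding \<beta>'_def \<gamma>'_def \<beta>_def \<gamma>_def by simp_all
      have "\<beta>' * (r \<bullet> b)\<^sup>2 + \<gamma>' * (?u \<bullet> b)\<^sup>2
          = \<gamma>\<^sup>2 * ((\<beta>' + 9 * \<gamma>') * X\<^sup>2 + (3 * \<beta>' - 9 * \<gamma>') * (X * Y) + 9/4 * (\<beta>' + \<gamma>') * Y\<^sup>2)"
        unfolding rb ub by (simp add: power2_eq_square algebra_simps)
      also have "\<dots> \<le> \<gamma>\<^sup>2 * ((\<beta>' + 9 * \<gamma>') * 9 + (3 * \<beta>' - 9 * \<gamma>') * 12 + 9/4 * (\<beta>' + \<gamma>') * 16)"
        using pos X2 Y2 XY12 by (intro mult_left_mono add_mono) auto
      finally have "\<beta>' * (r \<bullet> b)\<^sup>2 + \<gamma>' * (?u \<bullet> b)\<^sup>2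
        \<le> \<gamma>\<^sup>2 * ((\<beta>' + 9 * \<gamma>') * 9 + (3 * \<beta>' - 9 * \<gamma>') * 12 + 9/4 * (\<beta>' + \<gamma>') * 16)" .
      moreover have "b \<bullet> b \<le> (3 * (4 * \<gamma>)\<^sup>2 + 4 * (6 * \<gamma>)\<^sup>2) / 4"
        unfolding b using signed_vector(2)[of "\<lambda>i. q i - q j" y] dev by simp
      moreover have "q j + ((3 * (4 * \<gamma>)\<^sup>2 + 4 * (6 * \<gamma>)\<^sup>2) / 4
          + \<gamma>\<^sup>2 * ((\<beta>' + 9 * \<gamma>') * 9 + (3 * \<beta>' - 9 * \<gamma>') * 12 + 9/4 * (\<beta>' + \<gamma>') * 16)) \<le> radius_sq"
        unfolding qj \<beta>'_def \<gamma>'_def \<beta>_def \<gamma>_def radius_sq_def by (simp add: power2_eq_square)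
      moreover note deformed_form_dual[OF rs, of b y, folded \<beta>'_def \<gamma>'_def]
      ultimately show ?thesis by linarith
    qed
  qed
  then show ?thesis by blast
qed

lemma short_axis_exists:
  assumes "root_pair r s"
  obtains j where "short_axis r s j"
proof -
  obtain r' s' where rs: "root_pair r' s'" and eq: "deformed_form r' s' = deformed_form r s"
    and M: "image_mset (coordinate_profile r' s') (mset_set UNIV) \<in> plane_profiles"
    using profile_cases[OF assms] by blast
  have "\<exists>j. short_axis r' s' j"
    using M short_axis_alpha_type[OF rs] short_axis_beta_type[OF rs] short_axis_gamma_type[OF rs]
      short_axis_delta_type[OF rs] short_axis_epsilon_type[OF rs]
    unfolding plane_profiles_def by blast
  then show thesis using that eq unfolding short_axis_def by auto
qed

section \<open>Weighted averages of the deformed form\<close>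

lemma exists_le_average:
  fixes f :: "'a \<Rightarrow> real"
  assumes "finite I" "\<And>k. k \<in> I \<Longrightarrow> 0 \<le> w k" "(\<Sum>k\<in>I. w k) = 1"
  shows "\<exists>k\<in>I. f k \<le> (\<Sum>k\<in>I. w k * f k)"
proof (rule ccontr)
  let ?A = "\<Sum>k\<in>I. w k * f k"
  assume "\<not> ?thesis"
  then have gt: "?A < f k" if "k \<in> I" for k using that by force
  have "(\<Sum>k\<in>I. w k * (f k - ?A)) = ?A - (\<Sum>k\<in>I. w k) * ?A"
    by (simp add: right_diff_distrib sum_subtractf sum_distrib_right)
  then have "(\<Sum>k\<in>I. w k * (f k - ?A)) = 0" using assms(3) by simp
  then have "w k * (f k - ?A) = 0" if "k \<in> I" for k
    using that assms(1,2) gt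
    by (subst (asm) sum_nonneg_eq_0_iff) (auto intro!: mult_nonneg_nonneg intro: less_imp_le)
  then have "w k = 0" if "k \<in> I" for k using gt[OF that] that by fastforce
  then show False using assms(3) by simp
qed

definition deformed_polar :: "real ^ 8 \<Rightarrow> real ^ 8 \<Rightarrow> real ^ 8 \<Rightarrow> real ^ 8 \<Rightarrow> real" where
  "deformed_polar r s x y = x \<bullet> y - \<beta> * (r \<bullet> x) * (r \<bullet> y) - \<gamma> * (perp r s \<bullet> x) * (perp r s \<bullet> y)"

text \<open>
  Because the weights sum to one, the dependence on the centre \<open>c\<close> is the same for every combination
  with barycentre \<open>y\<close>. So two combinations of the same point can be compared without knowing \<open>c\<close>.
\<close>

lemma deformed_form_average:
  assumes "(\<Sum>k\<in>I. w k) = 1" "(\<Sum>k\<in>I. w k *\<^sub>R v k) = y"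
  shows "(\<Sum>k\<in>I. w k * deformed_form r s (v k - c))
    = (\<Sum>k\<in>I. w k * deformed_form r s (v k)) - 2 * deformed_polar r s y c + deformed_form r s c"
proof -
  have inner: "z \<bullet> y = (\<Sum>k\<in>I. w k * (z \<bullet> v k))" for z
    by (simp add: inner_sum_right flip: assms(2))
  have "w k * deformed_form r s (v k - c) = w k * deformed_form r s (v k)
      - 2 * (w k * (c \<bullet> v k) - \<beta> * (r \<bullet> c) * (w k * (r \<bullet> v k))
        - \<gamma> * (perp r s \<bullet> c) * (w k * (perp r s \<bullet> v k))) + w k * deformed_form r s c" for k
    unfolding deformed_form_def
    by (simp add: inner_diff_left inner_diff_right inner_commute power2_eq_square algebra_simps)
  then have "(\<Sum>k\<in>I. w k * deformed_form r s (v k - c)) = (\<Sum>k\<in>I. w k * deformed_form r s (v k))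
      - 2 * (c \<bullet> y - \<beta> * (r \<bullet> c) * (r \<bullet> y) - \<gamma> * (perp r s \<bullet> c) * (perp r s \<bullet> y))
      + (\<Sum>k\<in>I. w k) * deformed_form r s c"
    unfolding inner by (simp add: sum.distrib sum_subtractf sum_distrib_right flip: sum_distrib_left)
  then show ?thesis unfolding assms(1) deformed_polar_def by (simp add: inner_commute mult_ac)
qed

lemma deformed_polar_self: "deformed_polar r s y y = deformed_form r s y"
  unfolding deformed_polar_def deformed_form_def by (simp add: power2_eq_square)

section \<open>Covering and emptiness for cross polytopes\<close>

definition cross_vertices :: "(real ^ 8) set" where
  "cross_vertices = {w. \<exists>k. w = axis k 1 \<or> w = - axis k 1}"

lemma cross_vertices_odd_coset: "w \<in> cross_vertices \<Longrightarrow> w \<in> odd_coset"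
  unfolding cross_vertices_def using axis_odd_coset odd_coset_minus by auto

lemma finite_cross_vertices: "finite cross_vertices"
proof -
  have "cross_vertices = range (\<lambda>k. axis k 1) \<union> range (\<lambda>k. - axis k 1)"
    unfolding cross_vertices_def by auto
  then show ?thesis by (metis finite_Un finite_imageI finite_class.finite_UNIV)
qed

text \<open>
  The weight missing from \<open>\<Sum> \<bar>y\<^sub>i\<bar>\<close> is shared equally by the two ends of axis \<open>j\<close>, which does not
  move the barycentre.
\<close>

lemma cross_combination:
  assumes "(\<Sum>i\<in>UNIV. \<bar>y $ i\<bar>) \<le> 1"
  obtains w :: "8 \<times> bool \<Rightarrow> real" and v where "\<And>k. 0 \<le> w k" "(\<Sum>k\<in>UNIV. w k) = 1"
    "(\<Sum>k\<in>UNIV. w k *\<^sub>R v k) = y" "\<And>k. v k \<in> cross_vertices"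
    "(\<Sum>k\<in>UNIV. w k * deformed_form r s (v k)) = deformed_form r s (axis j 1)
      + (\<Sum>i\<in>UNIV. (deformed_form r s (axis i 1) - deformed_form r s (axis j 1)) * \<bar>y $ i\<bar>)"
proof -
  define h where "h = (1 - (\<Sum>i\<in>UNIV. \<bar>y $ i\<bar>)) / 2"
  define w :: "8 \<times> bool \<Rightarrow> real" where "w = (\<lambda>(i, b).
    (if b then max (y $ i) 0 else max (- (y $ i)) 0) + (if i = j then h else 0))"
  define v :: "8 \<times> bool \<Rightarrow> real ^ 8" where "v = (\<lambda>(i, b). if b then axis i 1 else - axis i 1)"
  have split: "(\<Sum>k\<in>UNIV. f k) = (\<Sum>i\<in>UNIV. f (i, True) + f (i, False))"
    for f :: "8 \<times> bool \<Rightarrow> 'a :: comm_monoid_add"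
  proof -
    have "(\<Sum>k\<in>UNIV. f k) = (\<Sum>i\<in>UNIV. \<Sum>b\<in>UNIV. f (i, b))"
      unfolding sum.cartesian_product by simp
    then show ?thesis by (simp add: UNIV_bool add.commute)
  qed
  show thesis
  proof (rule that[of w v])
    show "0 \<le> w k" for k using assms unfolding w_def h_def by (auto split: prod.splits)
    have "(\<Sum>k\<in>UNIV. w k) = (\<Sum>i\<in>UNIV. \<bar>y $ i\<bar> + (if i = j then 2 * h else 0))"
      unfolding split w_def by (intro sum.cong) (auto simp: max_def)
    then show "(\<Sum>k\<in>UNIV. w k) = 1" unfolding h_def by (simp add: sum.distrib field_simps)
    have "(\<Sum>k\<in>UNIV. w k *\<^sub>R v k) = (\<Sum>i\<in>UNIV. axis i (y $ i))"
      unfolding split w_def v_def by (intro sum.cong) (auto simp: max_def axis_def vec_eq_iff)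
    also have "\<dots> = y" by (simp add: vec_eq_iff axis_def)
    finally show "(\<Sum>k\<in>UNIV. w k *\<^sub>R v k) = y" .
    show "v k \<in> cross_vertices" for k unfolding v_def cross_vertices_def by (auto split: prod.splits)
    have "(\<Sum>k\<in>UNIV. w k * deformed_form r s (v k))
        = (\<Sum>i\<in>UNIV. deformed_form r s (axis i 1) * \<bar>y $ i\<bar> + (if i = j then 2 * h * deformed_form r s (axis j 1) else 0))"
      unfolding split w_def v_def by (intro sum.cong) (auto simp: max_def deformed_form_minus algebra_simps)
    also have "\<dots> = (\<Sum>i\<in>UNIV. deformed_form r s (axis i 1) * \<bar>y $ i\<bar>) + 2 * h * deformed_form r s (axis j 1)"
      by (simp add: sum.distrib)
    also have "\<dots> = deformed_form r s (axis j 1)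
      + (\<Sum>i\<in>UNIV. (deformed_form r s (axis i 1) - deformed_form r s (axis j 1)) * \<bar>y $ i\<bar>)"
    proof -
      have h2: "2 * h = 1 - (\<Sum>i\<in>UNIV. \<bar>y $ i\<bar>)" unfolding h_def by simp
      show ?thesis
        unfolding h2 by (simp add: left_diff_distrib right_diff_distrib sum_subtractf sum_distrib_left mult_ac)
    qed
    finally show "(\<Sum>k\<in>UNIV. w k * deformed_form r s (v k)) = deformed_form r s (axis j 1)
      + (\<Sum>i\<in>UNIV. (deformed_form r s (axis i 1) - deformed_form r s (axis j 1)) * \<bar>y $ i\<bar>)" .
  qed
qed

text \<open>
  A weighted average of the squared distances from \<open>y\<close> to the vertices is at most the bound, hence one
  of these distances is.
\<close>

lemma cross_cover:
  assumes rs: "root_pair r s" and y: "(\<Sum>i\<in>UNIV. \<bar>y $ i\<bar>) \<le> 1"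
  obtains w where "w \<in> odd_coset" "deformed_form r s (w - y) \<le> radius_sq"
proof -
  obtain j where j: "short_axis r s j" using short_axis_exists[OF rs] .
  obtain w v where w: "\<And>k :: 8 \<times> bool. 0 \<le> w k" "(\<Sum>k\<in>UNIV. w k) = 1"
    "(\<Sum>k\<in>UNIV. w k *\<^sub>R v k) = y" "\<And>k. v k \<in> cross_vertices"
    and q: "(\<Sum>k\<in>UNIV. w k * deformed_form r s (v k)) = deformed_form r s (axis j 1)
      + (\<Sum>i\<in>UNIV. (deformed_form r s (axis i 1) - deformed_form r s (axis j 1)) * \<bar>y $ i\<bar>)"
    using cross_combination[OF y, of r s j] by blast
  obtain k where "deformed_form r s (v k - y) \<le> (\<Sum>k\<in>UNIV. w k * deformed_form r s (v k - y))"
    using exists_le_average[of UNIV w "\<lambda>k. deformed_form r s (v k - y)"] w by auto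
  also have "\<dots> = (\<Sum>k\<in>UNIV. w k * deformed_form r s (v k)) - deformed_form r s y"
    using deformed_form_average[OF w(2,3), of r s y] deformed_polar_self[of r s y] by simp
  also have "\<dots> \<le> radius_sq" unfolding q using j unfolding short_axis_def by blast
  finally show thesis using that w(4) cross_vertices_odd_coset by blast
qed

text \<open>
  The vertex sets of Delone polytopes, for a form given as a function. The value \<open>R\<close> is the squared
  radius of the empty sphere.
\<close>

definition delone_vertices :: "'a set \<Rightarrow> ('a::real_vector \<Rightarrow> real) \<Rightarrow> 'a set \<Rightarrow> bool" where
  "delone_vertices L f V \<longleftrightarrow> finite V \<and> V \<noteq> {} \<and> V \<subseteq> L \<and>
    (\<exists>c R. (\<forall>v\<in>V. f (v - c) = R) \<and> (\<forall>v\<in>L - V. R < f (v - c)))"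

text \<open>
  The vertices of the cross polytope lie on or outside the empty sphere of \<open>V\<close>. Writing \<open>y\<close> once as a
  combination of them and once of \<open>V\<close>, the average of the form over \<open>V\<close> is therefore at most the
  interpolation at \<open>y\<close>. By convexity the latter is at most the average of the interpolation over \<open>V\<close>,
  and a point of \<open>V\<close> outside the cross polytope would make that strictly smaller than the average of
  the form.
\<close>

lemma delone_vertices_cross:
  assumes rs: "root_pair r s" and V: "delone_vertices odd_coset (deformed_form r s) V"
    and \<nu>: "\<And>v. v \<in> V \<Longrightarrow> 0 < \<nu> v" "(\<Sum>v\<in>V. \<nu> v) = 1" "(\<Sum>v\<in>V. \<nu> v *\<^sub>R v) = y"
    and y: "(\<Sum>i\<in>UNIV. \<bar>y $ i\<bar>) \<le> 1"
  shows "V \<subseteq> cross_vertices"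
proof (rule ccontr)
  assume "\<not> V \<subseteq> cross_vertices"
  then obtain v0 where v0: "v0 \<in> V" "v0 \<notin> cross_vertices" by blast
  obtain c R where on: "\<And>v. v \<in> V \<Longrightarrow> deformed_form r s (v - c) = R"
    and out: "\<And>v. v \<in> odd_coset - V \<Longrightarrow> R < deformed_form r s (v - c)"
    and fin: "finite V" and sub: "V \<subseteq> odd_coset"
    using V unfolding delone_vertices_def by blast
  obtain j where j: "short_axis r s j" using short_axis_exists[OF rs] .
  define g where "g x = deformed_form r s (axis j 1)
    + (\<Sum>i\<in>UNIV. (deformed_form r s (axis i 1) - deformed_form r s (axis j 1)) * \<bar>x $ i\<bar>)" for x :: "real ^ 8"
  obtain w v where w: "\<And>k :: 8 \<times> bool. 0 \<le> w k" "(\<Sum>k\<in>UNIV. w k) = 1"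
    "(\<Sum>k\<in>UNIV. w k *\<^sub>R v k) = y" "\<And>k. v k \<in> cross_vertices"
    and q: "(\<Sum>k\<in>UNIV. w k * deformed_form r s (v k)) = g y"
    using cross_combination[OF y, of r s j] unfolding g_def by blast
  have "R \<le> deformed_form r s (v k - c)" for k
    using on out cross_vertices_odd_coset[OF w(4)] by (metis DiffI less_imp_le order_refl)
  then have "(\<Sum>k\<in>UNIV. w k * R) \<le> (\<Sum>k\<in>UNIV. w k * deformed_form r s (v k - c))"
    using w(1) by (intro sum_mono mult_left_mono)
  then have 1: "R \<le> g y - 2 * deformed_polar r s y c + deformed_form r s c"
    unfolding deformed_form_average[OF w(2,3)] q using w(2) by (simp flip: sum_distrib_right)
  have "(\<Sum>x\<in>V. \<nu> x * deformed_form r s (x - c)) = (\<Sum>x\<in>V. \<nu> x * R)" using on by simp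
  then have 2: "(\<Sum>x\<in>V. \<nu> x * deformed_form r s x) - 2 * deformed_polar r s y c + deformed_form r s c = R"
    unfolding deformed_form_average[OF \<nu>(2,3)] using \<nu>(2) by (simp flip: sum_distrib_right)
  have "g y \<le> (\<Sum>x\<in>V. \<nu> x * g x)"
  proof -
    have "\<bar>y $ i\<bar> \<le> (\<Sum>x\<in>V. \<nu> x * \<bar>x $ i\<bar>)" for i
    proof -
      have "y $ i = (\<Sum>x\<in>V. \<nu> x * x $ i)" by (simp flip: \<nu>(3))
      then have "\<bar>y $ i\<bar> \<le> (\<Sum>x\<in>V. \<bar>\<nu> x * x $ i\<bar>)" by (simp add: sum_abs)
      also have "\<dots> = (\<Sum>x\<in>V. \<nu> x * \<bar>x $ i\<bar>)"
        using \<nu>(1) by (intro sum.cong) (auto simp: abs_mult less_imp_le)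
      finally show ?thesis .
    qed
    then have "g y \<le> deformed_form r s (axis j 1)
      + (\<Sum>i\<in>UNIV. (deformed_form r s (axis i 1) - deformed_form r s (axis j 1)) * (\<Sum>x\<in>V. \<nu> x * \<bar>x $ i\<bar>))"
      unfolding g_def using j unfolding short_axis_def
      by (intro add_left_mono sum_mono mult_left_mono) auto
    also have "\<dots> = (\<Sum>x\<in>V. \<nu> x) * deformed_form r s (axis j 1)
      + (\<Sum>i\<in>UNIV. \<Sum>x\<in>V. \<nu> x * ((deformed_form r s (axis i 1) - deformed_form r s (axis j 1)) * \<bar>x $ i\<bar>))"
      unfolding \<nu>(2) by (simp add: sum_distrib_left sum_distrib_right mult_ac)
    also have "\<dots> = (\<Sum>x\<in>V. \<nu> x * g x)"
      unfolding g_def by (subst sum.swap) (simp add: sum_distrib_left sum_distrib_right distrib_left sum.distrib)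
    finally show ?thesis .
  qed
  moreover have "(\<Sum>x\<in>V. \<nu> x * g x) < (\<Sum>x\<in>V. \<nu> x * deformed_form r s x)"
  proof (rule sum_strict_mono_ex1[OF fin])
    have le: "g x < deformed_form r s x" if "x \<in> V" "x \<notin> cross_vertices" for x
      using j that sub unfolding short_axis_def g_def cross_vertices_def by blast
    have eq: "g x = deformed_form r s x" if x: "x \<in> cross_vertices" for x
    proof -
      obtain k where "x = axis k 1 \<or> x = - axis k 1" using x unfolding cross_vertices_def by blast
      then have "\<bar>x $ i\<bar> = (if i = k then 1 else 0)" "deformed_form r s x = deformed_form r s (axis k 1)" for i
        by (auto simp: axis_def deformed_form_minus)
      then have "g x = deformed_form r s (axis j 1)
          + (\<Sum>i\<in>UNIV. if i = k then deformed_form r s (axis i 1) - deformed_form r s (axis j 1) else 0)"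
        unfolding g_def by (intro arg_cong2[where f = "(+)"] refl sum.cong) auto
      then show ?thesis using \<open>deformed_form r s x = deformed_form r s (axis k 1)\<close> by simp
    qed
    show "\<forall>x\<in>V. \<nu> x * g x \<le> \<nu> x * deformed_form r s x"
      using le eq \<nu>(1) by (metis less_imp_le mult_left_mono order_refl)
    show "\<exists>x\<in>V. \<nu> x * g x < \<nu> x * deformed_form r s x" using le[OF v0] \<nu>(1) v0(1) by auto
  qed
  ultimately show False using 1 2 by linarith
qed

section \<open>Covering for simplices\<close>

text \<open>
  The numbers \<open>c\<close> are the values of \<open>r\<close> at the nine vertices of a regular simplex, relative to its
  centre. In the undeformed simplex \<open>1 - \<Sum> l\<^sup>2\<close> is the average squared distance to the vertices, at most
  8/9, and the deformation subtracts \<open>\<beta>\<close> times the variance of \<open>c\<close>. Substituting \<open>l = 1/9 + t\<close> and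
  completing squares leaves only the fourth moment of \<open>c\<close> to be bounded.
\<close>

lemma variance_bound:
  fixes c l :: "'a \<Rightarrow> real"
  assumes I: "finite I" "card I = 9" and c: "(\<Sum>k\<in>I. c k) = 0" "(\<Sum>k\<in>I. (c k)\<^sup>2) = 2"
    and l: "(\<Sum>k\<in>I. l k) = 1"
  shows "1 - radius_sq \<le> (\<Sum>k\<in>I. (l k)\<^sup>2) + \<beta> * ((\<Sum>k\<in>I. l k * (c k)\<^sup>2) - (\<Sum>k\<in>I. l k * c k)\<^sup>2)"
proof -
  \<comment> \<open>Some \<open>c k\<close> is at least average; for it, \<open>2/9 \<le> (c k)\<^sup>2 \<le> 16/9\<close>, and the other squares sum to \<open>2 - (c k)\<^sup>2\<close>.\<close>
  have "\<exists>k\<in>I. 2/9 \<le> (c k)\<^sup>2"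
  proof (rule ccontr)
    assume "\<not> ?thesis"
    then have lt: "\<And>k. k \<in> I \<Longrightarrow> (c k)\<^sup>2 < 2/9" by force
    have "I \<noteq> {}" using I by auto
    then have "(\<Sum>k\<in>I. (c k)\<^sup>2) < (\<Sum>k\<in>I. 2/9)" using lt I by (intro sum_strict_mono) auto
    then show False using c I by simp
  qed
  then obtain m where m: "m \<in> I" "2/9 \<le> (c m)\<^sup>2" by blast
  let ?J = "I - {m}"
  have J: "finite ?J" "card ?J = 8" using I m by auto
  have split: "(\<Sum>k\<in>I. f k) = f m + (\<Sum>k\<in>?J. f k)" for f :: "'a \<Rightarrow> real"
    using I m by (intro sum.remove) auto
  have "(\<Sum>k\<in>?J. c k)\<^sup>2 \<le> (\<Sum>k\<in>?J. (1::real)\<^sup>2) * (\<Sum>k\<in>?J. (c k)\<^sup>2)"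
    using Cauchy_Schwarz_ineq_sum[of "\<lambda>_. 1" c ?J] by simp
  moreover have "(\<Sum>k\<in>?J. c k) = - c m" "(\<Sum>k\<in>?J. (c k)\<^sup>2) = 2 - (c m)\<^sup>2"
    using c split[of c] split[of "\<lambda>k. (c k)\<^sup>2"] by linarith+
  ultimately have m2: "(c m)\<^sup>2 \<le> 16/9" using J by simp
  have rest: "(\<Sum>k\<in>?J. ((c k)\<^sup>2)\<^sup>2) \<le> (\<Sum>k\<in>?J. (c k)\<^sup>2)\<^sup>2"
  proof -
    have "((c k)\<^sup>2)\<^sup>2 \<le> (c k)\<^sup>2 * (\<Sum>k\<in>?J. (c k)\<^sup>2)" if "k \<in> ?J" for k
      unfolding power2_eq_square[of "(c k)\<^sup>2"]
      using that J by (intro mult_left_mono member_le_sum) auto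
    then have "(\<Sum>k\<in>?J. ((c k)\<^sup>2)\<^sup>2) \<le> (\<Sum>k\<in>?J. (c k)\<^sup>2 * (\<Sum>k\<in>?J. (c k)\<^sup>2))"
      by (rule sum_mono)
    then show ?thesis by (simp add: power2_eq_square sum_distrib_right)
  qed
  have "((c m)\<^sup>2 - 2/9) * ((c m)\<^sup>2 - 16/9) \<le> 0"
    using m m2 by (intro mult_nonneg_nonpos) auto
  then have "((c m)\<^sup>2)\<^sup>2 + (2 - (c m)\<^sup>2)\<^sup>2 \<le> 260/81"
    by (simp add: power2_eq_square[of "(c m)\<^sup>2"] power2_eq_square[of "2 - (c m)\<^sup>2"] algebra_simps)
  then have c4: "(\<Sum>k\<in>I. ((c k)\<^sup>2)\<^sup>2) \<le> 260/81"
    using rest split[of "\<lambda>k. ((c k)\<^sup>2)\<^sup>2"] \<open>(\<Sum>k\<in>?J. (c k)\<^sup>2) = 2 - (c m)\<^sup>2\<close> by simp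
  define t where "t k = l k - 1/9" for k
  define e where "e k = (c k)\<^sup>2 - 2/9" for k
  have t0: "(\<Sum>k\<in>I. t k) = 0" unfolding t_def using l I by (simp add: sum_subtractf)
  have l2: "(\<Sum>k\<in>I. (l k)\<^sup>2) = 1/9 + (\<Sum>k\<in>I. (t k)\<^sup>2)"
  proof -
    have "(l k)\<^sup>2 = 1/81 + 2/9 * t k + (t k)\<^sup>2" for k
      unfolding t_def by (simp add: power2_eq_square algebra_simps)
    then have "(\<Sum>k\<in>I. (l k)\<^sup>2) = (\<Sum>k\<in>I. 1/81) + 2/9 * (\<Sum>k\<in>I. t k) + (\<Sum>k\<in>I. (t k)\<^sup>2)"
      by (simp only: sum.distrib sum_distrib_left)
    then show ?thesis using t0 I by simp
  qed
  have lc2: "(\<Sum>k\<in>I. l k * (c k)\<^sup>2) = 2/9 + (\<Sum>k\<in>I. t k * e k)"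
  proof -
    have "l k * (c k)\<^sup>2 = (c k)\<^sup>2 / 9 + t k * e k + 2/9 * t k" for k
      unfolding t_def e_def by (simp add: algebra_simps)
    then have "(\<Sum>k\<in>I. l k * (c k)\<^sup>2)
        = (\<Sum>k\<in>I. (c k)\<^sup>2) / 9 + (\<Sum>k\<in>I. t k * e k) + 2/9 * (\<Sum>k\<in>I. t k)"
      by (simp only: sum.distrib sum_distrib_left sum_divide_distrib)
    then show ?thesis using t0 c by simp
  qed
  have lc: "(\<Sum>k\<in>I. l k * c k) = (\<Sum>k\<in>I. t k * c k)"
  proof -
    have "l k * c k = c k / 9 + t k * c k" for k unfolding t_def by (simp add: algebra_simps)
    then show ?thesis using c by (simp add: sum.distrib flip: sum_divide_distrib)
  qed
  have cs: "(\<Sum>k\<in>I. t k * c k)\<^sup>2 \<le> 2 * (\<Sum>k\<in>I. (t k)\<^sup>2)"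
    using Cauchy_Schwarz_ineq_sum[of t c I] c by (simp add: mult.commute)
  have e2: "(\<Sum>k\<in>I. (e k)\<^sup>2) \<le> 224/81"
  proof -
    have "(e k)\<^sup>2 = ((c k)\<^sup>2)\<^sup>2 - 4/9 * (c k)\<^sup>2 + 4/81" for k
      unfolding e_def by (simp add: power2_eq_square[of "(c k)\<^sup>2 - 2/9"] power2_eq_square[of "(c k)\<^sup>2"] algebra_simps)
    then have "(\<Sum>k\<in>I. (e k)\<^sup>2) = (\<Sum>k\<in>I. ((c k)\<^sup>2)\<^sup>2) - 4/9 * (\<Sum>k\<in>I. (c k)\<^sup>2) + (\<Sum>k\<in>I. 4/81)"
      by (simp only: sum.distrib sum_subtractf sum_distrib_left)
    then show ?thesis using c4 c I by simp
  qed
  \<comment> \<open>The constant 1/180 is an upper bound for \<open>\<beta>\<^sup>2 / (4 * (1 - 2 * \<beta>))\<close>.\<close>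
  have "- (1/180 * (e k)\<^sup>2) \<le> (1 - 2 * \<beta>) * (t k)\<^sup>2 + \<beta> * (t k * e k)" for k
  proof -
    have "0 \<le> (1 - 2 * \<beta>) * (t k + \<beta> / (2 * (1 - 2 * \<beta>)) * e k)\<^sup>2" by (simp add: \<beta>_def)
    also have "\<dots> = (1 - 2 * \<beta>) * (t k)\<^sup>2 + \<beta> * (t k * e k) + \<beta>\<^sup>2 / (4 * (1 - 2 * \<beta>)) * (e k)\<^sup>2"
      unfolding \<beta>_def by (simp add: power2_eq_square algebra_simps)
    also have "\<beta>\<^sup>2 / (4 * (1 - 2 * \<beta>)) * (e k)\<^sup>2 \<le> 1/180 * (e k)\<^sup>2"
      by (intro mult_right_mono) (simp_all add: \<beta>_def power2_eq_square)
    finally show ?thesis by simp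
  qed
  then have "(\<Sum>k\<in>I. - (1/180 * (e k)\<^sup>2)) \<le> (\<Sum>k\<in>I. (1 - 2 * \<beta>) * (t k)\<^sup>2 + \<beta> * (t k * e k))"
    by (rule sum_mono)
  then have low: "- (1/180 * (\<Sum>k\<in>I. (e k)\<^sup>2)) \<le> (1 - 2 * \<beta>) * (\<Sum>k\<in>I. (t k)\<^sup>2) + \<beta> * (\<Sum>k\<in>I. t k * e k)"
    by (simp add: sum.distrib sum_negf sum_distrib_left)
  have "\<beta> * (\<Sum>k\<in>I. t k * c k)\<^sup>2 \<le> \<beta> * (2 * (\<Sum>k\<in>I. (t k)\<^sup>2))"
    using cs by (intro mult_left_mono) (simp_all add: \<beta>_def)
  then have "1/9 + \<beta> * (2/9) - 1/180 * (224/81)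
    \<le> (\<Sum>k\<in>I. (l k)\<^sup>2) + \<beta> * ((\<Sum>k\<in>I. l k * (c k)\<^sup>2) - (\<Sum>k\<in>I. l k * c k)\<^sup>2)"
    unfolding l2 lc2 lc using low e2 by (simp add: algebra_simps)
  moreover have "1 - radius_sq \<le> 1/9 + \<beta> * (2/9) - 1/180 * (224/81)"
    unfolding radius_sq_def \<beta>_def by simp
  ultimately show ?thesis by linarith
qed


text \<open>
  The apex has index \<^const>\<open>None\<close>.
\<close>

definition simplex_vertex :: "real ^ 8 \<Rightarrow> 8 option \<Rightarrow> real ^ 8" where
  "simplex_vertex \<tau> k = (case k of None \<Rightarrow> \<tau> | Some i \<Rightarrow> axis i (2 * \<tau> $ i))"

text \<open>
  Barycentric coordinates with respect to \<open>simplex_vertex \<tau>\<close>.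
\<close>

definition barycentric :: "real ^ 8 \<Rightarrow> real ^ 8 \<Rightarrow> 8 option \<Rightarrow> real" where
  "barycentric \<tau> y k = (let l0 = (2 * (\<tau> \<bullet> y) - 1) / 3 in
    case k of None \<Rightarrow> l0 | Some i \<Rightarrow> 2 * \<tau> $ i * y $ i - l0 / 2)"

lemma sum_UNIV_option:
  fixes f :: "'a::finite option \<Rightarrow> 'b::comm_monoid_add"
  shows "(\<Sum>k\<in>UNIV. f k) = f None + (\<Sum>i\<in>UNIV. f (Some i))"
  by (simp add: UNIV_option_conv sum.reindex)

lemma two_half_signs_axis:
  assumes "half_signs \<tau>"
  shows "axis i (2 * \<tau> $ i) \<in> cross_vertices"
  unfolding cross_vertices_def
  by (rule half_signs_cases[OF assms, of i]) (auto simp: axis_def vec_eq_iff)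

lemma half_signs_four: "half_signs \<tau> \<Longrightarrow> 4 * (\<tau> $ i * (\<tau> $ i * x)) = x"
  using half_signs_square[of \<tau> i] by (simp add: mult.assoc[symmetric])

lemma barycentric_sum:
  assumes "half_signs \<tau>"
  shows "(\<Sum>k\<in>UNIV. barycentric \<tau> y k) = 1"
    "(\<Sum>k\<in>UNIV. barycentric \<tau> y k *\<^sub>R simplex_vertex \<tau> k) = y"
proof -
  let ?l = "(2 * (\<tau> \<bullet> y) - 1) / 3"
  have "(\<Sum>i\<in>UNIV. 2 * \<tau> $ i * y $ i) = 2 * (\<tau> \<bullet> y)"
    by (simp add: inner_vec_def sum_distrib_left mult.assoc)
  then show "(\<Sum>k\<in>UNIV. barycentric \<tau> y k) = 1"
    unfolding sum_UNIV_option barycentric_def Let_def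
    by (simp add: sum_subtractf) (simp add: field_simps)
  show "(\<Sum>k\<in>UNIV. barycentric \<tau> y k *\<^sub>R simplex_vertex \<tau> k) = y"
  proof (rule vec_eq_iff[THEN iffD2], rule allI)
    fix i
    have "(\<Sum>k\<in>UNIV. barycentric \<tau> y k *\<^sub>R simplex_vertex \<tau> k) $ i
        = ?l * \<tau> $ i + (\<Sum>k\<in>UNIV. if i = k then (2 * \<tau> $ k * y $ k - ?l / 2) * (2 * \<tau> $ k) else 0)"
      unfolding sum_UNIV_option barycentric_def simplex_vertex_def Let_def
      by (simp add: axis_def if_distrib cong: if_cong)
    also have "\<dots> = ?l * \<tau> $ i + (2 * \<tau> $ i * y $ i - ?l / 2) * (2 * \<tau> $ i)" by simp
    also have "\<dots> = 4 * (\<tau> $ i * (\<tau> $ i * y $ i))" by (simp add: field_simps)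
    finally show "(\<Sum>k\<in>UNIV. barycentric \<tau> y k *\<^sub>R simplex_vertex \<tau> k) $ i = y $ i"
      using half_signs_four[OF assms] by simp
  qed
qed

lemma barycentric_affine:
  "barycentric \<tau> ((1 - t) *\<^sub>R x + t *\<^sub>R y) k = (1 - t) * barycentric \<tau> x k + t * barycentric \<tau> y k"
  unfolding barycentric_def Let_def by (cases k) (simp_all add: inner_add_right algebra_simps diff_divide_distrib add_divide_distrib)

lemma barycentric_eqI:
  assumes \<tau>: "half_signs \<tau>" and l: "(\<Sum>i\<in>UNIV. l i) + l0 = (1 :: real)"
    and y: "\<And>i. y $ i = l0 * \<tau> $ i + 2 * \<tau> $ i * l i"
  shows "barycentric \<tau> y None = l0" "barycentric \<tau> y (Some i) = l i"
proof -
  have ty: "\<tau> $ i * y $ i = l0 / 4 + l i / 2" for i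
  proof -
    have "\<tau> $ i * y $ i = (\<tau> $ i * \<tau> $ i) * (l0 + 2 * l i)" unfolding y by (simp add: algebra_simps)
    then show ?thesis unfolding half_signs_square[OF \<tau>] by (simp add: algebra_simps)
  qed
  have "\<tau> \<bullet> y = (\<Sum>i\<in>UNIV. l0 / 4 + l i / 2)" by (simp add: inner_vec_def ty)
  also have "\<dots> = 2 * l0 + (1 - l0) / 2" using l by (simp add: sum.distrib flip: sum_divide_distrib) 
  finally have l0: "(2 * (\<tau> \<bullet> y) - 1) / 3 = l0" by (simp add: field_simps)
  then show "barycentric \<tau> y None = l0" unfolding barycentric_def by simp
  show "barycentric \<tau> y (Some i) = l i"
    unfolding barycentric_def Let_def l0 using ty[of i] by (simp add: mult.assoc)
qed

lemma simplex_vertex_square: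
  assumes "half_signs \<tau>"
  shows "simplex_vertex \<tau> k \<bullet> simplex_vertex \<tau> k = (if k = None then 2 else 1)"
  using half_signs_inner[OF assms] half_signs_four[OF assms, of _ 1]
  unfolding simplex_vertex_def by (cases k) (simp_all add: inner_axis)

lemma simplex_vertex_odd_coset:
  assumes "half_signs \<tau>" "\<tau> \<in> odd_coset"
  shows "simplex_vertex \<tau> k \<in> odd_coset"
  unfolding simplex_vertex_def using assms two_half_signs_axis cross_vertices_odd_coset
  by (auto split: option.split)

text \<open>
  The variance along the root \<open>r\<close> pushes the average squared distance below the bound; the variance
  along the other vector is nonnegative and can only decrease it further.
\<close>

lemma simplex_cover:
  assumes rs: "root_pair r s" and \<tau>: "half_signs \<tau>" "\<tau> \<in> odd_coset"
    and nn: "\<And>k. 0 \<le> barycentric \<tau> y k"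
  obtains w where "w \<in> odd_coset" "deformed_form r s (w - y) \<le> radius_sq"
proof -
  let ?l = "barycentric \<tau> y" let ?v = "simplex_vertex \<tau>" let ?u = "perp r s"
  note l = barycentric_sum[OF \<tau>(1), of y]
  have rr: "r \<bullet> r = 2" using rs unfolding root_pair_def by simp
  define g where "g i = 2 * \<tau> $ i * r $ i" for i
  \<comment> \<open>The value of \<open>r\<close> at the centre \<open>\<tau> / 3\<close> of the simplex.\<close>
  define h where "h = (\<Sum>i\<in>UNIV. g i) / 6"
  define c where "c k = r \<bullet> ?v k - h" for k
  have rv: "r \<bullet> ?v (Some i) = g i" "r \<bullet> ?v None = 3 * h" for i
    unfolding simplex_vertex_def g_def h_def
    by (simp_all add: inner_axis) (simp_all add: inner_vec_def sum_distrib_left mult_ac flip: sum_divide_distrib)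
  have "(g i)\<^sup>2 = r $ i * r $ i" for i
    unfolding g_def using half_signs_four[OF \<tau>(1), of i "r $ i * r $ i"]
    by (simp add: power2_eq_square mult_ac)
  then have g2: "(\<Sum>i\<in>UNIV. (g i)\<^sup>2) = 2" using rr by (simp add: inner_vec_def)
  have gs: "(\<Sum>i\<in>UNIV. g i) = 6 * h" unfolding h_def by simp
  have c0: "(\<Sum>k\<in>UNIV. c k) = 0"
    unfolding sum_UNIV_option c_def rv using gs by (simp add: sum_subtractf)
  have c2: "(\<Sum>k\<in>UNIV. (c k)\<^sup>2) = 2"
  proof -
    have "(\<Sum>i\<in>UNIV. (g i - h)\<^sup>2) = (\<Sum>i\<in>UNIV. (g i)\<^sup>2 - 2 * h * g i + h\<^sup>2)"
      by (simp add: power2_eq_square algebra_simps)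
    also have "\<dots> = 2 - 2 * h * (6 * h) + 8 * h\<^sup>2"
      by (simp add: sum.distrib sum_subtractf g2 gs flip: sum_distrib_left)
    finally show ?thesis unfolding sum_UNIV_option c_def rv by (simp add: power2_eq_square)
  qed
  have card: "card (UNIV :: 8 option set) = 9" by simp
  note var = variance_bound[OF finite_class.finite_UNIV card c0 c2 l(1)]
  have inner_y: "z \<bullet> y = (\<Sum>k\<in>UNIV. ?l k * (z \<bullet> ?v k))" for z
  proof -
    have "z \<bullet> (\<Sum>k\<in>UNIV. ?l k *\<^sub>R ?v k) = (\<Sum>k\<in>UNIV. ?l k * (z \<bullet> ?v k))"
      by (simp add: inner_sum_right)
    then show ?thesis unfolding l(2) .
  qed
  have rvc: "r \<bullet> ?v k = c k + h" for k unfolding c_def by simp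
  have ry: "r \<bullet> y = (\<Sum>k\<in>UNIV. ?l k * c k) + h"
  proof -
    have "r \<bullet> y = (\<Sum>k\<in>UNIV. ?l k * (r \<bullet> ?v k))" by (rule inner_y)
    also have "\<dots> = (\<Sum>k\<in>UNIV. ?l k * c k) + (\<Sum>k\<in>UNIV. ?l k) * h"
      unfolding rvc by (simp add: distrib_left sum.distrib sum_distrib_right)
    finally show ?thesis using l(1) by simp
  qed
  have rvar: "(\<Sum>k\<in>UNIV. ?l k * (r \<bullet> ?v k)\<^sup>2) - (r \<bullet> y)\<^sup>2
      = (\<Sum>k\<in>UNIV. ?l k * (c k)\<^sup>2) - (\<Sum>k\<in>UNIV. ?l k * c k)\<^sup>2"
  proof -
    have "l * (x + h)\<^sup>2 = l * x\<^sup>2 + 2 * h * (l * x) + h\<^sup>2 * l" for l x :: real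
      by (simp add: power2_eq_square algebra_simps)
    then have "(\<Sum>k\<in>UNIV. ?l k * (r \<bullet> ?v k)\<^sup>2)
        = (\<Sum>k\<in>UNIV. ?l k * (c k)\<^sup>2 + 2 * h * (?l k * c k) + h\<^sup>2 * ?l k)"
      unfolding rvc by (simp only:)
    also have "\<dots> = (\<Sum>k\<in>UNIV. ?l k * (c k)\<^sup>2) + 2 * h * (\<Sum>k\<in>UNIV. ?l k * c k) + h\<^sup>2 * (\<Sum>k\<in>UNIV. ?l k)"
      by (simp only: sum.distrib sum_distrib_left)
    finally show ?thesis unfolding ry l(1) by (simp add: power2_eq_square algebra_simps)
  qed
  have uvar: "(?u \<bullet> y)\<^sup>2 \<le> (\<Sum>k\<in>UNIV. ?l k * (?u \<bullet> ?v k)\<^sup>2)"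
  proof -
    note uy = inner_y[of ?u]
    have pos: "0 \<le> (\<Sum>k\<in>UNIV. ?l k * (?u \<bullet> ?v k - ?u \<bullet> y)\<^sup>2)" using nn by (intro sum_nonneg) simp
    have "l * (a - b)\<^sup>2 = l * a\<^sup>2 - 2 * b * (l * a) + b\<^sup>2 * l" for l a b :: real
      by (simp add: power2_eq_square algebra_simps)
    then have "(\<Sum>k\<in>UNIV. ?l k * (?u \<bullet> ?v k - ?u \<bullet> y)\<^sup>2)
      = (\<Sum>k\<in>UNIV. ?l k * (?u \<bullet> ?v k)\<^sup>2 - 2 * (?u \<bullet> y) * (?l k * (?u \<bullet> ?v k)) + (?u \<bullet> y)\<^sup>2 * ?l k)"
      by (simp only:)
    also have "\<dots> = (\<Sum>k\<in>UNIV. ?l k * (?u \<bullet> ?v k)\<^sup>2) - 2 * (?u \<bullet> y) * (?u \<bullet> y) + (?u \<bullet> y)\<^sup>2 * (\<Sum>k\<in>UNIV. ?l k)"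
      by (simp only: sum.distrib sum_subtractf sum_distrib_left[symmetric] uy[symmetric])
    finally show ?thesis using pos unfolding l(1) by (simp add: power2_eq_square)
  qed
  have vv: "(\<Sum>k\<in>UNIV. ?l k * (?v k \<bullet> ?v k)) - y \<bullet> y = 1 - (\<Sum>k\<in>UNIV. (?l k)\<^sup>2)"
  proof -
    define a where "a = ?l None"
    define b where "b i = ?l (Some i)" for i
    have ab: "a + (\<Sum>i\<in>UNIV. b i) = 1" using l(1) unfolding sum_UNIV_option a_def b_def .
    have yi: "y $ i = 2 * \<tau> $ i * (b i + a / 2)" for i
    proof -
      have "2 * \<tau> $ i * (b i + a / 2) = 4 * (\<tau> $ i * (\<tau> $ i * y $ i))"
        unfolding a_def b_def barycentric_def Let_def by simp
      then show ?thesis using half_signs_four[OF \<tau>(1)] by simp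
    qed
    have "y $ i * y $ i = (b i + a / 2)\<^sup>2" for i
    proof -
      have "y $ i * y $ i = 4 * (\<tau> $ i * \<tau> $ i) * (b i + a / 2)\<^sup>2"
        unfolding yi by (simp add: power2_eq_square)
      then show ?thesis unfolding half_signs_square[OF \<tau>(1)] by simp
    qed
    then have "y \<bullet> y = (\<Sum>i\<in>UNIV. (b i)\<^sup>2 + a * b i + a\<^sup>2 / 4)"
      by (simp add: inner_vec_def) (simp add: power2_eq_square algebra_simps)
    also have "\<dots> = (\<Sum>i\<in>UNIV. (b i)\<^sup>2) + a * (\<Sum>i\<in>UNIV. b i) + 2 * a\<^sup>2"
      by (simp add: sum.distrib sum_distrib_left)
    also have "(\<Sum>i\<in>UNIV. b i) = 1 - a" using ab by simp
    finally have "y \<bullet> y = (\<Sum>i\<in>UNIV. (b i)\<^sup>2) + a + a\<^sup>2" by (simp add: power2_eq_square algebra_simps)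
    moreover have "(\<Sum>k\<in>UNIV. ?l k * (?v k \<bullet> ?v k)) = 1 + a"
      unfolding simplex_vertex_square[OF \<tau>(1)] sum_UNIV_option using ab
      by (simp add: a_def b_def)
    moreover have "(\<Sum>k\<in>UNIV. (?l k)\<^sup>2) = a\<^sup>2 + (\<Sum>i\<in>UNIV. (b i)\<^sup>2)"
      unfolding sum_UNIV_option a_def b_def ..
    ultimately show ?thesis by simp
  qed
  have "(\<Sum>k\<in>UNIV. ?l k * deformed_form r s (?v k)) = (\<Sum>k\<in>UNIV. ?l k * (?v k \<bullet> ?v k))
      - \<beta> * (\<Sum>k\<in>UNIV. ?l k * (r \<bullet> ?v k)\<^sup>2) - \<gamma> * (\<Sum>k\<in>UNIV. ?l k * (?u \<bullet> ?v k)\<^sup>2)"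
    unfolding deformed_form_def by (simp add: right_diff_distrib sum_subtractf sum_distrib_left mult_ac)
  then have "(\<Sum>k\<in>UNIV. ?l k * deformed_form r s (?v k)) - deformed_form r s y
      = ((\<Sum>k\<in>UNIV. ?l k * (?v k \<bullet> ?v k)) - y \<bullet> y)
      - \<beta> * ((\<Sum>k\<in>UNIV. ?l k * (r \<bullet> ?v k)\<^sup>2) - (r \<bullet> y)\<^sup>2)
      - \<gamma> * ((\<Sum>k\<in>UNIV. ?l k * (?u \<bullet> ?v k)\<^sup>2) - (?u \<bullet> y)\<^sup>2)"
    unfolding deformed_form_def[of r s y] by (simp add: algebra_simps)
  moreover have "0 \<le> \<gamma> * ((\<Sum>k\<in>UNIV. ?l k * (?u \<bullet> ?v k)\<^sup>2) - (?u \<bullet> y)\<^sup>2)"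
    using uvar by (simp add: \<gamma>_def)
  ultimately have bound: "(\<Sum>k\<in>UNIV. ?l k * deformed_form r s (?v k)) - deformed_form r s y \<le> radius_sq"
    unfolding vv rvar using var by linarith
  obtain k where "deformed_form r s (?v k - y) \<le> (\<Sum>k\<in>UNIV. ?l k * deformed_form r s (?v k - y))"
    using exists_le_average[of UNIV ?l "\<lambda>k. deformed_form r s (?v k - y)"] nn l(1) by auto
  also have "\<dots> = (\<Sum>k\<in>UNIV. ?l k * deformed_form r s (?v k)) - deformed_form r s y"
    using deformed_form_average[OF l, of r s y] deformed_polar_self[of r s y] by simp
  finally have "deformed_form r s (?v k - y) \<le> radius_sq" using bound by linarith
  then show thesis by (rule that[OF simplex_vertex_odd_coset[OF \<tau>]])
qed

section \<open>The Delone cells of the root lattice\<close>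

lemma cross_vertices_delone: "delone_vertices odd_coset (\<lambda>x. x \<bullet> x) cross_vertices"
proof -
  have "w \<bullet> w = 1" if "w \<in> cross_vertices" for w
    using that unfolding cross_vertices_def by (auto simp: inner_axis_axis)
  moreover have "1 < w \<bullet> w" if "w \<in> odd_coset - cross_vertices" for w
  proof -
    have "w \<in> odd_coset" using that by simp
    then show ?thesis
    proof (cases rule: odd_coset_norm_cases)
      case (axis k)
      then show ?thesis using that unfolding cross_vertices_def by blast
    next
      case half
      then show ?thesis using half_signs_inner by simp
    qed simp
  qed
  moreover have "cross_vertices \<noteq> {}" unfolding cross_vertices_def by auto
  ultimately show ?thesis
    unfolding delone_vertices_def using finite_cross_vertices cross_vertices_odd_coset
    by (intro conjI exI[of _ 0] exI[of _ 1]) auto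
qed

text \<open>
  The centre of the simplex with apex \<open>\<tau>\<close> is \<open>\<tau> / 3\<close>, at squared distance 8/9 from the vertices.
\<close>

lemma simplex_sphere:
  assumes \<tau>: "half_signs \<tau>"
  shows "(w - (1/3) *\<^sub>R \<tau>) \<bullet> (w - (1/3) *\<^sub>R \<tau>) = w \<bullet> w - 2/3 * (\<tau> \<bullet> w) + 2/9"
  by (simp add: inner_diff_left inner_diff_right half_signs_inner[OF \<tau>] inner_commute)

lemma simplex_sphere_outside:
  assumes \<tau>: "half_signs \<tau>" and w: "w \<in> odd_coset" "w \<notin> range (simplex_vertex \<tau>)"
  shows "2/3 < w \<bullet> w - 2/3 * (\<tau> \<bullet> w)"
  using w(1)
proof (cases rule: odd_coset_norm_cases)
  case (axis k)
  have "simplex_vertex \<tau> (Some k) \<noteq> w" using w(2) by blast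
  then have "w \<noteq> axis k (2 * \<tau> $ k)" unfolding simplex_vertex_def by simp
  moreover have "axis k (2 * \<tau> $ k) = axis k 1 \<and> \<tau> $ k = 1/2 \<or> axis k (2 * \<tau> $ k) = - axis k 1 \<and> \<tau> $ k = - (1/2)"
    by (rule half_signs_cases[OF \<tau>, of k]) (auto simp: axis_def vec_eq_iff)
  ultimately have "w = - axis k 1 \<and> \<tau> $ k = 1/2 \<or> w = axis k 1 \<and> \<tau> $ k = - (1/2)"
    using axis by metis
  then show ?thesis by (auto simp: inner_axis)
next
  case half
  have "w \<noteq> \<tau>" using w(2) unfolding simplex_vertex_def by (metis option.simps(4) rangeI)
  then obtain k where k: "w $ k \<noteq> \<tau> $ k" by (auto simp: vec_eq_iff)
  have le: "\<tau> $ i * w $ i \<le> 1/4" for i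
  proof -
    have "\<bar>\<tau> $ i * w $ i\<bar> = 1/2 * (1/2)" using half \<tau> unfolding half_signs_def abs_mult by metis
    then show ?thesis by linarith
  qed
  have "w $ k = - \<tau> $ k"
    using k by (rule_tac half_signs_cases[OF \<tau>, of k]; rule_tac half_signs_cases[OF half, of k]) auto
  then have "\<tau> $ k * w $ k = - (1/4)" using half_signs_square[OF \<tau>, of k] by simp
  moreover have "\<tau> \<bullet> w = \<tau> $ k * w $ k + (\<Sum>i\<in>UNIV - {k}. \<tau> $ i * w $ i)"
    unfolding inner_vec_def inner_real_def by (subst sum.remove[of _ k]) auto
  moreover have "(\<Sum>i\<in>UNIV - {k}. \<tau> $ i * w $ i) \<le> (\<Sum>i\<in>UNIV - {k}. 1/4)"
    by (intro sum_mono le)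
  moreover have "(\<Sum>i\<in>UNIV - {k}. 1/4 :: real) = 7/4" by (simp add: card_Diff_singleton)
  ultimately show ?thesis using half_signs_inner[OF half] by simp
next
  case far
  have "0 \<le> (w - \<tau>) \<bullet> (w - \<tau>)" by simp
  then have "2 * (\<tau> \<bullet> w) \<le> 2 + w \<bullet> w"
    by (simp add: inner_diff_left inner_diff_right half_signs_inner[OF \<tau>] inner_commute)
  then show ?thesis using far by simp
qed

lemma simplex_delone:
  assumes \<tau>: "half_signs \<tau>" "\<tau> \<in> odd_coset"
  shows "delone_vertices odd_coset (\<lambda>x. x \<bullet> x) (range (simplex_vertex \<tau>))"
proof -
  have sq: "simplex_vertex \<tau> k \<bullet> simplex_vertex \<tau> k - 2/3 * (\<tau> \<bullet> simplex_vertex \<tau> k) = 2/3" for k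
    unfolding simplex_vertex_square[OF \<tau>(1)]
    using half_signs_inner[OF \<tau>(1)] half_signs_four[OF \<tau>(1), of _ 1]
    by (cases k) (simp_all add: simplex_vertex_def inner_axis)
  have "simplex_vertex \<tau> k \<bullet> simplex_vertex \<tau> k - 2/3 * (\<tau> \<bullet> simplex_vertex \<tau> k) + 2/9 = 8/9" for k
    using sq[of k] by linarith
  then have "\<forall>v\<in>range (simplex_vertex \<tau>). (v - (1/3) *\<^sub>R \<tau>) \<bullet> (v - (1/3) *\<^sub>R \<tau>) = 8/9"
    unfolding simplex_sphere[OF \<tau>(1)] by blast
  moreover have "\<forall>w\<in>odd_coset - range (simplex_vertex \<tau>). 8/9 < (w - (1/3) *\<^sub>R \<tau>) \<bullet> (w - (1/3) *\<^sub>R \<tau>)"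
    unfolding simplex_sphere[OF \<tau>(1)] using simplex_sphere_outside[OF \<tau>(1)] by fastforce
  ultimately show ?thesis
    unfolding delone_vertices_def using simplex_vertex_odd_coset[OF \<tau>]
    by (intro conjI exI[of _ "(1/3) *\<^sub>R \<tau>"] exI[of _ "8/9"]) auto
qed

text \<open>
  A lattice point in the simplex would lie in the circumscribed ball, whose only lattice points are the
  vertices.
\<close>

lemma barycentric_outside:
  assumes \<tau>: "half_signs \<tau>" and w: "w \<in> odd_coset" "w \<notin> range (simplex_vertex \<tau>)"
  obtains k where "barycentric \<tau> w k < 0"
proof (rule ccontr)
  assume no: "\<not> thesis"
  have nn: "0 \<le> barycentric \<tau> w k" for k using that[of k] no by (meson not_less)
  let ?l = "barycentric \<tau> w" let ?c = "(1/3) *\<^sub>R \<tau>"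
  note l = barycentric_sum[OF \<tau>, of w]
  have "norm (\<Sum>k\<in>UNIV. ?l k *\<^sub>R (simplex_vertex \<tau> k - ?c)) \<le> (\<Sum>k\<in>UNIV. ?l k * sqrt (8/9))"
  proof (rule sum_norm_le)
    fix k
    have "(simplex_vertex \<tau> k - ?c) \<bullet> (simplex_vertex \<tau> k - ?c) = 8/9"
      unfolding simplex_sphere[OF \<tau>] simplex_vertex_square[OF \<tau>]
      using half_signs_inner[OF \<tau>] half_signs_four[OF \<tau>, of _ 1]
      by (cases k) (simp_all add: simplex_vertex_def inner_axis)
    then have "norm (simplex_vertex \<tau> k - ?c) = sqrt (8/9)" by (simp add: norm_eq_sqrt_inner)
    then show "norm (?l k *\<^sub>R (simplex_vertex \<tau> k - ?c)) \<le> ?l k * sqrt (8/9)" using nn[of k] by simp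
  qed
  also have "\<dots> = sqrt (8/9)" using l(1) by (simp flip: sum_distrib_right)
  also have "(\<Sum>k\<in>UNIV. ?l k *\<^sub>R (simplex_vertex \<tau> k - ?c)) = w - ?c"
    unfolding scaleR_diff_right sum_subtractf scaleR_sum_left[symmetric] l by simp
  finally have "(w - ?c) \<bullet> (w - ?c) \<le> 8/9" by (simp add: norm_eq_sqrt_inner)
  then show False using simplex_sphere_outside[OF \<tau> w] unfolding simplex_sphere[OF \<tau>] by simp
qed

text \<open>
  A ray leaves the positive orthant when the first coordinate vanishes.
\<close>

lemma exit_parameter:
  fixes a b :: "'a \<Rightarrow> real"
  assumes I: "finite I" "\<And>k. k \<in> I \<Longrightarrow> 0 \<le> a k" and neg: "k0 \<in> I" "b k0 < 0"
  obtains t k where "0 \<le> t" "t < 1" "\<And>k. k \<in> I \<Longrightarrow> 0 \<le> (1 - t) * a k + t * b k"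
    "k \<in> I" "(1 - t) * a k + t * b k = 0"
proof -
  define K where "K = {k\<in>I. b k < 0}"
  define f where "f k = a k / (a k - b k)" for k
  have K: "finite K" "K \<noteq> {}" unfolding K_def using I neg by auto
  define t where "t = Min (f ` K)"
  obtain m where m: "m \<in> K" "t = f m" using Min_in[of "f ` K"] K unfolding t_def by blast
  have pos: "0 < a k - b k" "0 \<le> a k" if "k \<in> K" for k
    using that I(2)[of k] unfolding K_def by auto
  have t01: "0 \<le> t" "t < 1"
    using pos[OF m(1)] m(1) unfolding m(2) f_def K_def by (auto simp: divide_less_eq)
  show thesis
  proof (rule that[OF t01])
    show "m \<in> I" using m(1) unfolding K_def by simp
    show "(1 - t) * a m + t * b m = 0"
      using pos[OF m(1)] unfolding m(2) f_def by (simp add: field_simps)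
    show "0 \<le> (1 - t) * a k + t * b k" if k: "k \<in> I" for k
    proof (cases "k \<in> K")
      case True
      then have "t \<le> f k" unfolding t_def using K by simp
      then have "t * (a k - b k) \<le> a k" using pos[OF True] unfolding f_def by (simp add: field_simps)
      then show ?thesis by (simp add: algebra_simps)
    next
      case False
      then have "0 \<le> b k" using k unfolding K_def by auto
      then show ?thesis using t01 I(2)[OF k] by simp
    qed
  qed
qed

section \<open>From hole coordinates to the root lattice\<close>

lemma hole_frame_inj:
  assumes "hole_frame m U" "m + U x = m + U y"
  shows "x = y"
  using assms orthogonal_transformation_inj unfolding hole_frame_def by (auto dest: injD)

text \<open>
  The linear part of a frame preserves the lattice and inner products, so it moves the deforming plane to
  another one of the same kind.
\<close>

lemma hole_frame_pair:
  assumes f: "hole_frame m U" and rs: "root_pair r s"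
  obtains r' s' where "root_pair r' s'" "\<And>x. deformed_form r s (U x) = deformed_form r' s' x"
proof -
  obtain r' where r': "r' \<in> E8" "U r' = r"
    using hole_frame_pullback[OF f] rs unfolding root_pair_def by blast
  obtain s' where s': "s' \<in> E8" "U s' = s"
    using hole_frame_pullback[OF f] rs unfolding root_pair_def by blast
  note U = hole_frame_diff[OF f]
  have "root_pair r' s'"
    using rs r'(1) s'(1) U(4) unfolding root_pair_def r'(2)[symmetric] s'(2)[symmetric] by metis
  moreover have p: "perp r s = U (perp r' s')"
    unfolding perp_def r'(2)[symmetric] s'(2)[symmetric] by (simp add: U)
  have "r \<bullet> U x = r' \<bullet> x" for x using U(4)[of r' x] unfolding r'(2) .
  then have "deformed_form r s (U x) = deformed_form r' s' x" for x
    unfolding deformed_form_def p by (simp add: U(4))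
  ultimately show thesis using that by blast
qed

lemma hole_frame_surj:
  assumes "hole_frame m U"
  obtains y where "x = m + U y"
proof -
  obtain y where "x - m = U y"
    using assms orthogonal_transformation_surj unfolding hole_frame_def by (metis surjD)
  then show thesis using that by (metis add.commute diff_add_cancel)
qed

lemma hole_frame_delone_push:
  assumes f: "hole_frame m U" and W: "delone_vertices odd_coset (\<lambda>x. x \<bullet> x) W"
  shows "delone_vertices E8 (\<lambda>x. x \<bullet> x) ((\<lambda>w. m + U w) ` W)"
proof -
  obtain c R where c: "\<And>v. v \<in> W \<Longrightarrow> (v - c) \<bullet> (v - c) = R"
    "\<And>v. v \<in> odd_coset - W \<Longrightarrow> R < (v - c) \<bullet> (v - c)" and W': "finite W" "W \<noteq> {}" "W \<subseteq> odd_coset"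
    using W unfolding delone_vertices_def by blast
  have E8: "E8 = (\<lambda>y. m + U y) ` odd_coset" using f unfolding hole_frame_def by simp
  have eq: "(m + U v - (m + U c)) \<bullet> (m + U v - (m + U c)) = (v - c) \<bullet> (v - c)" for v
    using hole_frame_diff(4)[OF f, of "v - c" "v - c"] by (simp add: hole_frame_diff(1)[OF f])
  show ?thesis
    unfolding delone_vertices_def
  proof (intro conjI exI[of _ "m + U c"] exI[of _ R] ballI)
    show "R < (x - (m + U c)) \<bullet> (x - (m + U c))" if x: "x \<in> E8 - (\<lambda>w. m + U w) ` W" for x
    proof -
      obtain v where "v \<in> odd_coset" "x = m + U v" using x unfolding E8 by blast
      then show ?thesis using x eq c(2)[of v] by auto
    qed
    show "(x - (m + U c)) \<bullet> (x - (m + U c)) = R" if "x \<in> (\<lambda>w. m + U w) ` W" for x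
      using that eq c(1) by auto
  qed (use W' E8 in auto)
qed

lemma hole_frame_cross:
  assumes f: "hole_frame m U" and rs: "root_pair r s" and V: "delone_vertices E8 (deformed_form r s) V"
    and \<nu>: "\<And>v. v \<in> V \<Longrightarrow> 0 < \<nu> v" "(\<Sum>v\<in>V. \<nu> v) = 1" "(\<Sum>v\<in>V. \<nu> v *\<^sub>R v) = m + U y"
    and y: "(\<Sum>i\<in>UNIV. \<bar>y $ i\<bar>) \<le> 1"
  shows "V \<subseteq> (\<lambda>w. m + U w) ` cross_vertices"
proof -
  obtain r' s' where rs': "root_pair r' s'" and eq: "\<And>x. deformed_form r s (U x) = deformed_form r' s' x"
    using hole_frame_pair[OF f rs] by blast
  let ?g = "\<lambda>w. m + U w"
  have E8: "E8 = ?g ` odd_coset" using f unfolding hole_frame_def by simp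
  have lin: "linear U" using f unfolding hole_frame_def orthogonal_transformation_def by blast
  have inj: "inj ?g" using hole_frame_inj[OF f] by (auto intro: injI)
  obtain c R where c: "\<And>v. v \<in> V \<Longrightarrow> deformed_form r s (v - c) = R"
    "\<And>v. v \<in> E8 - V \<Longrightarrow> R < deformed_form r s (v - c)" and V': "finite V" "V \<noteq> {}" "V \<subseteq> E8"
    using V unfolding delone_vertices_def by blast
  define V0 where "V0 = odd_coset \<inter> ?g -` V"
  have V0: "V = ?g ` V0" using V'(3) unfolding V0_def E8 by blast
  obtain c0 where c0: "c = m + U c0" using hole_frame_surj[OF f] .
  have shift: "deformed_form r s (?g w - c) = deformed_form r' s' (w - c0)" for w
    unfolding c0 using eq[of "w - c0"] by (simp add: hole_frame_diff(1)[OF f])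
  have D: "delone_vertices odd_coset (deformed_form r' s') V0"
    unfolding delone_vertices_def
  proof (intro conjI exI[of _ c0] exI[of _ R] ballI)
    show "finite V0" using V'(1) V0 inj by (metis finite_imageD inj_on_subset subset_UNIV)
    show "V0 \<noteq> {}" using V'(2) V0 by auto
    show "V0 \<subseteq> odd_coset" unfolding V0_def by simp
    show "deformed_form r' s' (w - c0) = R" if "w \<in> V0" for w
      using that c(1) unfolding V0_def shift[symmetric] by simp
    show "R < deformed_form r' s' (w - c0)" if "w \<in> odd_coset - V0" for w
      using that c(2)[of "?g w"] unfolding V0_def shift[symmetric] E8 by blast
  qed
  have sum: "(\<Sum>v\<in>V. h v) = (\<Sum>w\<in>V0. h (?g w))" for h :: "real ^ 8 \<Rightarrow> 'b :: comm_monoid_add"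
    unfolding V0 using inj by (subst sum.reindex) (auto intro: inj_on_subset)
  have S1: "(\<Sum>w\<in>V0. \<nu> (?g w)) = 1" using \<nu>(2) sum[of \<nu>] by simp
  have S2: "(\<Sum>w\<in>V0. \<nu> (?g w) *\<^sub>R w) = y"
  proof (rule hole_frame_inj[OF f])
    have "m + U (\<Sum>w\<in>V0. \<nu> (?g w) *\<^sub>R w) = (\<Sum>w\<in>V0. \<nu> (?g w)) *\<^sub>R m + (\<Sum>w\<in>V0. \<nu> (?g w) *\<^sub>R U w)"
      using S1 by (simp add: linear_sum[OF lin] linear_scale[OF lin])
    also have "\<dots> = (\<Sum>w\<in>V0. \<nu> (?g w) *\<^sub>R ?g w)"
      by (simp add: scaleR_sum_left scaleR_add_right sum.distrib)
    also have "\<dots> = m + U y" using \<nu>(3) sum[of "\<lambda>v. \<nu> v *\<^sub>R v"] by simp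
    finally show "m + U (\<Sum>w\<in>V0. \<nu> (?g w) *\<^sub>R w) = m + U y" .
  qed
  have "0 < \<nu> (?g w)" if "w \<in> V0" for w using that \<nu>(1) unfolding V0_def by blast
  then have "V0 \<subseteq> cross_vertices" by (rule delone_vertices_cross[OF rs' D _ S1 S2 y])
  then show ?thesis unfolding V0 by blast
qed

lemma half_signs_abs_double:
  assumes "half_signs \<tau>"
  shows "\<bar>2 * \<tau> $ i\<bar> = 1"
proof -
  have "\<bar>\<tau> $ i\<bar> = 1/2" using assms unfolding half_signs_def by blast
  then show ?thesis by linarith
qed

text \<open>
  The reflection in the root \<open>\<rho>\<close> exchanges the apex of the simplex with its vertex on axis \<open>k\<close>. It maps
  the facet opposite to that vertex onto a facet of the cross polytope.
\<close>

lemma reflected_facet: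
  assumes \<tau>: "half_signs \<tau>" "\<tau> \<in> odd_coset" and nn: "\<And>k. 0 \<le> barycentric \<tau> y k"
    and k: "barycentric \<tau> y (Some k) = 0"
  defines "\<rho> \<equiv> \<tau> - axis k (2 * \<tau> $ k)"
  shows "half_signs \<rho>" "\<rho> \<in> E8" "(\<Sum>i\<in>UNIV. \<bar>(y - (\<rho> \<bullet> y - 1/2) *\<^sub>R \<rho>) $ i\<bar>) \<le> 1"
proof -
  show "half_signs \<rho>" using \<tau> unfolding half_signs_def \<rho>_def by (auto simp: axis_def)
  show "\<rho> \<in> E8"
    unfolding \<rho>_def
    by (rule odd_coset_diff[OF \<tau>(2) cross_vertices_odd_coset[OF two_half_signs_axis[OF \<tau>(1)]]])
  define a where "a = barycentric \<tau> y None"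
  have ta: "\<tau> \<bullet> y = 1/2 + 3/2 * a" unfolding a_def barycentric_def by (simp add: field_simps)
  have ty: "2 * \<tau> $ i * y $ i = barycentric \<tau> y (Some i) + a / 2" for i
    unfolding a_def barycentric_def by simp
  have "\<rho> \<bullet> y = \<tau> \<bullet> y - 2 * \<tau> $ k * y $ k"
    unfolding \<rho>_def by (simp add: inner_diff_left inner_axis')
  then have \<rho>y: "\<rho> \<bullet> y - 1/2 = a" using ta ty[of k] k by simp
  have yi: "y $ i = 2 * \<tau> $ i * (barycentric \<tau> y (Some i) + a / 2)" for i
    unfolding ty[symmetric] using half_signs_four[OF \<tau>(1), of i "y $ i"] by (simp add: mult_ac)
  have "\<bar>(y - a *\<^sub>R \<rho>) $ i\<bar> = barycentric \<tau> y (Some i) + (if i = k then a else 0)" for i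
  proof -
    have "(y - a *\<^sub>R \<rho>) $ i = 2 * \<tau> $ i * (barycentric \<tau> y (Some i) + (if i = k then a else 0))"
      unfolding \<rho>_def using yi[of i] k by (auto simp: axis_def algebra_simps)
    moreover have "\<bar>2 * \<tau> $ i\<bar> = 1" by (rule half_signs_abs_double[OF \<tau>(1)])
    moreover have "0 \<le> barycentric \<tau> y (Some i) + (if i = k then a else 0)"
      using nn[of "Some i"] nn[of None] unfolding a_def by simp
    ultimately show ?thesis by (simp add: abs_mult)
  qed
  then have "(\<Sum>i\<in>UNIV. \<bar>(y - a *\<^sub>R \<rho>) $ i\<bar>) = (\<Sum>i\<in>UNIV. barycentric \<tau> y (Some i)) + a"
    by (simp add: sum.distrib)
  also have "\<dots> = 1" using barycentric_sum(1)[OF \<tau>(1), of y] unfolding sum_UNIV_option a_def by simp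
  finally show "(\<Sum>i\<in>UNIV. \<bar>(y - (\<rho> \<bullet> y - 1/2) *\<^sub>R \<rho>) $ i\<bar>) \<le> 1" unfolding \<rho>y by simp
qed

lemma apex_facet:
  assumes \<tau>: "half_signs \<tau>" and nn: "\<And>k. 0 \<le> barycentric \<tau> y k" and k: "barycentric \<tau> y None = 0"
  shows "(\<Sum>i\<in>UNIV. \<bar>y $ i\<bar>) \<le> 1"
proof -
  have ty: "2 * \<tau> $ i * y $ i = barycentric \<tau> y (Some i)" for i
    using k unfolding barycentric_def by simp
  have "\<bar>y $ i\<bar> = barycentric \<tau> y (Some i)" for i
  proof -
    have "\<bar>2 * \<tau> $ i\<bar> = 1" by (rule half_signs_abs_double[OF \<tau>])
    then have "\<bar>y $ i\<bar> = \<bar>2 * \<tau> $ i * y $ i\<bar>" by (simp add: abs_mult)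
    then show ?thesis unfolding ty using nn by simp
  qed
  then show ?thesis using barycentric_sum(1)[OF \<tau>, of y] k unfolding sum_UNIV_option by simp
qed

lemma E8_cover:
  assumes rs: "root_pair r s"
  obtains v where "v \<in> E8" "deformed_form r s (v - x) \<le> radius_sq"
proof -
  obtain m U y where f: "hole_frame m U" and x: "x = m + U y"
    and half: "\<forall>\<rho>\<in>E8. half_signs \<rho> \<longrightarrow> \<rho> \<bullet> y \<le> 1/2"
    using cell_coordinates[of x] by blast
  obtain r' s' where rs': "root_pair r' s'" and eq: "\<And>x. deformed_form r s (U x) = deformed_form r' s' x"
    using hole_frame_pair[OF f rs] by blast
  obtain w where w: "w \<in> odd_coset" "deformed_form r' s' (w - y) \<le> radius_sq"
    using half
  proof (cases rule: cross_polytope_or_simplex)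
    case cross
    then show thesis by (rule cross_cover[OF rs']) (rule that)
  next
    case (simplex \<tau> l l0)
    have "0 \<le> barycentric \<tau> y k" for k
      using barycentric_eqI[OF simplex(1,5,6)] simplex(3,4) by (cases k) auto
    then show thesis by (rule simplex_cover[OF rs' simplex(1,2)]) (rule that)
  qed
  have "m + U w \<in> E8" using f w unfolding hole_frame_def by blast
  moreover have "deformed_form r s (m + U w - x) = deformed_form r' s' (w - y)"
    unfolding x using eq[of "w - y"] by (simp add: hole_frame_diff(1)[OF f])
  ultimately show thesis using that w by simp
qed

text \<open>
  Consider the cell of the barycentre \<open>x\<close> of \<open>V\<close>. If it is a cross polytope, it contains \<open>V\<close>. If it is a
  simplex that does not contain some \<open>v \<in> V\<close>, then the segment from \<open>x\<close> to \<open>v\<close> leaves it through a facet.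
  Every facet belongs to a cross polytope, and the exit point is still a combination of all of \<open>V\<close> with
  positive weights, so this cross polytope contains \<open>V\<close>.
\<close>

lemma E8_refinement:
  assumes rs: "root_pair r s" and V: "delone_vertices E8 (deformed_form r s) V"
  obtains W where "delone_vertices E8 (\<lambda>x. x \<bullet> x) W" "V \<subseteq> W"
proof -
  have fin: "finite V" "V \<noteq> {}" "V \<subseteq> E8" using V unfolding delone_vertices_def by auto
  define n where "n = real (card V)"
  have n: "0 < n" unfolding n_def using fin by (simp add: card_gt_0_iff)
  define x where "x = (\<Sum>v\<in>V. (1 / n) *\<^sub>R v)"
  note result = that
  have in_cross: thesis if f: "hole_frame m U" and y: "(\<Sum>i\<in>UNIV. \<bar>y $ i\<bar>) \<le> 1"
    and \<nu>: "\<And>v. v \<in> V \<Longrightarrow> 0 < \<nu> v" "(\<Sum>v\<in>V. \<nu> v) = 1" "(\<Sum>v\<in>V. \<nu> v *\<^sub>R v) = m + U y" for m U y \<nu>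
    by (rule result[OF hole_frame_delone_push[OF f cross_vertices_delone] hole_frame_cross[OF f rs V \<nu> y]])
  obtain m U y where f: "hole_frame m U" and x: "x = m + U y"
    and half: "\<forall>\<rho>\<in>E8. half_signs \<rho> \<longrightarrow> \<rho> \<bullet> y \<le> 1/2"
    using cell_coordinates[of x] by blast
  have sum1: "(\<Sum>v\<in>V. 1 / n) = 1" using n unfolding n_def by simp
  show thesis
    using half
  proof (cases rule: cross_polytope_or_simplex)
    case cross
    show thesis by (rule in_cross[OF f cross, of "\<lambda>_. 1 / n"]) (use n sum1 x x_def in auto)
  next
    case (simplex \<tau> l l0)
    note \<tau> = simplex(1,2)
    have nn: "0 \<le> barycentric \<tau> y k" for k
      using barycentric_eqI[OF simplex(1,5,6)] simplex(3,4) by (cases k) auto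
    let ?S = "(\<lambda>w. m + U w) ` range (simplex_vertex \<tau>)"
    show thesis
    proof (cases "V \<subseteq> ?S")
      case True
      show thesis by (rule result[OF hole_frame_delone_push[OF f simplex_delone[OF \<tau>]] True])
    next
      case False
      then obtain v where v: "v \<in> V" "v \<notin> ?S" by blast
      have "v \<in> (\<lambda>w. m + U w) ` odd_coset" using v fin f unfolding hole_frame_def by auto
      then obtain w where w: "w \<in> odd_coset" "v = m + U w" by blast
      have "w \<notin> range (simplex_vertex \<tau>)" using v w by blast
      then obtain k0 where "barycentric \<tau> w k0 < 0" using barycentric_outside[OF \<tau>(1) w(1)] by blast
      then obtain t k where t: "0 \<le> t" "t < 1"
        and b: "\<And>k. 0 \<le> (1 - t) * barycentric \<tau> y k + t * barycentric \<tau> w k"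
        and k: "(1 - t) * barycentric \<tau> y k + t * barycentric \<tau> w k = 0"
        using exit_parameter[of UNIV "barycentric \<tau> y" k0 "barycentric \<tau> w"] nn by auto
      define z where "z = (1 - t) *\<^sub>R y + t *\<^sub>R w"
      have bz: "0 \<le> barycentric \<tau> z k'" "barycentric \<tau> z k = 0" for k'
        unfolding z_def barycentric_affine using b k by auto
      define \<nu> where "\<nu> v' = (1 - t) * (1 / n) + (if v' = v then t else 0)" for v'
      have \<nu>0: "0 < \<nu> v'" for v' unfolding \<nu>_def using t n by (simp add: add_pos_nonneg)
      have \<nu>1: "(\<Sum>v\<in>V. \<nu> v) = 1"
        unfolding \<nu>_def using fin v(1) sum1 by (simp add: sum.distrib flip: sum_distrib_left)
      have "(\<Sum>v'\<in>V. \<nu> v' *\<^sub>R v') = (\<Sum>v'\<in>V. (1 - t) *\<^sub>R ((1 / n) *\<^sub>R v') + (if v' = v then t *\<^sub>R v' else 0))"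
        unfolding \<nu>_def by (intro sum.cong) (auto simp: scaleR_left_distrib)
      also have "\<dots> = (1 - t) *\<^sub>R x + t *\<^sub>R v"
        unfolding x_def using fin v(1) by (simp add: sum.distrib scaleR_sum_right)
      also have "\<dots> = m + U z"
        unfolding x w(2) z_def by (simp add: hole_frame_diff[OF f] algebra_simps)
      finally have \<nu>z: "(\<Sum>v\<in>V. \<nu> v *\<^sub>R v) = m + U z" .
      show thesis
      proof (cases k)
        case None
        show thesis
          by (rule in_cross[OF f apex_facet[OF \<tau>(1) bz(1)], of \<nu>]) (use bz(2) None \<nu>0 \<nu>1 \<nu>z in auto)
      next
        case (Some i)
        define \<rho> where "\<rho> = \<tau> - axis i (2 * \<tau> $ i)"
        note \<rho> = reflected_facet[OF \<tau> bz(1) bz(2)[unfolded Some], folded \<rho>_def]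
        define z' where "z' = z - (\<rho> \<bullet> z - 1/2) *\<^sub>R \<rho>"
        have "(1/2) *\<^sub>R \<rho> + (z' - (\<rho> \<bullet> z') *\<^sub>R \<rho>) = z"
        proof -
          have "\<rho> \<bullet> z' = 1 - \<rho> \<bullet> z"
            unfolding z'_def by (simp add: inner_diff_right half_signs_inner[OF \<rho>(1)])
          moreover have "(1/2) *\<^sub>R \<rho> + (z - (c - 1/2) *\<^sub>R \<rho> - (1 - c) *\<^sub>R \<rho>) = z" for c
            by (simp add: vec_eq_iff algebra_simps)
          ultimately show ?thesis by (simp only: z'_def)
        qed
        then have "m + U z = (m + U ((1/2) *\<^sub>R \<rho>)) + U (z' - (\<rho> \<bullet> z') *\<^sub>R \<rho>)"
          using hole_frame_diff(2)[OF f] by (metis add.assoc)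
        then show thesis
          using \<nu>z by (intro in_cross[OF hole_frame_reflect[OF f \<rho>(1,2)] \<rho>(3) \<nu>0 \<nu>1]) (simp add: z'_def)
      qed
    qed
  qed
qed


section \<open>A basis of the root lattice\<close>

text \<open>
  Twice one coordinate \<open>y\<^sub>p\<close> tells how often to subtract the all-halves vector; what remains is integral with
  even sum, and the coordinate \<open>q\<close> takes care of the parity. With \<open>p\<close> first and \<open>q\<close> last the matrix
  is lower triangular.
\<close>

lemma E8_basis_exists:
  obtains B :: "real ^ 8 ^ 8" where "lattice_basis B E8" "det B = 1"
proof -
  define p :: 8 where "p = Min UNIV"
  define q :: 8 where "q = Max UNIV"
  have p: "p \<le> i" and q: "i \<le> q" for i unfolding p_def q_def by simp_all
  have pq: "p \<noteq> q"
  proof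
    assume "p = q"
    then have "i = p" for i using p[of i] q[of i] by simp
    then have "(UNIV :: 8 set) = {p}" by auto
    then have "card (UNIV :: 8 set) = card {p}" by (rule arg_cong)
    then show False by simp
  qed
  define B :: "real ^ 8 ^ 8" where "B = (\<chi> i j. if j = p then 1/2 else
    if i = q then (if j = q then 2 else -1) else if i = j then 1 else 0)"
  have "det B = (\<Prod>i\<in>UNIV. B $ i $ i)"
  proof (rule det_lowerdiagonal)
    fix i j :: 8 assume "i < j"
    then have "j \<noteq> p" "i \<noteq> q" "i \<noteq> j" using p[of i] q[of j] by auto
    then show "B $ i $ j = 0" unfolding B_def by simp
  qed
  also have "\<dots> = (\<Prod>i\<in>UNIV. if i = p then 1/2 else 1) * (\<Prod>i\<in>UNIV. if i = q then 2 else 1)"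
    unfolding prod.distrib[symmetric] using pq by (intro prod.cong) (auto simp: B_def)
  finally have det: "det B = 1" by simp
  have Bx: "(B *v x) $ i = (if i = p then x $ p / 2
      else if i = q then 3/2 * x $ p + 3 * x $ q - (\<Sum>j\<in>UNIV. x $ j) else x $ p / 2 + x $ i)" for x i
  proof -
    have "B $ i $ j * x $ j = (if i = p then (if j = p then x $ p / 2 else 0)
      else if i = q then (if j = p then 3/2 * x $ p else 0) + (if j = q then 3 * x $ q else 0) - x $ j
      else (if j = p then x $ p / 2 else 0) + (if j = i then x $ i else 0))" for j
      using pq by (auto simp: B_def)
    then have "(B *v x) $ i = (\<Sum>j\<in>UNIV. if i = p then (if j = p then x $ p / 2 else 0)
      else if i = q then (if j = p then 3/2 * x $ p else 0) + (if j = q then 3 * x $ q else 0) - x $ j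
      else (if j = p then x $ p / 2 else 0) + (if j = i then x $ i else 0))"
      by (simp only: matrix_vector_mult_def vec_lambda_beta)
    then show ?thesis by (cases "i = p"; cases "i = q"; simp add: sum.distrib sum_subtractf)
  qed
  have sumB: "(\<Sum>i\<in>UNIV. (B *v x) $ i) = 4 * x $ p + 2 * x $ q" for x
  proof -
    have "(B *v x) $ i = x $ i + x $ p / 2 + (if i = p then - x $ p else 0)
        + (if i = q then x $ p + 2 * x $ q - (\<Sum>j\<in>UNIV. x $ j) else 0)" for i
      unfolding Bx using pq by auto
    then show ?thesis by (simp add: sum.distrib)
  qed
  have "E8 = (\<lambda>x. B *v x) ` integer_vectors"
  proof (intro equalityI subsetI)
    fix y :: "real ^ 8" assume y: "y \<in> E8"
    define x where "x = (\<chi> i. if i = p then 2 * y $ p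
      else if i = q then (\<Sum>j\<in>UNIV. y $ j) / 2 - 4 * y $ p else y $ i - y $ p)"
    have x_eq: "x $ i = y $ i - y $ p + (if i = p then 2 * y $ p else 0)
        + (if i = q then (\<Sum>j\<in>UNIV. y $ j) / 2 - 3 * y $ p - y $ q else 0)" for i
      unfolding x_def using pq by auto
    have xp: "x $ p = 2 * y $ p" and xq: "x $ q = (\<Sum>j\<in>UNIV. y $ j) / 2 - 4 * y $ p"
      unfolding x_def using pq by auto
    have sumx: "(\<Sum>j\<in>UNIV. x $ j) = 3/2 * (\<Sum>j\<in>UNIV. y $ j) - 9 * y $ p - y $ q"
      unfolding x_eq by (simp add: sum.distrib sum_subtractf)
    have "B *v x = y"
      unfolding vec_eq_iff Bx xp xq sumx using pq by (auto simp: x_def)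
    moreover have "x \<in> integer_vectors"
    proof -
      obtain a where a: "\<And>i. y $ i = real_of_int (a i) / 2" "(\<forall>i. even (a i)) \<or> (\<forall>i. odd (a i))"
        using E8_double_coordinates[OF y] by blast
      have diff: "y $ i - y $ p \<in> \<int>" for i
      proof -
        have "even (a i - a p)" using a(2) by auto
        then obtain k where "a i - a p = 2 * k" by blast
        then have "a i = a p + 2 * k" by simp
        then have "y $ i - y $ p = of_int k" unfolding a(1) by (simp add: add_divide_distrib)
        then show ?thesis by simp
      qed
      have "2 * y $ p = of_int (a p)" "4 * y $ p = of_int (2 * a p)" unfolding a(1) by simp_all
      then have "2 * y $ p \<in> \<int>" "4 * y $ p \<in> \<int>" by (metis Ints_of_int)+
      moreover have "(\<Sum>j\<in>UNIV. y $ j) / 2 \<in> \<int>" using y unfolding E8_iff by blast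
      ultimately show ?thesis unfolding integer_vectors_def x_def using diff by auto
    qed
    ultimately show "y \<in> (\<lambda>x. B *v x) ` integer_vectors" by blast
  next
    fix y assume "y \<in> (\<lambda>x. B *v x) ` integer_vectors"
    then obtain x where x: "x \<in> integer_vectors" "y = B *v x" by blast
    have xi: "x $ i \<in> \<int>" for i using x(1) unfolding integer_vectors_def by blast
    have coord: "y $ i - x $ p / 2 \<in> \<int>" for i
    proof (cases "i = q")
      case True
      have "y $ i - x $ p / 2 = x $ p + 3 * x $ q - (\<Sum>j\<in>UNIV. x $ j)"
        unfolding x(2) Bx using True pq by simp
      then show ?thesis using xi by (auto intro!: Ints_add Ints_diff Ints_sum)
    next
      case False
      then show ?thesis unfolding x(2) Bx using xi by auto
    qed
    obtain n where n: "x $ p = of_int n" using xi[of p] by (auto elim: Ints_cases)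
    have "(\<forall>i. y $ i \<in> \<int>) \<or> (\<forall>i. y $ i - 1/2 \<in> \<int>)"
    proof (cases "even n")
      case True
      then obtain k where "x $ p / 2 = of_int k" using n by auto
      then show ?thesis using coord Ints_add[OF coord Ints_of_int[of k]] by simp
    next
      case False
      then obtain k where "n = 2 * k + 1" by (auto elim: oddE)
      then have "x $ p / 2 = of_int k + 1/2" using n by simp
      then have "y $ i - 1/2 = (y $ i - x $ p / 2) + of_int k" for i by linarith
      then show ?thesis using coord by (metis Ints_add Ints_of_int)
    qed
    moreover have "(\<Sum>i\<in>UNIV. y $ i) / 2 = 2 * x $ p + x $ q" unfolding x(2) sumB by simp
    then have "(\<Sum>i\<in>UNIV. y $ i) / 2 \<in> \<int>" using xi by (metis Ints_add Ints_mult Ints_numeral)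
    ultimately show "y \<in> E8" unfolding E8_iff by blast
  qed
  then show thesis
    using that[of B] det unfolding lattice_basis_def by (simp add: invertible_det_nz)
qed

section \<open>The deforming map\<close>

text \<open>
  Rotating a coordinate axis to the direction of \<open>a\<close> makes the map diagonal.
\<close>

lemma det_rank_one:
  fixes a :: "real ^ 'n::finite"
  shows "det (matrix (\<lambda>x. x - (k * (a \<bullet> x)) *\<^sub>R a)) = 1 - k * (a \<bullet> a)"
proof (cases "a = 0")
  case True
  then show ?thesis by (simp add: matrix_id flip: id_def)
next
  case False
  define j :: 'n where "j = undefined"
  obtain R where R: "orthogonal_matrix R" "R *v axis j 1 = (1 / norm a) *\<^sub>R a"
    using orthogonal_matrix_exists_basis[of "(1 / norm a) *\<^sub>R a" j] False by auto
  have Ra: "a = norm a *\<^sub>R (R *v axis j 1)" unfolding R(2) using False by simp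
  have RT: "R ** transpose R = mat 1" "transpose R ** R = mat 1"
    using R(1) unfolding orthogonal_matrix_def by auto
  define D :: "real ^ 'n ^ 'n" where
    "D = (\<chi> i i'. if i = i' then (if i = j then 1 - k * (a \<bullet> a) else 1) else 0)"
  have "det D = (\<Prod>i\<in>UNIV. if i = j then 1 - k * (a \<bullet> a) else 1)"
    by (subst det_diagonal) (simp_all add: D_def)
  then have detD: "det D = 1 - k * (a \<bullet> a)" by simp
  have lin: "linear (\<lambda>x. x - (k * (a \<bullet> x)) *\<^sub>R a)"
    by (intro linearI) (simp_all add: inner_add_right algebra_simps)
  have "matrix (\<lambda>x. x - (k * (a \<bullet> x)) *\<^sub>R a) = R ** D ** transpose R"
  proof (rule matrix_eq[THEN iffD2], rule allI)
    fix x
    define z where "z = transpose R *v x"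
    have x: "x = R *v z" unfolding z_def by (metis RT(1) matrix_vector_mul_assoc matrix_vector_mul_lid)
    have "a \<bullet> x = norm a * ((R *v axis j 1) \<bullet> (R *v z))" by (subst Ra) (simp add: x)
    also have "(R *v axis j 1) \<bullet> (R *v z) = axis j 1 \<bullet> z"
      by (metis RT(2) dot_lmul_matrix matrix_vector_mul_assoc matrix_vector_mul_lid transpose_matrix_vector)
    finally have ax: "a \<bullet> x = norm a * z $ j" by (simp add: inner_axis')
    have "D *v z = z - axis j (k * (a \<bullet> a) * z $ j)"
    proof (rule vec_eq_iff[THEN iffD2], rule allI)
      fix i
      have "D $ i $ l * z $ l = (if l = i then (if i = j then 1 - k * (a \<bullet> a) else 1) * z $ i else 0)" for l
        unfolding D_def by simp
      then have "(D *v z) $ i = (if i = j then 1 - k * (a \<bullet> a) else 1) * z $ i"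
        unfolding matrix_vector_mult_def by simp
      then show "(D *v z) $ i = (z - axis j (k * (a \<bullet> a) * z $ j)) $ i"
        by (simp add: axis_def algebra_simps)
    qed
    also have "axis j (k * (a \<bullet> a) * z $ j) = (k * (a \<bullet> a) * z $ j) *\<^sub>R axis j 1"
      by (simp add: vec_eq_iff axis_def)
    finally have "R *v (D *v z) = R *v z - (k * (a \<bullet> a) * z $ j) *\<^sub>R (R *v axis j 1)"
      by (simp add: matrix_vector_mult_diff_distrib matrix_vector_mult_scaleR)
    also have "(k * (a \<bullet> a) * z $ j) *\<^sub>R (R *v axis j 1) = (k * (a \<bullet> x)) *\<^sub>R a"
      unfolding R(2) ax using False by (simp add: dot_square_norm power2_eq_square)
    finally have "R *v (D *v z) = x - (k * (a \<bullet> x)) *\<^sub>R a" unfolding x[symmetric] .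
    then show "matrix (\<lambda>x. x - (k * (a \<bullet> x)) *\<^sub>R a) *v x = R ** D ** transpose R *v x"
      unfolding fun_cong[OF matrix_vector_mul(2)[OF lin]] z_def matrix_vector_mul_assoc matrix_mul_assoc
      by (rule sym)
  qed
  then have "det (matrix (\<lambda>x. x - (k * (a \<bullet> x)) *\<^sub>R a)) = det D * (det R * det (transpose R))"
    by (simp add: det_mul)
  also have "det R * det (transpose R) = 1" using RT(1) by (metis det_mul det_I)
  finally show ?thesis using detD by simp
qed

text \<open>
  Scale by \<open>sqrt (1 - 2 * \<beta>)\<close> along \<open>r\<close> and by \<open>sqrt (1 - 14 * \<gamma>)\<close> along the vector orthogonal to it.
\<close>

lemma deforming_map:
  assumes rs: "root_pair r s"
  obtains T :: "real ^ 8 ^ 8" where "\<And>x. (T *v x) \<bullet> (T *v x) = deformed_form r s x"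
    "det T = sqrt (1 - 2 * \<beta>) * sqrt (1 - 14 * \<gamma>)"
proof -
  let ?u = "perp r s"
  define c1 where "c1 = sqrt (1 - 2 * \<beta>)"
  define c2 where "c2 = sqrt (1 - 14 * \<gamma>)"
  define k1 where "k1 = (1 - c1) / 2"
  define k2 where "k2 = (1 - c2) / 14"
  have c: "c1 * c1 = 1 - 2 * \<beta>" "c2 * c2 = 1 - 14 * \<gamma>"
    unfolding c1_def c2_def by (simp_all add: \<beta>_def \<gamma>_def)
  have rr: "r \<bullet> r = 2" using rs unfolding root_pair_def by simp
  note uu = perp_inner[OF rs]
  define f where "f x = x - (k1 * (r \<bullet> x)) *\<^sub>R r" for x
  define g where "g x = x - (k2 * (?u \<bullet> x)) *\<^sub>R ?u" for x
  have lin: "linear f" "linear g"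
    unfolding f_def g_def by (intro linearI; simp add: inner_add_right algebra_simps)+
  define T where "T = matrix f ** matrix g"
  have "det T = (1 - k1 * 2) * (1 - k2 * 14)"
    unfolding T_def det_mul f_def g_def det_rank_one rr uu ..
  moreover have "1 - k1 * 2 = c1" "1 - k2 * 14 = c2" unfolding k1_def k2_def by (simp_all add: field_simps)
  ultimately have "det T = c1 * c2" by simp
  moreover have "(T *v x) \<bullet> (T *v x) = deformed_form r s x" for x
  proof -
    define P where "P = r \<bullet> x"
    define Q where "Q = ?u \<bullet> x"
    have "T *v x = f (g x)"
      unfolding T_def by (simp add: fun_cong[OF matrix_vector_mul(2)[OF lin(1)]] fun_cong[OF matrix_vector_mul(2)[OF lin(2)]] flip: matrix_vector_mul_assoc)
    also have "\<dots> = x - (k2 * Q) *\<^sub>R ?u - (k1 * P) *\<^sub>R r"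
      unfolding f_def g_def P_def Q_def by (simp add: inner_diff_right uu)
    finally have Tx: "T *v x = x - (k2 * Q) *\<^sub>R ?u - (k1 * P) *\<^sub>R r" .
    have "(T *v x) \<bullet> (T *v x) = x \<bullet> x - (2 * k1 - 2 * k1 * k1) * P\<^sup>2 - (2 * k2 - 14 * k2 * k2) * Q\<^sup>2"
      unfolding Tx by (simp add: inner_diff_left inner_diff_right uu rr P_def Q_def inner_commute power2_eq_square algebra_simps)
    also have "2 * k1 - 2 * k1 * k1 = (1 - c1 * c1) / 2" unfolding k1_def by (simp add: field_simps)
    also have "2 * k2 - 14 * k2 * k2 = (1 - c2 * c2) / 14" unfolding k2_def by (simp add: field_simps)
    finally show ?thesis unfolding c deformed_form_def P_def Q_def by simp
  qed
  ultimately show thesis using that unfolding c1_def c2_def by blast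
qed

section \<open>The improved lattice\<close>

lemma quad_form_gram: "quad_form (transpose A ** A) x = (A *v x) \<bullet> (A *v x)"
  unfolding quad_form_def
  by (metis dot_lmul_matrix matrix_vector_mul_assoc transpose_matrix_vector transpose_transpose inner_commute)

lemma PQF_gram:
  assumes "invertible A"
  shows "PQF (transpose A ** A)"
  unfolding PQF_def
proof (intro conjI allI impI)
  show "transpose (transpose A ** A) = transpose A ** A"
    by (simp add: matrix_transpose_mul)
  fix x :: "real ^ 'a" assume "x \<noteq> 0"
  then have "A *v x \<noteq> 0" using assms inj_matrix_vector_mult
    by (metis injD matrix_vector_mult_0_right)
  then show "0 < quad_form (transpose A ** A) x" unfolding quad_form_gram by simp
qed

lemma is_refinement_refl: "is_refinement D D"
  unfolding is_refinement_def by blast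

text \<open>
  Multiplication by \<open>B\<close> translates Delone polytopes in integer coordinates into empty spheres of the root
  lattice.
\<close>

lemma refinement_of_Delone_vertices:
  fixes A B :: "real ^ 8 ^ 8"
  assumes B: "lattice_basis B E8" and A: "\<And>x. (A *v x) \<bullet> (A *v x) = deformed_form r s (B *v x)"
    and rs: "root_pair r s"
  shows "is_refinement (Del (transpose A ** A)) (Del (transpose B ** B))"
  unfolding is_refinement_def
proof
  fix P' assume "P' \<in> Del (transpose A ** A)"
  then obtain V c \<rho> where V: "finite V" "V \<noteq> {}" "V \<subseteq> integer_vectors" "P' = convex hull V"
    and on: "\<And>v. v \<in> V \<Longrightarrow> quad_form (transpose A ** A) (v - c) = \<rho>\<^sup>2"
    and out: "\<And>v. v \<in> integer_vectors - V \<Longrightarrow> quad_form (transpose A ** A) (v - c) > \<rho>\<^sup>2"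
    unfolding Del_def delone_polytope_def by blast
  have E8: "E8 = (\<lambda>x. B *v x) ` integer_vectors" and inv: "invertible B"
    using B unfolding lattice_basis_def by auto
  have inj: "inj ((*v) B)" using inv inj_matrix_vector_mult by blast
  have form: "deformed_form r s (B *v v - B *v c) = quad_form (transpose A ** A) (v - c)" for v
    unfolding quad_form_gram A by (simp add: matrix_vector_mult_diff_distrib)
  have "delone_vertices E8 (deformed_form r s) ((*v) B ` V)"
    unfolding delone_vertices_def
  proof (intro conjI exI[of _ "B *v c"] exI[of _ "\<rho>\<^sup>2"] ballI)
    show "deformed_form r s (w - B *v c) = \<rho>\<^sup>2" if "w \<in> (*v) B ` V" for w
      using that form on by auto
    show "\<rho>\<^sup>2 < deformed_form r s (w - B *v c)" if w: "w \<in> E8 - (*v) B ` V" for w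
    proof -
      obtain v where v: "v \<in> integer_vectors" "w = B *v v" using w unfolding E8 by blast
      then have "v \<in> integer_vectors - V" using w by blast
      then show ?thesis using out unfolding v(2) form by blast
    qed
  qed (use V E8 in auto)
  then obtain W where W: "delone_vertices E8 (\<lambda>x. x \<bullet> x) W" "(*v) B ` V \<subseteq> W"
    using E8_refinement[OF rs] by blast
  then obtain c' R where fin: "finite W" "W \<noteq> {}" "W \<subseteq> E8"
    and onW: "\<And>w. w \<in> W \<Longrightarrow> (w - c') \<bullet> (w - c') = R"
    and outW: "\<And>w. w \<in> E8 - W \<Longrightarrow> R < (w - c') \<bullet> (w - c')"
    unfolding delone_vertices_def by blast
  define W0 where "W0 = integer_vectors \<inter> (*v) B -` W"
  have W_eq: "W = (*v) B ` W0" using fin(3) unfolding W0_def E8 by blast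
  obtain B' where B': "B ** B' = mat 1" using inv unfolding invertible_def by blast
  define d where "d = B' *v c'"
  have d: "B *v d = c'" unfolding d_def by (metis B' matrix_vector_mul_assoc matrix_vector_mul_lid)
  have formW: "quad_form (transpose B ** B) (v - d) = (B *v v - c') \<bullet> (B *v v - c')" for v
    unfolding quad_form_gram d[symmetric] by (simp add: matrix_vector_mult_diff_distrib)
  have "0 \<le> R" using fin(2) onW by (metis ex_in_conv inner_ge_zero)
  then have R: "(sqrt R)\<^sup>2 = R" by simp
  have "delone_polytope (transpose B ** B) (convex hull W0)"
    unfolding delone_polytope_def
  proof (intro exI conjI ballI)
    show "finite W0" using fin(1) inj unfolding W_eq by (metis finite_imageD inj_on_subset subset_UNIV)
    show "W0 \<noteq> {}" using fin(2) W_eq by auto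
    show "W0 \<subseteq> integer_vectors" unfolding W0_def by simp
    show "quad_form (transpose B ** B) (v - d) = (sqrt R)\<^sup>2" if "v \<in> W0" for v
      using that onW unfolding formW R W0_def by blast
    show "quad_form (transpose B ** B) (v - d) > (sqrt R)\<^sup>2" if "v \<in> integer_vectors - W0" for v
      using that outW[of "B *v v"] unfolding formW R W0_def E8 by blast
  qed simp
  moreover have "V \<subseteq> W0" using V(3) W(2) unfolding W0_def by blast
  then have "P' \<subseteq> convex hull W0" unfolding V(4) by (rule hull_mono)
  ultimately show "\<exists>P\<in>Del (transpose B ** B). P' \<subseteq> P" unfolding Del_def by blast
qed

lemma root_pair_exists: "root_pair (\<chi> i. 1/2) (2 *\<^sub>R axis 1 1)"
proof -
  have "(2 *\<^sub>R axis 1 1 :: real ^ 8) \<in> E8" using two_axis_E8[of 1] by (simp add: scaleR_2)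
  moreover have "(\<chi> i. 1/2 :: real ^ 8) \<in> E8" unfolding E8_iff by simp
  moreover have "(\<chi> i. 1/2 :: real ^ 8) \<bullet> (\<chi> i. 1/2) = 2" by (simp add: inner_vec_def)
  moreover have "(\<chi> i. 1/2 :: real ^ 8) \<bullet> (2 *\<^sub>R axis 1 1) = 1" by (simp add: inner_axis)
  ultimately show ?thesis unfolding root_pair_def by (simp add: inner_axis_axis)
qed

text \<open>
  The margin dictates the precision of the rational estimates: with this radius the density is about
  3.201293.
\<close>

lemma density_bound:
  "radius_sq ^ 4 * unit_ball_vol 8 < 3.2013 * (sqrt (1 - 2 * \<beta>) * sqrt (1 - 14 * \<gamma>))"
proof -
  have "pi ^ 4 \<le> 3.1415926535899 ^ 4" using pi_approx(2) pi_ge_zero by (intro power_mono) auto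
  then have "radius_sq ^ 4 * unit_ball_vol 8 \<le> radius_sq ^ 4 * (3.1415926535899 ^ 4 / 24)"
    by (intro mult_left_mono) (simp_all add: unit_ball_vol_numeral fact_numeral radius_sq_def)
  also have "\<dots> < 3.2013 * (0.8649555 * 0.8663925)"
    unfolding radius_sq_def by (simp add: power_numeral_reduce)
  also have "\<dots> \<le> 3.2013 * (sqrt (1 - 2 * \<beta>) * sqrt (1 - 14 * \<gamma>))"
    by (intro mult_left_mono mult_mono real_le_rsqrt) (simp_all add: \<beta>_def \<gamma>_def power2_eq_square)
  finally show ?thesis .
qed

theorem theorem1p2:
  "\<exists>L :: (real ^ 8) set.
     is_lattice L \<and> covering_density L < 3.2013 \<and> have_common_refinement L E8"
proof -
  obtain r s where rs: "root_pair r s" using root_pair_exists by blast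
  obtain B :: "real ^ 8 ^ 8" where B: "lattice_basis B E8" "det B = 1" by (rule E8_basis_exists)
  obtain T :: "real ^ 8 ^ 8" where T: "\<And>x. (T *v x) \<bullet> (T *v x) = deformed_form r s x"
    "det T = sqrt (1 - 2 * \<beta>) * sqrt (1 - 14 * \<gamma>)" using deforming_map[OF rs] by blast
  define A where "A = T ** B"
  define L where "L = (\<lambda>x. A *v x) ` integer_vectors"
  have detA: "det A = sqrt (1 - 2 * \<beta>) * sqrt (1 - 14 * \<gamma>)"
    unfolding A_def by (simp add: det_mul T B)
  have pos: "0 < det A" unfolding detA by (simp add: \<beta>_def \<gamma>_def)
  then have inv: "invertible A" by (simp add: invertible_det_nz)
  have basis: "lattice_basis A L" unfolding lattice_basis_def L_def using inv by simp
  then have L: "is_lattice L" unfolding is_lattice_def by blast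
  have L_eq: "L = (*v) T ` E8"
  proof -
    have E8: "E8 = (\<lambda>x. B *v x) ` integer_vectors" using B(1) unfolding lattice_basis_def by blast
    show ?thesis unfolding L_def A_def E8 image_image matrix_vector_mul_assoc ..
  qed
  have cover: "\<exists>v\<in>L. dist v x \<le> sqrt radius_sq" for x
  proof -
    have "det T \<noteq> 0" using pos unfolding A_def by (simp add: det_mul B)
    then obtain T' where T': "T ** T' = mat 1" unfolding invertible_det_nz[symmetric] invertible_def by blast
    have x: "x = T *v (T' *v x)" by (simp add: matrix_vector_mul_assoc T')
    obtain v where v: "v \<in> E8" "deformed_form r s (v - T' *v x) \<le> radius_sq" using E8_cover[OF rs] by blast
    have "dist (T *v v) x = norm (T *v (v - T' *v x))"
      by (subst x) (simp add: dist_norm matrix_vector_mult_diff_distrib)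
    also have "\<dots> \<le> sqrt radius_sq" using v(2) by (simp add: norm_eq_sqrt_inner T(1))
    finally show ?thesis using v(1) unfolding L_eq by blast
  qed
  have "covering_radius L ^ 8 \<le> sqrt radius_sq ^ 8"
    using covering_radius_le[OF L cover] by (intro power_mono) auto
  also have "sqrt radius_sq ^ 8 = (sqrt radius_sq ^ 2) ^ 4" by (simp flip: power_mult)
  also have "\<dots> = radius_sq ^ 4" by (simp add: radius_sq_def)
  finally have "covering_radius L ^ 8 * unit_ball_vol 8 \<le> radius_sq ^ 4 * unit_ball_vol 8"
    by (intro mult_right_mono) simp_all
  also have "\<dots> < 3.2013 * det A" unfolding detA by (rule density_bound)
  finally have "covering_density L < 3.2013"
    unfolding covering_density_def lattice_det_eq[OF basis] using pos by (simp add: pos_divide_less_eq)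
  moreover have "(A *v x) \<bullet> (A *v x) = deformed_form r s (B *v x)" for x
    unfolding A_def by (simp add: T(1) flip: matrix_vector_mul_assoc)
  then have "have_common_refinement L E8"
    unfolding have_common_refinement_def associated_form_def
    using basis B(1) PQF_gram[OF inv] is_refinement_refl refinement_of_Delone_vertices[OF B(1) _ rs] by blast
  ultimately show ?thesis using L by blast
qed

end
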